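(* Let $p\ge 3$ be a prime, let $r\equiv a \bmod (p-1)$ with $1\le a\le p-1$, let $r\equiv r_0\bmod p$ with $0\le r_0\le p-1$, and let $1\le i<p-1$ with $i=[a-i]$. If $r\ge i(p+1)+p$, then there is an exact sequence of $\Gamma$-modules $$0\to W\to Q(i)\to Q(i-1)\to 0,$$ where $$W\cong\begin{cases}0, & \text{if } \binom{r-i+1}{i+1}\not\equiv 0\bmod p,\\ V_{p-1}\otimes D^{i}, & \text{if } r_0=i,\\ V_0\otimes D^{i}, & \text{if } r_0=i-1,\\ V_r^{(i)}/V_r^{(i+1)}, & \text{otherwise.}\end{cases}$$
   Context: Let $\Gamma=\mathrm{GL}_2(\mathbb{F}_p)$ and $D:\Gamma\to\mathbb{F}_p^\ast$ the determinant character. For an integer $n$, $[n]\in\{1,2,\dots,p-1\}$ denotes the element with $[n]\equiv n\bmod (p-1)$. $V_r$ is the $\mathbb{F}_p$-space of homogeneous polynomials $F(X,Y)$ of degree $r$ over $\mathbb{F}_p$, with action $\begin{pmatrix} a&b\\c&d\end{pmatrix}\cdot F(X,Y)=F(aX+cY,\,bX+dY)$. $X_{r-l}=X_{r-l,\,r}\subseteq V_r$ is the $\mathbb{F}_p[\Gamma]$-submodule generated by $X^{r-l}Y^{l}$. Let $\theta=X^pY-XY^p$ and, for $m\ge0$, $V_r^{(m)}=\{F\in V_r:\theta^m\mid F\}$, a $\Gamma$-submodule of $V_r$. For $l\ge0$, $Q(l)=V_r/(X_{r-l}+V_r^{(l+1)})$ (both $Q(i)$ and $Q(i-1)$ are formed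 from the same $V_r$). *)

theory Defs
  imports
    "HOL-Number_Theory.Number_Theory"
    "HOL-Algebra.AbelCoset"
    "Jordan_Normal_Form.VS_Connect"
    "Berlekamp_Zassenhaus.Finite_Field"
begin

hide_const (open) Polynomial.smult

section \<open>Modules with a linear group action\<close>

text \<open>The \<open>mult\<close> and \<open>one\<close> fields inherited from \<open>ring\<close> play no role for a plain module and are
  left \<open>undefined\<close> below.\<close>

record ('a, 'b, 'g) gmodule = "('a, 'b) module" +
  act :: "'g \<Rightarrow> 'b \<Rightarrow> 'b"

locale group_module = G: group G + module R M
  for G :: "('g, 'u) monoid_scheme" and R :: "('a, 'v) ring_scheme"
    and M :: "('a, 'b, 'g, 'w) gmodule_scheme" (structure) +
  assumes act_closed: "\<lbrakk>g \<in> carrier G; x \<in> carrier M\<rbrakk> \<Longrightarrow> act M g x \<in> carrier M"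
    and act_one: "x \<in> carrier M \<Longrightarrow> act M \<one>\<^bsub>G\<^esub> x = x"
    and act_mult: "\<lbrakk>g \<in> carrier G; h \<in> carrier G; x \<in> carrier M\<rbrakk>
      \<Longrightarrow> act M (g \<otimes>\<^bsub>G\<^esub> h) x = act M g (act M h x)"
    and act_add: "\<lbrakk>g \<in> carrier G; x \<in> carrier M; y \<in> carrier M\<rbrakk>
      \<Longrightarrow> act M g (x \<oplus> y) = act M g x \<oplus> act M g y"
    and act_smult: "\<lbrakk>g \<in> carrier G; c \<in> carrier R; x \<in> carrier M\<rbrakk>
      \<Longrightarrow> act M g (c \<odot>\<^bsub>M\<^esub> x) = c \<odot>\<^bsub>M\<^esub> act M g x"

definition gmodule_hom ::
  "('g, 'u) monoid_scheme \<Rightarrow> ('a, 'v) ring_scheme \<Rightarrow> ('a, 'b, 'g, 'w) gmodule_scheme \<Rightarrow>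
    ('a, 'c, 'g, 'z) gmodule_scheme \<Rightarrow> ('b \<Rightarrow> 'c) set" where
  "gmodule_hom G R M N =
    {f \<in> LinearCombinations.module_hom R M N.
      \<forall>g\<in>carrier G. \<forall>x\<in>carrier M. f (act M g x) = act N g (f x)}"

definition gmodule_iso ::
  "('g, 'u) monoid_scheme \<Rightarrow> ('a, 'v) ring_scheme \<Rightarrow> ('a, 'b, 'g, 'w) gmodule_scheme \<Rightarrow>
    ('a, 'c, 'g, 'z) gmodule_scheme \<Rightarrow> bool" where
  "gmodule_iso G R M N \<longleftrightarrow> (\<exists>f\<in>gmodule_hom G R M N. bij_betw f (carrier M) (carrier N))"

text \<open>Exactness of \<open>0 \<rightarrow> A \<rightarrow> B \<rightarrow> C \<rightarrow> 0\<close> with maps \<open>\<phi> : A \<rightarrow> B\<close> and \<open>\<psi> : B \<rightarrow> C\<close>.\<close>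

definition short_exact ::
  "('g, 'u) monoid_scheme \<Rightarrow> ('a, 'v) ring_scheme \<Rightarrow> ('a, 'b, 'g, 'w) gmodule_scheme \<Rightarrow> ('b \<Rightarrow> 'c) \<Rightarrow>
    ('a, 'c, 'g, 'x) gmodule_scheme \<Rightarrow> ('c \<Rightarrow> 'd) \<Rightarrow> ('a, 'd, 'g, 'y) gmodule_scheme \<Rightarrow> bool" where
  "short_exact G R A \<phi> B \<psi> C \<longleftrightarrow>
    group_module G R A \<and> group_module G R B \<and> group_module G R C \<and>
    \<phi> \<in> gmodule_hom G R A B \<and> \<psi> \<in> gmodule_hom G R B C \<and>
    inj_on \<phi> (carrier A) \<and>
    \<phi> ` carrier A = {x \<in> carrier B. \<psi> x = \<zero>\<^bsub>C\<^esub>} \<and>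
    \<psi> ` carrier B = carrier C"

definition gsubmodule ::
  "('g, 'u) monoid_scheme \<Rightarrow> ('a, 'v) ring_scheme \<Rightarrow> 'b set \<Rightarrow> ('a, 'b, 'g, 'w) gmodule_scheme \<Rightarrow> bool"
  where
  "gsubmodule G R U M \<longleftrightarrow>
    LinearCombinations.submodule R U M \<and> (\<forall>g\<in>carrier G. \<forall>u\<in>U. act M g u \<in> U)"

definition generated_gsubmodule ::
  "('g, 'u) monoid_scheme \<Rightarrow> ('a, 'v) ring_scheme \<Rightarrow> ('a, 'b, 'g, 'w) gmodule_scheme \<Rightarrow> 'b set \<Rightarrow> 'b set"
  where
  "generated_gsubmodule G R M S = \<Inter>{U. gsubmodule G R U M \<and> S \<subseteq> U}"

text \<open>The elements of \<open>M/U\<close> are the cosets of \<open>U\<close>.  Scalars and group elements act on a coset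
  through its representatives; all members of each union below coincide as soon as \<open>U\<close> is a
  stable submodule (the device as in \<open>rcoset_mult\<close> for quotient rings).\<close>

definition quotient_gmodule ::
  "('a, 'b, 'g, 'w) gmodule_scheme \<Rightarrow> 'b set \<Rightarrow> ('a, 'b set, 'g) gmodule" where
  "quotient_gmodule M U =
    \<lparr>carrier = a_rcosets\<^bsub>M\<^esub> U, mult = undefined, one = undefined,
     zero = U, add = (\<lambda>S T. S <+>\<^bsub>M\<^esub> T),
     smult = (\<lambda>c S. \<Union>x\<in>S. U +>\<^bsub>M\<^esub> (c \<odot>\<^bsub>M\<^esub> x)),
     act = (\<lambda>g S. \<Union>x\<in>S. U +>\<^bsub>M\<^esub> act M g x)\<rparr>"

definition zero_gmodule :: "('a, unit, 'g) gmodule" where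
  "zero_gmodule =
    \<lparr>carrier = {()}, mult = undefined, one = undefined, zero = (), add = (\<lambda>_ _. ()),
     smult = (\<lambda>_ _. ()), act = (\<lambda>_ _. ())\<rparr>"


section \<open>Binary forms and the action of \<open>GL\<^sub>2\<close>\<close>

definition GL2 :: "'k::field mat monoid" where
  "GL2 = units_of (ring_mat TYPE('k) 2 ())"

text \<open>\<open>k[X,Y]\<close> is realised as \<open>k[X][Y]\<close>: the inner variable is \<open>X\<close>, the outer one is \<open>Y\<close>, so
  \<open>coeff (coeff F j) i\<close> is the coefficient of \<open>X\<^sup>i Y\<^sup>j\<close> in \<open>F\<close>.\<close>

definition varX :: "'k::comm_ring_1 poly poly" where
  "varX = [:[:0, 1:]:]"

definition varY :: "'k::comm_ring_1 poly poly" where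
  "varY = [:0, 1:]"

definition const2 :: "'k::comm_ring_1 \<Rightarrow> 'k poly poly" where
  "const2 c = [:[:c:]:]"

definition homogeneous :: "nat \<Rightarrow> 'k::comm_ring_1 poly poly \<Rightarrow> bool" where
  "homogeneous r F \<longleftrightarrow> (\<forall>i j. coeff (coeff F j) i \<noteq> 0 \<longrightarrow> i + j = r)"

text \<open>\<open>subst2 F P Q\<close> is \<open>F(P, Q)\<close>.\<close>

definition subst2 ::
  "'k::comm_ring_1 poly poly \<Rightarrow> 'k poly poly \<Rightarrow> 'k poly poly \<Rightarrow> 'k poly poly" where
  "subst2 F P Q = poly (map_poly (\<lambda>f. poly (map_poly const2 f) P) F) Q"

definition mat_act :: "'k::comm_ring_1 mat \<Rightarrow> 'k poly poly \<Rightarrow> 'k poly poly" where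
  "mat_act A F = subst2 F
    (const2 (A $$ (0,0)) * varX + const2 (A $$ (1,0)) * varY)
    (const2 (A $$ (0,1)) * varX + const2 (A $$ (1,1)) * varY)"

definition Vrep :: "nat \<Rightarrow> ('k::field, 'k poly poly, 'k mat) gmodule" where
  "Vrep r = \<lparr>carrier = {F. homogeneous r F}, mult = undefined, one = undefined,
    zero = 0, add = (+), smult = (\<lambda>c F. const2 c * F), act = mat_act\<rparr>"

text \<open>\<open>M \<otimes> D\<^sup>n\<close> for the determinant character \<open>D\<close>: since \<open>D\<^sup>n\<close> is one-dimensional, this is the module
  \<open>M\<close> with \<open>g\<close> acting as \<open>D(g)\<^sup>n g\<close>.\<close>

definition det_twist ::
  "('k::field, 'b, 'k mat) gmodule \<Rightarrow> nat \<Rightarrow> ('k, 'b, 'k mat) gmodule" where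
  "det_twist M n = M\<lparr>act := (\<lambda>g x. (det g ^ n) \<odot>\<^bsub>M\<^esub> act M g x)\<rparr>"

text \<open>The submodule \<open>X\<^bsub>r-l,r\<^esub>\<close> generated by \<open>X\<^bsup>r-l\<^esup> Y\<^sup>l\<close>; it is meant for \<open>l \<le> r\<close> only.\<close>

definition Xsub :: "nat \<Rightarrow> nat \<Rightarrow> 'k::field poly poly set" where
  "Xsub r l = generated_gsubmodule GL2 class_ring (Vrep r) {varX ^ (r - l) * varY ^ l}"

definition theta :: "'p::prime_card mod_ring poly poly" where
  "theta = varX ^ CARD('p) * varY - varX * varY ^ CARD('p)"

definition Vfilt :: "nat \<Rightarrow> nat \<Rightarrow> 'p::prime_card mod_ring poly poly set" where
  "Vfilt r m = {F \<in> carrier (Vrep r). theta ^ m dvd F}"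

definition Qrep :: "nat \<Rightarrow> nat \<Rightarrow>
    ('p::prime_card mod_ring, 'p mod_ring poly poly set, 'p mod_ring mat) gmodule" where
  "Qrep r l = quotient_gmodule (Vrep r) (Xsub r l <+>\<^bsub>Vrep r\<^esub> Vfilt r (l + 1))"

text \<open>\<open>V\<^sub>r\<^bsup>(m)\<^esup> / V\<^sub>r\<^bsup>(m+1)\<^esup>\<close>\<close>

definition Vgraded :: "nat \<Rightarrow> nat \<Rightarrow>
    ('p::prime_card mod_ring, 'p mod_ring poly poly set, 'p mod_ring mat) gmodule" where
  "Vgraded r m = quotient_gmodule ((Vrep r)\<lparr>carrier := Vfilt r m\<rparr>) (Vfilt r (m + 1))"

text \<open>\<open>[n]\<close>: the representative of \<open>n\<close> modulo \<open>p - 1\<close> in \<open>{1, \<dots>, p - 1}\<close>.\<close>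

definition bracket :: "nat \<Rightarrow> int \<Rightarrow> nat" where
  "bracket p n = (THE m. m \<in> {1..p - 1} \<and> [int m = n] (mod int (p - 1)))"

end

theory Submission
  imports Defs
begin

text \<open>
  Write \<open>V\<^sup>m\<close> for the forms of degree \<open>r\<close> divisible by \<open>\<theta>\<^sup>m\<close>, and \<open>N = r - i\<close>.  The
  hypothesis \<open>i = [a - i]\<close> says that \<open>N \<equiv> i\<close> modulo \<open>p - 1\<close>.

  Up to a scalar, \<open>\<theta>\<close> is the product of the \<open>p + 1\<close> linear forms over \<open>\<bbbF>\<^sub>p\<close>.  So \<open>\<theta>\<^sup>m\<close>
  divides a form iff the form vanishes to order \<open>m\<close> at every point of the projective line over
  \<open>\<bbbF>\<^sub>p\<close> (\<open>theta_power_dvdI\<close>), and \<open>\<theta>\<^sup>i H\<close> modulo \<open>V\<^bsup>i+1\<^esup>\<close> is known from the values of \<open>H\<close>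
  at these points (\<open>vanishing_form\<close>, \<open>val_from_jet\<close>).  The degree \<open>s\<close> of \<open>H\<close> is a multiple
  of \<open>p - 1\<close> and at least \<open>p\<close>, hence \<open>V\<^sup>i/V\<^bsup>i+1\<^esup>\<close> is the space of all functions on the projective line,
  twisted by \<open>D\<^sup>i\<close>.  It contains the constants and the functions with sum zero.

  Once it is known that \<open>X\<^bsub>r-i+1\<^esub> \<subseteq> X\<^bsub>r-i\<^esub> \<subseteq> X\<^bsub>r-i+1\<^esub> + V\<^sup>i\<close>, the kernel of \<open>Q(i) \<rightarrow> Q(i-1)\<close> is
  the quotient of \<open>V\<^sup>i/V\<^bsup>i+1\<^esup>\<close> by the image of \<open>X\<^bsub>r-i\<^esub> \<inter> V\<^sup>i\<close>, and the theorem amounts to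
  finding this image.

  \<^emph>\<open>Elements of the image.\<close>  The form
  \<open>E = - (\<Sum>c\<noteq>0. (X + c Y)\<^sup>N (\<Sum>k\<le>i. (-X/c)\<^sup>k Y\<^bsup>i-k\<^esup>))\<close> lies in \<open>X\<^bsub>r-i\<^esub>\<close>.  Since characters of
  the multiplicative group are orthogonal, the inner sum is a reproducing kernel; it turns the
  expansion of \<open>(X + c Y)\<^sup>N\<close> at a rational point into an explicit multiple of \<open>t\<^sup>i\<close>
  (\<open>jet_relation_form\<close>).  So \<open>E\<close> is divisible by \<open>\<theta>\<^sup>i\<close>, and up to the sign \<open>(-1)\<^sup>i\<close> its
  function is \<open>binom (N-1) i\<close> plus \<open>(i+1) binom N i\<close> times the indicator of \<open>X Y \<noteq> 0\<close>.  The
  translates of this function span all functions, the functions with sum zero, or the constants,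
  according to whether \<open>binom (N+1) (i+1)\<close> is nonzero modulo \<open>p\<close>, \<open>N \<equiv> -1\<close>, or \<open>N \<equiv> 0\<close>.
  Reducing \<open>E\<close> modulo \<open>X\<^bsub>r-i+1\<^esub>\<close> instead gives \<open>X\<^bsub>r-i\<^esub> \<subseteq> X\<^bsub>r-i+1\<^esub> + V\<^sup>i\<close>
  (\<open>generator_in_lower_sum\<close>).

  \<^emph>\<open>Nothing else is in the image.\<close>  The power \<open>p (p-1)\<close> of a linear form is \<open>1\<close> to order \<open>p\<close>
  at every rational point where the linear form does not vanish.  Hence the expansions to order
  \<open>i\<close> of the elements of \<open>X\<^bsub>r-i\<^esub>\<close> depend on \<open>N\<close> only modulo \<open>p (p-1)\<close> (\<open>Xsub_companion\<close>).  If
  \<open>p\<close> divides \<open>binom (N+1) (i+1)\<close>, then \<open>N + 1 \<equiv> j\<close> modulo \<open>p\<close> with \<open>0 \<le> j \<le> i\<close>, and \<open>N\<close> may be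
  replaced by \<open>p (i+1-j) + j - 1\<close>.  For this exponent the quotient by \<open>\<theta>\<^sup>i\<close> has degree
  \<open>(1-j) (p-1)\<close>: it is zero for \<open>j \<ge> 2\<close>, constant for \<open>j = 1\<close>, and for \<open>j = 0\<close> its function has
  sum zero, as for every form of degree \<open>p - 1\<close> (\<open>values_of_Qker\<close>).

  The kernel is therefore \<open>0\<close>, all functions, the functions modulo constants, or the functions
  modulo those of sum zero.  The last two are \<open>V\<^bsub>p-1\<^esub>\<close> and \<open>V\<^sub>0\<close>, by the maps \<open>dual_form\<close> and
  \<open>total\<close>.
\<close>

section \<open>Quotients of group modules\<close>

lemma gmodule_homD:
  assumes "f \<in> gmodule_hom G R M N" "x \<in> carrier M"
  shows "f x \<in> carrier N"
    and "y \<in> carrier M \<Longrightarrow> f (x \<oplus>\<^bsub>M\<^esub> y) = f x \<oplus>\<^bsub>N\<^esub> f y"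
    and "c \<in> carrier R \<Longrightarrow> f (c \<odot>\<^bsub>M\<^esub> x) = c \<odot>\<^bsub>N\<^esub> f x"
    and "g \<in> carrier G \<Longrightarrow> f (act M g x) = act N g (f x)"
  using assms unfolding gmodule_hom_def module_hom_def by auto

context group_module
begin

lemma gsubmodule_restrict:
  assumes "gsubmodule G R V M"
  shows "group_module G R (M\<lparr>carrier := V\<rparr>)"
proof -
  interpret S: LinearCombinations.submodule R V M
    using assms by (simp add: gsubmodule_def)
  have "module R (M\<lparr>carrier := V\<rparr>)"
    using submodule_is_module[OF S.submodule_axioms] .
  then show ?thesis
    unfolding group_module_def group_module_axioms_def
    using assms S.subset G.is_group
    by (simp add: gsubmodule_def act_one act_mult act_add act_smult subset_iff)
qed

end

locale group_submodule = group_module +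
  fixes U
  assumes U: "gsubmodule G R U M"
begin

lemma U_subset: "U \<subseteq> carrier M" and U_add: "x \<in> U \<Longrightarrow> y \<in> U \<Longrightarrow> x \<oplus>\<^bsub>M\<^esub> y \<in> U"
  and U_zero: "\<zero>\<^bsub>M\<^esub> \<in> U" and U_smult: "c \<in> carrier R \<Longrightarrow> x \<in> U \<Longrightarrow> c \<odot>\<^bsub>M\<^esub> x \<in> U"
  and U_act: "g \<in> carrier G \<Longrightarrow> x \<in> U \<Longrightarrow> act M g x \<in> U"
  using U unfolding gsubmodule_def submodule_def by auto

lemma U_minus: assumes x: "x \<in> U" shows "\<ominus>\<^bsub>M\<^esub> x \<in> U"
proof -
  have "(\<ominus>\<^bsub>R\<^esub> \<one>\<^bsub>R\<^esub>) \<odot>\<^bsub>M\<^esub> x \<in> U" using x U_smult by simp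
  moreover have "(\<ominus>\<^bsub>R\<^esub> \<one>\<^bsub>R\<^esub>) \<odot>\<^bsub>M\<^esub> x = \<ominus>\<^bsub>M\<^esub> x"
    using x U_subset by (subst smult_l_minus) auto
  ultimately show ?thesis by simp
qed

lemma U_diff: "x \<in> U \<Longrightarrow> y \<in> U \<Longrightarrow> x \<ominus>\<^bsub>M\<^esub> y \<in> U"
  by (simp add: a_minus_def U_add U_minus)

sublocale A: abelian_subgroup U M
proof (rule abelian_subgroupI3)
  show "additive_subgroup U M"
    by (intro additive_subgroup.intro subgroup.intro)
       (use U_subset U_add U_zero U_minus in \<open>auto simp: a_inv_def[symmetric]\<close>)
  show "abelian_group M" ..
qed

lemma coset_eq_iff:
  assumes "x \<in> carrier M" "y \<in> carrier M"
  shows "U +>\<^bsub>M\<^esub> x = U +>\<^bsub>M\<^esub> y \<longleftrightarrow> x \<ominus>\<^bsub>M\<^esub> y \<in> U"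
  using assms A.a_rcos_module[of y x] A.a_repr_independence'[of x y] A.a_rcos_self[of x]
  by (auto simp: a_minus_def)


lemma coset_cases:
  assumes "S \<in> carrier (quotient_gmodule M U)"
  obtains x where "x \<in> carrier M" "S = U +>\<^bsub>M\<^esub> x"
  using assms by (auto simp: quotient_gmodule_def A_RCOSETS_defs a_r_coset_def)

lemma coset_closed: "x \<in> carrier M \<Longrightarrow> U +>\<^bsub>M\<^esub> x \<in> carrier (quotient_gmodule M U)"
  using U_subset by (auto simp: quotient_gmodule_def intro: a_rcosetsI)

lemma coset_zero: "\<zero>\<^bsub>quotient_gmodule M U\<^esub> = U +>\<^bsub>M\<^esub> \<zero>\<^bsub>M\<^esub>"
  using U_subset by (simp add: quotient_gmodule_def)

lemma coset_add:
  assumes "x \<in> carrier M" "y \<in> carrier M"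
  shows "(U +>\<^bsub>M\<^esub> x) \<oplus>\<^bsub>quotient_gmodule M U\<^esub> (U +>\<^bsub>M\<^esub> y) = U +>\<^bsub>M\<^esub> (x \<oplus>\<^bsub>M\<^esub> y)"
  using assms by (simp add: quotient_gmodule_def A.a_rcos_sum)

text \<open>The unions in \<open>quotient_gmodule\<close> collapse to a single coset because \<open>f\<close> moves the
  representatives of a coset by elements of \<open>U\<close>.\<close>

lemma coset_UN:
  assumes x: "x \<in> carrier M"
    and f: "\<And>y. y \<in> carrier M \<Longrightarrow> f y \<in> carrier M"
      "\<And>y z. y \<in> carrier M \<Longrightarrow> z \<in> carrier M \<Longrightarrow> f (y \<oplus>\<^bsub>M\<^esub> z) = f y \<oplus>\<^bsub>M\<^esub> f z"
      "\<And>u. u \<in> U \<Longrightarrow> f u \<in> U"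
  shows "(\<Union>y\<in>U +>\<^bsub>M\<^esub> x. U +>\<^bsub>M\<^esub> f y) = U +>\<^bsub>M\<^esub> f x"
proof -
  have "U +>\<^bsub>M\<^esub> f y = U +>\<^bsub>M\<^esub> f x" if "y \<in> U +>\<^bsub>M\<^esub> x" for y
  proof -
    from that obtain u where u: "u \<in> U" "y = u \<oplus>\<^bsub>M\<^esub> x" by (auto simp: a_r_coset_def')
    hence uc: "u \<in> carrier M" using U_subset by auto
    have "f y \<ominus>\<^bsub>M\<^esub> f x = f u"
      using u uc x f(1,2) by (simp add: a_minus_def M.a_assoc M.r_neg)
    thus ?thesis using u uc x f by (subst coset_eq_iff) auto
  qed
  moreover have "x \<in> U +>\<^bsub>M\<^esub> x" using x by (rule A.a_rcos_self)
  ultimately show ?thesis by blast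
qed

lemma coset_smult:
  assumes "c \<in> carrier R" "x \<in> carrier M"
  shows "c \<odot>\<^bsub>quotient_gmodule M U\<^esub> (U +>\<^bsub>M\<^esub> x) = U +>\<^bsub>M\<^esub> (c \<odot>\<^bsub>M\<^esub> x)"
  using assms coset_UN[of x "\<lambda>y. c \<odot>\<^bsub>M\<^esub> y"] U_smult
  by (simp add: quotient_gmodule_def smult_r_distr)

lemma coset_act:
  assumes "g \<in> carrier G" "x \<in> carrier M"
  shows "act (quotient_gmodule M U) g (U +>\<^bsub>M\<^esub> x) = U +>\<^bsub>M\<^esub> act M g x"
  using assms coset_UN[of x "act M g"] U_act
  by (simp add: quotient_gmodule_def act_closed act_add)

lemmas coset_simps = coset_zero coset_add coset_smult coset_act coset_closed

lemma quotient_group_module: "group_module G R (quotient_gmodule M U)"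
proof -
  let ?Q = "quotient_gmodule M U"
  have inverse: "\<exists>y\<in>carrier ?Q. y \<oplus>\<^bsub>?Q\<^esub> x = \<zero>\<^bsub>?Q\<^esub>" if "x \<in> carrier ?Q" for x
    using that
  proof (elim coset_cases)
    fix z assume z: "z \<in> carrier M" "x = U +>\<^bsub>M\<^esub> z"
    show ?thesis
      by (rule bexI[of _ "U +>\<^bsub>M\<^esub> (\<ominus>\<^bsub>M\<^esub> z)"]) (use z in \<open>simp_all add: coset_simps M.l_neg\<close>)
  qed
  have "abelian_group ?Q"
    by (rule abelian_groupI, erule_tac [6] inverse)
       (auto elim!: coset_cases simp: coset_simps M.a_ac)
  then have "module R ?Q"
    by (intro moduleI R.is_cring)
       (auto elim!: coset_cases simp: coset_simps smult_l_distr smult_r_distr smult_assoc1)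
  then show ?thesis
    unfolding group_module_def group_module_axioms_def
    by (auto elim!: coset_cases simp: coset_simps act_closed act_one act_mult act_add act_smult
          intro: G.is_group)
qed

text \<open>The map \<open>f\<close> is constant on each coset of its kernel, so a coset is sent to the only element of
  its image.\<close>

lemma quotient_iso:
  assumes f: "f \<in> gmodule_hom G R M N" and onto: "f ` carrier M = carrier N"
    and N: "group_module G R N" and ker: "U = {x \<in> carrier M. f x = \<zero>\<^bsub>N\<^esub>}"
  shows "gmodule_iso G R (quotient_gmodule M U) N"
proof -
  interpret N: group_module G R N by (rule N)
  note fc = gmodule_homD(1)[OF f] and fadd = gmodule_homD(2)[OF f]
    and fsm = gmodule_homD(3)[OF f] and fact = gmodule_homD(4)[OF f]
  have memU: "x \<in> U \<longleftrightarrow> x \<in> carrier M \<and> f x = \<zero>\<^bsub>N\<^esub>" for x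
    unfolding ker by blast
  define h where "h S = the_elem (f ` S)" for S
  have h: "h (U +>\<^bsub>M\<^esub> x) = f x" if x: "x \<in> carrier M" for x
  proof -
    have "f ` (U +>\<^bsub>M\<^esub> x) = {f x}"
    proof -
      have "f y = f x" if "y \<in> U +>\<^bsub>M\<^esub> x" for y
      proof -
        from that obtain u where u: "u \<in> U" "y = u \<oplus>\<^bsub>M\<^esub> x" unfolding a_r_coset_def' by blast
        hence "u \<in> carrier M" "f u = \<zero>\<^bsub>N\<^esub>" using memU by blast+
        thus ?thesis using x u fc[OF x] by (simp add: fadd)
      qed
      moreover have "x \<in> U +>\<^bsub>M\<^esub> x" using x by (rule A.a_rcos_self)
      ultimately show ?thesis by blast
    qed
    thus ?thesis by (simp add: h_def)
  qed
  have diff: "f (x \<ominus>\<^bsub>M\<^esub> y) = \<zero>\<^bsub>N\<^esub> \<longleftrightarrow> f x = f y" if xy: "x \<in> carrier M" "y \<in> carrier M" for x y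
  proof -
    have "(x \<ominus>\<^bsub>M\<^esub> y) \<oplus>\<^bsub>M\<^esub> y = x"
      using xy by (simp add: a_minus_def M.a_assoc M.l_neg)
    hence "f (x \<ominus>\<^bsub>M\<^esub> y) \<oplus>\<^bsub>N\<^esub> f y = f x"
      using xy fadd[of "x \<ominus>\<^bsub>M\<^esub> y" y] by simp
    thus ?thesis using xy fc N.M.add.l_cancel_one' by (metis M.minus_closed N.M.add.r_cancel_one)
  qed
  have "h \<in> gmodule_hom G R (quotient_gmodule M U) N"
    unfolding gmodule_hom_def module_hom_def
  proof (intro CollectI conjI allI ballI impI funcsetI; (elim conjE)?)
    fix S assume "S \<in> carrier (quotient_gmodule M U)"
    thus "h S \<in> carrier N" by (rule coset_cases) (simp add: h fc)
  next
    fix S T assume "S \<in> carrier (quotient_gmodule M U)" "T \<in> carrier (quotient_gmodule M U)"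
    thus "h (S \<oplus>\<^bsub>quotient_gmodule M U\<^esub> T) = h S \<oplus>\<^bsub>N\<^esub> h T"
      by (elim coset_cases) (simp add: coset_add h fadd)
  next
    fix c S assume "c \<in> carrier R" "S \<in> carrier (quotient_gmodule M U)"
    thus "h (c \<odot>\<^bsub>quotient_gmodule M U\<^esub> S) = c \<odot>\<^bsub>N\<^esub> h S"
      by (elim coset_cases) (simp add: coset_smult h fsm)
  next
    fix g S assume "g \<in> carrier G" "S \<in> carrier (quotient_gmodule M U)"
    thus "h (act (quotient_gmodule M U) g S) = act N g (h S)"
      by (elim coset_cases) (simp add: coset_act h fact act_closed)
  qed
  moreover have "inj_on h (carrier (quotient_gmodule M U))"
    by (rule inj_onI, elim coset_cases) (metis M.minus_closed coset_eq_iff diff h memU)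
  moreover have "h ` carrier (quotient_gmodule M U) = carrier N"
  proof
    show "h ` carrier (quotient_gmodule M U) \<subseteq> carrier N"
      by (auto elim!: coset_cases simp: h fc)
    show "carrier N \<subseteq> h ` carrier (quotient_gmodule M U)"
    proof
      fix y assume "y \<in> carrier N"
      then obtain x where "x \<in> carrier M" "y = f x" unfolding onto[symmetric] by blast
      hence "x \<in> carrier M" "y = h (U +>\<^bsub>M\<^esub> x)" by (simp_all add: h)
      thus "y \<in> h ` carrier (quotient_gmodule M U)" using coset_closed by blast
    qed
  qed
  ultimately show ?thesis unfolding gmodule_iso_def bij_betw_def by blast
qed

lemma quotient_zero_iso:
  assumes "U = carrier M"
  shows "gmodule_iso G R (quotient_gmodule M U) (zero_gmodule :: ('c, unit, 'a) gmodule)"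
proof (rule quotient_iso)
  show "group_module G R (zero_gmodule :: ('c, unit, 'a) gmodule)"
    unfolding group_module_def group_module_axioms_def
    by (auto intro!: moduleI abelian_groupI R.is_cring G.is_group simp: zero_gmodule_def)
  show "(\<lambda>_. ()) ` carrier M = carrier (zero_gmodule :: ('c, unit, 'a) gmodule)"
    using M.zero_closed by (auto simp: zero_gmodule_def)
qed (auto simp: assms gmodule_hom_def module_hom_def zero_gmodule_def)

lemma coset_of_coset:
  assumes "J \<subseteq> U" "\<zero>\<^bsub>M\<^esub> \<in> J" "x \<in> carrier M"
  shows "U <+>\<^bsub>M\<^esub> (J +>\<^bsub>M\<^esub> x) = U +>\<^bsub>M\<^esub> x"
proof -
  have "\<exists>w\<in>U. u \<oplus>\<^bsub>M\<^esub> (v \<oplus>\<^bsub>M\<^esub> x) = w \<oplus>\<^bsub>M\<^esub> x" if "u \<in> U" "v \<in> J" for u v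
    using that assms U_subset by (intro bexI[of _ "u \<oplus>\<^bsub>M\<^esub> v"]) (auto simp: M.a_assoc U_add subset_iff)
  moreover have "\<exists>u\<in>U. \<exists>v\<in>J. w \<oplus>\<^bsub>M\<^esub> x = u \<oplus>\<^bsub>M\<^esub> (v \<oplus>\<^bsub>M\<^esub> x)" if "w \<in> U" for w
    using that assms by (intro bexI[of _ w] bexI[of _ "\<zero>\<^bsub>M\<^esub>"]) auto
  ultimately show ?thesis
    by (auto simp: set_add_def' a_r_coset_def')
qed

end

lemma (in group_module) group_submoduleI: "gsubmodule G R U M \<Longrightarrow> group_submodule G R M U"
  by (intro group_submodule.intro group_submodule_axioms.intro group_module_axioms)

lemma (in group_module) gsubmoduleI:
  assumes "U \<subseteq> carrier M" "\<zero>\<^bsub>M\<^esub> \<in> U" "\<And>x y. x \<in> U \<Longrightarrow> y \<in> U \<Longrightarrow> x \<oplus>\<^bsub>M\<^esub> y \<in> U"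
    "\<And>c x. c \<in> carrier R \<Longrightarrow> x \<in> U \<Longrightarrow> c \<odot>\<^bsub>M\<^esub> x \<in> U"
    "\<And>g x. g \<in> carrier G \<Longrightarrow> x \<in> U \<Longrightarrow> act M g x \<in> U"
  shows "gsubmodule G R U M"
  using assms unfolding gsubmodule_def submodule_def by (auto intro: module_axioms)

lemma (in group_module) gsubmodule_sum:
  assumes "gsubmodule G R U M" "gsubmodule G R V M"
  shows "gsubmodule G R (U <+>\<^bsub>M\<^esub> V) M"
proof -
  interpret U: group_submodule G R M U by (rule group_submoduleI) fact
  interpret V: group_submodule G R M V by (rule group_submoduleI) fact
  have sum_mem: "u \<oplus>\<^bsub>M\<^esub> v \<in> U <+>\<^bsub>M\<^esub> V" if "u \<in> U" "v \<in> V" for u v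
    using that unfolding set_add_def' by blast
  have sum_cases: thesis if "x \<in> U <+>\<^bsub>M\<^esub> V"
      "\<And>u v. u \<in> U \<Longrightarrow> v \<in> V \<Longrightarrow> u \<in> carrier M \<Longrightarrow> v \<in> carrier M \<Longrightarrow> x = u \<oplus>\<^bsub>M\<^esub> v \<Longrightarrow> thesis" for x thesis
    using that U.U_subset V.U_subset unfolding set_add_def' by blast
  show ?thesis
  proof (rule gsubmoduleI)
    show "x \<oplus>\<^bsub>M\<^esub> y \<in> U <+>\<^bsub>M\<^esub> V" if xy: "x \<in> U <+>\<^bsub>M\<^esub> V" "y \<in> U <+>\<^bsub>M\<^esub> V" for x y
      using xy
    proof (elim sum_cases)
      fix u v u' v' assume *: "u \<in> U" "v \<in> V" "u' \<in> U" "v' \<in> V"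
        "u \<in> carrier M" "v \<in> carrier M" "u' \<in> carrier M" "v' \<in> carrier M"
        "x = u \<oplus>\<^bsub>M\<^esub> v" "y = u' \<oplus>\<^bsub>M\<^esub> v'"
      hence "x \<oplus>\<^bsub>M\<^esub> y = (u \<oplus>\<^bsub>M\<^esub> u') \<oplus>\<^bsub>M\<^esub> (v \<oplus>\<^bsub>M\<^esub> v')"
        by (simp add: M.a_ac)
      thus ?thesis using * sum_mem[OF U.U_add V.U_add] by simp
    qed
  next
    show "\<zero>\<^bsub>M\<^esub> \<in> U <+>\<^bsub>M\<^esub> V"
      using sum_mem[OF U.U_zero V.U_zero] by simp
  next
    show "U <+>\<^bsub>M\<^esub> V \<subseteq> carrier M"
      by (rule subsetI, erule sum_cases) simp
  next
    show "c \<odot>\<^bsub>M\<^esub> x \<in> U <+>\<^bsub>M\<^esub> V" if "c \<in> carrier R" "x \<in> U <+>\<^bsub>M\<^esub> V" for c x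
      using that(2) by (rule sum_cases) (simp add: smult_r_distr sum_mem U.U_smult V.U_smult that(1))
  next
    show "act M g x \<in> U <+>\<^bsub>M\<^esub> V" if "g \<in> carrier G" "x \<in> U <+>\<^bsub>M\<^esub> V" for g x
      using that(2) by (rule sum_cases) (simp add: act_add sum_mem U.U_act V.U_act that(1))
  qed
qed

text \<open>The kernel of \<open>M/U \<rightarrow> M/(U + V)\<close> is \<open>(U + V)/U\<close>, which is \<open>V/(U \<inter> V)\<close>.\<close>

lemma (in group_module) short_exact_quotients:
  assumes U: "gsubmodule G R U M" and V: "gsubmodule G R V M" and U': "U' = U <+>\<^bsub>M\<^esub> V"
  shows "short_exact G R (quotient_gmodule (M\<lparr>carrier := V\<rparr>) (U \<inter> V)) (\<lambda>S. U <+>\<^bsub>M\<^esub> S)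
    (quotient_gmodule M U) (\<lambda>S. U' <+>\<^bsub>M\<^esub> S) (quotient_gmodule M U')"
proof -
  let ?V = "M\<lparr>carrier := V\<rparr>"
  interpret U: group_submodule G R M U by (rule group_submoduleI) fact
  interpret V: group_submodule G R M V by (rule group_submoduleI) fact
  have U'sub: "gsubmodule G R U' M" unfolding U' by (rule gsubmodule_sum) fact+
  interpret U': group_submodule G R M U' by (rule group_submoduleI[OF U'sub])
  interpret MV: group_module G R ?V by (rule gsubmodule_restrict) fact
  have "gsubmodule G R (U \<inter> V) ?V"
    by (rule MV.gsubmoduleI) (auto simp: U.U_zero V.U_zero U.U_add V.U_add U.U_smult V.U_smult U.U_act V.U_act)
  then interpret J: group_submodule G R ?V "U \<inter> V" by (rule MV.group_submoduleI)
  have Vc: "x \<in> carrier M" if "x \<in> V" for x using that V.U_subset by auto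
  have sum_mem: "u \<oplus>\<^bsub>M\<^esub> v \<in> U'" if "u \<in> U" "v \<in> V" for u v
    using that unfolding U' set_add_def' by blast
  have UU': "U \<subseteq> U'"
    using sum_mem[OF _ V.U_zero] U.U_subset by (auto simp: subset_iff)
  have coset: "U \<inter> V +>\<^bsub>?V\<^esub> x = U \<inter> V +>\<^bsub>M\<^esub> x" for x by (simp add: a_r_coset_def')
  have phi: "U <+>\<^bsub>M\<^esub> (U \<inter> V +>\<^bsub>?V\<^esub> x) = U +>\<^bsub>M\<^esub> x" if "x \<in> V" for x
    using that unfolding coset by (intro U.coset_of_coset) (auto simp: U.U_zero V.U_zero Vc)
  have psi: "U' <+>\<^bsub>M\<^esub> (U +>\<^bsub>M\<^esub> x) = U' +>\<^bsub>M\<^esub> x" if "x \<in> carrier M" for x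
    using that by (intro U'.coset_of_coset) (auto simp: U.U_zero UU')
  have Jsimps: "(U \<inter> V +>\<^bsub>?V\<^esub> x) \<oplus>\<^bsub>quotient_gmodule ?V (U \<inter> V)\<^esub> (U \<inter> V +>\<^bsub>?V\<^esub> y)
      = U \<inter> V +>\<^bsub>?V\<^esub> (x \<oplus>\<^bsub>M\<^esub> y)"
    "c \<in> carrier R \<Longrightarrow> c \<odot>\<^bsub>quotient_gmodule ?V (U \<inter> V)\<^esub> (U \<inter> V +>\<^bsub>?V\<^esub> x) = U \<inter> V +>\<^bsub>?V\<^esub> (c \<odot>\<^bsub>M\<^esub> x)"
    "g \<in> carrier G \<Longrightarrow> act (quotient_gmodule ?V (U \<inter> V)) g (U \<inter> V +>\<^bsub>?V\<^esub> x) = U \<inter> V +>\<^bsub>?V\<^esub> act M g x"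
    if "x \<in> V" "y \<in> V" for x y c g
    using that J.coset_add[of x y] J.coset_smult[of c x] J.coset_act[of g x] by simp_all
  have Jcases: thesis if "S \<in> carrier (quotient_gmodule ?V (U \<inter> V))"
      "\<And>x. x \<in> V \<Longrightarrow> S = U \<inter> V +>\<^bsub>?V\<^esub> x \<Longrightarrow> thesis" for S thesis
    using that(2) by (rule J.coset_cases[OF that(1)]) auto
  have Jclosed: "U \<inter> V +>\<^bsub>?V\<^esub> x \<in> carrier (quotient_gmodule ?V (U \<inter> V))" if "x \<in> V" for x
    using that J.coset_closed[of x] by simp
  have phi_hom: "(\<lambda>S. U <+>\<^bsub>M\<^esub> S) \<in> gmodule_hom G R (quotient_gmodule ?V (U \<inter> V)) (quotient_gmodule M U)"
    unfolding gmodule_hom_def module_hom_def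
    by (auto elim!: Jcases simp: Jsimps phi V.U_add V.U_smult V.U_act Vc U.coset_simps)
  have psi_hom: "(\<lambda>S. U' <+>\<^bsub>M\<^esub> S) \<in> gmodule_hom G R (quotient_gmodule M U) (quotient_gmodule M U')"
    unfolding gmodule_hom_def module_hom_def
    by (auto elim!: U.coset_cases simp: U.coset_simps U'.coset_simps psi act_closed)
  have inj: "inj_on (\<lambda>S. U <+>\<^bsub>M\<^esub> S) (carrier (quotient_gmodule ?V (U \<inter> V)))"
  proof (rule inj_onI, elim Jcases)
    fix S T x y assume *: "U <+>\<^bsub>M\<^esub> S = U <+>\<^bsub>M\<^esub> T" "x \<in> V" "y \<in> V" 
      "S = U \<inter> V +>\<^bsub>?V\<^esub> x" "T = U \<inter> V +>\<^bsub>?V\<^esub> y"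
    hence "x \<ominus>\<^bsub>M\<^esub> y \<in> U" by (simp add: phi U.coset_eq_iff Vc)
    then obtain u where u: "u \<in> U \<inter> V" "x = u \<oplus>\<^bsub>M\<^esub> y"
      using V.U_diff[OF *(2,3)] *(2,3) Vc
      by (intro that[of "x \<ominus>\<^bsub>M\<^esub> y"]) (auto simp: a_minus_def M.a_assoc M.l_neg)
    hence "x \<in> U \<inter> V +>\<^bsub>?V\<^esub> y" by (auto simp: a_r_coset_def')
    thus "S = T" using * J.A.a_repr_independence'[of x y] by simp
  qed
  have kernel: "U' +>\<^bsub>M\<^esub> x = U' \<longleftrightarrow> x \<in> U'" if "x \<in> carrier M" for x
    using that by (metis U'.A.a_rcos_const U'.A.a_rcos_self)
  have image: "(\<lambda>S. U <+>\<^bsub>M\<^esub> S) ` carrier (quotient_gmodule ?V (U \<inter> V)) =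
    {S \<in> carrier (quotient_gmodule M U). U' <+>\<^bsub>M\<^esub> S = \<zero>\<^bsub>quotient_gmodule M U'\<^esub>}"
  proof (intro equalityI subsetI)
    fix S assume "S \<in> (\<lambda>S. U <+>\<^bsub>M\<^esub> S) ` carrier (quotient_gmodule ?V (U \<inter> V))"
    then obtain x where x: "x \<in> V" "S = U +>\<^bsub>M\<^esub> x" by (auto elim!: Jcases simp: phi)
    moreover have "x \<in> U'"
      using x sum_mem[OF U.U_zero, of x] Vc by simp
    ultimately show "S \<in> {S \<in> carrier (quotient_gmodule M U). U' <+>\<^bsub>M\<^esub> S = \<zero>\<^bsub>quotient_gmodule M U'\<^esub>}"
      by (simp add: psi Vc U.coset_closed kernel quotient_gmodule_def[of M U'])
  next
    fix S assume "S \<in> {S \<in> carrier (quotient_gmodule M U). U' <+>\<^bsub>M\<^esub> S = \<zero>\<^bsub>quotient_gmodule M U'\<^esub>}"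
    then obtain x where x: "x \<in> carrier M" "S = U +>\<^bsub>M\<^esub> x" "x \<in> U'"
      by (auto elim!: U.coset_cases simp: psi kernel quotient_gmodule_def[of M U'])
    then obtain u v where uv: "u \<in> U" "v \<in> V" "x = u \<oplus>\<^bsub>M\<^esub> v" unfolding U' by (auto simp: set_add_def')
    have "S = U +>\<^bsub>M\<^esub> v"
      using uv x U.U_subset Vc by (auto simp: U.coset_eq_iff a_minus_def M.a_assoc M.r_neg)
    hence "S = U <+>\<^bsub>M\<^esub> (U \<inter> V +>\<^bsub>?V\<^esub> v)" using uv by (simp add: phi)
    thus "S \<in> (\<lambda>S. U <+>\<^bsub>M\<^esub> S) ` carrier (quotient_gmodule ?V (U \<inter> V))"
      using uv Jclosed by blast
  qed
  have onto: "(\<lambda>S. U' <+>\<^bsub>M\<^esub> S) ` carrier (quotient_gmodule M U) = carrier (quotient_gmodule M U')"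
  proof (intro equalityI subsetI)
    fix S assume "S \<in> carrier (quotient_gmodule M U')"
    then obtain x where x: "x \<in> carrier M" "S = U' +>\<^bsub>M\<^esub> x" by (rule U'.coset_cases)
    hence "S = U' <+>\<^bsub>M\<^esub> (U +>\<^bsub>M\<^esub> x)" by (simp add: psi)
    thus "S \<in> (\<lambda>S. U' <+>\<^bsub>M\<^esub> S) ` carrier (quotient_gmodule M U)" using x U.coset_closed by blast
  qed (auto elim!: U.coset_cases simp: psi U'.coset_closed)
  show ?thesis
    unfolding short_exact_def
    using J.quotient_group_module U.quotient_group_module U'.quotient_group_module
      phi_hom psi_hom inj image onto by blast
qed


section \<open>Substitution in two variables\<close>

text \<open>Three substitutions are used: \<open>mat_act\<close> (where \<open>h\<close> is \<open>const2\<close>), values at points of the plane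
  (\<open>h\<close> the identity), and expansions along a line (\<open>h\<close> the constants of \<open>k[t]\<close>).  Identities
  between them are checked on the generators, by \<open>ring_hom_poly2_eqI\<close>.\<close>

definition eval2 ::
  "('k::comm_ring_1 \<Rightarrow> 'a::comm_ring_1) \<Rightarrow> 'a \<Rightarrow> 'a \<Rightarrow> 'k poly poly \<Rightarrow> 'a" where
  "eval2 h P Q F = poly (map_poly (\<lambda>f. poly (map_poly h f) P) F) Q"

lemma subst2_eq_eval2: "subst2 F P Q = eval2 const2 P Q F"
  by (simp add: subst2_def eval2_def)

lemma const2_hom: "comm_ring_hom (const2 :: 'k::comm_ring_1 \<Rightarrow> 'k poly poly)"
  by unfold_locales (simp_all add: const2_def one_pCons)

lemma const_hom: "comm_ring_hom (\<lambda>c::'k::comm_ring_1. [:c:])"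
  by unfold_locales (simp_all add: one_pCons)

lemma id_ring_hom: "comm_ring_hom (\<lambda>c::'k::comm_ring_1. c)"
  by unfold_locales simp_all

lemma comm_ring_hom_comp:
  assumes "comm_ring_hom g" "comm_ring_hom h"
  shows "comm_ring_hom (\<lambda>x. g (h x))"
proof -
  interpret g: comm_ring_hom g by fact
  interpret h: comm_ring_hom h by fact
  show ?thesis by unfold_locales (simp_all add: g.hom_add g.hom_mult h.hom_add h.hom_mult)
qed

lemma eval2_hom:
  assumes "comm_ring_hom h"
  shows "comm_ring_hom (eval2 h P Q)"
proof -
  interpret h: comm_ring_hom h by fact
  interpret hm: map_poly_comm_ring_hom h ..
  have "comm_ring_hom (\<lambda>f. poly (map_poly h f) P)"
    by (rule comm_ring_hom_comp[of "\<lambda>f. poly f P"]) unfold_locales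
  then interpret m: comm_ring_hom "\<lambda>f. poly (map_poly h f) P" .
  interpret mm: map_poly_comm_ring_hom "\<lambda>f. poly (map_poly h f) P" ..
  show ?thesis unfolding eval2_def
    by (rule comm_ring_hom_comp[of "\<lambda>f. poly f Q"]) unfold_locales
qed

lemma eval2_gens:
  assumes "comm_ring_hom h"
  shows "eval2 h P Q (const2 c) = h c" "eval2 h P Q varX = P" "eval2 h P Q varY = Q"
proof -
  interpret h: comm_ring_hom h by fact
  show "eval2 h P Q (const2 c) = h c" "eval2 h P Q varX = P" "eval2 h P Q varY = Q"
    by (cases "c = 0"; simp add: eval2_def const2_def varX_def varY_def map_poly_pCons h.hom_zero h.hom_one)+
qed

lemma coeff2_monomial:
  "coeff (coeff (const2 c * varX ^ a * varY ^ b) j) i = (if i = a \<and> j = b then c else 0)"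
proof -
  have "varX ^ a = [:monom (1::'a) a:]" for a
    by (induction a) (simp_all add: varX_def one_pCons monom_Suc monom_0)
  moreover have "varY ^ b = monom (1::'a poly) b" for b
    by (induction b) (simp_all add: varY_def monom_Suc one_pCons monom_0 smult_monom)
  ultimately show ?thesis
    by (simp add: const2_def smult_monom)
qed

lemma poly2_expansion:
  fixes F :: "'k::comm_ring_1 poly poly"
  shows "F = (\<Sum>j\<le>degree F. \<Sum>i\<le>degree (coeff F j). const2 (coeff (coeff F j) i) * varX ^ i * varY ^ j)"
proof (intro poly_eqI)
  fix n m
  have "coeff (coeff (\<Sum>j\<le>degree F. \<Sum>i\<le>degree (coeff F j). const2 (coeff (coeff F j) i) * varX ^ i * varY ^ j) n) m
    = (\<Sum>j\<le>degree F. \<Sum>i\<le>degree (coeff F j). if m = i \<and> n = j then coeff (coeff F j) i else 0)"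
    by (simp only: coeff_sum coeff2_monomial)
  also have "\<dots> = (\<Sum>j\<le>degree F. if j = n then (\<Sum>i\<le>degree (coeff F j). if i = m then coeff (coeff F j) i else 0) else 0)"
    by (intro sum.cong refl) (auto intro!: sum.cong)
  also have "\<dots> = coeff (coeff F n) m"
    by (auto simp: sum.delta coeff_eq_0 not_le)
  finally show "coeff (coeff F n) m = coeff (coeff (\<Sum>j\<le>degree F. \<Sum>i\<le>degree (coeff F j). const2 (coeff (coeff F j) i) * varX ^ i * varY ^ j) n) m" ..
qed

lemma ring_hom_poly2_eqI:
  assumes "comm_ring_hom f" "comm_ring_hom g" and "\<And>c. f (const2 c) = g (const2 c)"
    and "f varX = g varX" "f varY = g varY"
  shows "f F = g F"
proof -
  interpret f: comm_ring_hom f by fact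
  interpret g: comm_ring_hom g by fact
  show ?thesis
    by (subst (1 2) poly2_expansion)
       (simp add: f.hom_sum g.hom_sum f.hom_mult g.hom_mult f.hom_power g.hom_power assms)
qed

lemma hom_eval2:
  assumes "comm_ring_hom g" "comm_ring_hom h"
  shows "g (eval2 h P Q F) = eval2 (\<lambda>c. g (h c)) (g P) (g Q) F"
  by (rule ring_hom_poly2_eqI[where F=F])
     (simp_all add: comm_ring_hom_comp eval2_hom eval2_gens assms)

section \<open>Binary forms\<close>

lemma homogeneous_0: "homogeneous r 0"
  by (simp add: homogeneous_def)

lemma homogeneous_add: "homogeneous r F \<Longrightarrow> homogeneous r G \<Longrightarrow> homogeneous r (F + G)"
  unfolding homogeneous_def by (metis add.right_neutral coeff_add)

lemma homogeneous_minus: "homogeneous r F \<Longrightarrow> homogeneous r (- F)"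
  unfolding homogeneous_def by simp

lemma homogeneous_diff: "homogeneous r F \<Longrightarrow> homogeneous r G \<Longrightarrow> homogeneous r (F - G)"
  using homogeneous_add[OF _ homogeneous_minus, of r F G] by simp

lemma homogeneous_sum: "(\<And>a. a \<in> A \<Longrightarrow> homogeneous r (f a)) \<Longrightarrow> homogeneous r (\<Sum>a\<in>A. f a)"
  by (induction A rule: infinite_finite_induct) (auto simp: homogeneous_0 homogeneous_add)

lemma homogeneous_monomial: "i + j = r \<Longrightarrow> homogeneous r (const2 c * varX ^ i * varY ^ j)"
  by (simp add: homogeneous_def coeff2_monomial)

lemma homogeneous_const2: "homogeneous 0 (const2 c)"
  using homogeneous_monomial[of 0 0 0 c] by simp

lemma const2_1: "const2 1 = 1"
  by (simp add: const2_def one_pCons)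

lemma homogeneous_varX: "homogeneous 1 varX" and homogeneous_varY: "homogeneous 1 varY"
  using homogeneous_monomial[of 1 0 1 1] homogeneous_monomial[of 0 1 1 1] by (simp_all add: const2_1)

lemma homogeneous_mult:
  assumes "homogeneous r F" "homogeneous s G"
  shows "homogeneous (r + s) (F * G)"
  unfolding homogeneous_def
proof (intro allI impI)
  fix i j assume "coeff (coeff (F * G) j) i \<noteq> 0"
  hence "(\<Sum>b\<le>j. \<Sum>a\<le>i. coeff (coeff F b) a * coeff (coeff G (j - b)) (i - a)) \<noteq> 0"
    by (simp add: coeff_mult coeff_sum)
  then obtain a b where "a \<le> i" "b \<le> j" "coeff (coeff F b) a * coeff (coeff G (j - b)) (i - a) \<noteq> 0"
    by (metis (no_types, lifting) atMost_iff sum.neutral)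
  moreover from this have "a + b = r" "(i - a) + (j - b) = s"
    using assms unfolding homogeneous_def by (metis mult_zero_left, metis mult_zero_right)
  ultimately show "i + j = r + s" by simp
qed

lemma homogeneous_const2_mult: "homogeneous r F \<Longrightarrow> homogeneous r (const2 c * F)"
  using homogeneous_mult[OF homogeneous_const2] by fastforce

lemma homogeneous_power: "homogeneous r F \<Longrightarrow> homogeneous (r * n) (F ^ n)"
  by (induction n) (use homogeneous_const2[of 1] in \<open>auto simp: const2_1 homogeneous_mult\<close>)

lemma homogeneous_power1: "homogeneous 1 F \<Longrightarrow> homogeneous n (F ^ n)"
  using homogeneous_power[of 1 F n] by simp

lemma homogeneous_expansion:
  fixes F :: "'k::comm_ring_1 poly poly"
  assumes "homogeneous r F"
  shows "F = (\<Sum>j\<le>r. const2 (coeff (coeff F j) (r - j)) * varX ^ (r - j) * varY ^ j)"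
proof (intro poly_eqI)
  fix n m
  have "coeff (coeff (\<Sum>j\<le>r. const2 (coeff (coeff F j) (r - j)) * varX ^ (r - j) * varY ^ j) n) m
    = (\<Sum>j\<le>r. if m = r - j \<and> n = j then coeff (coeff F j) (r - j) else 0)"
    by (simp only: coeff_sum coeff2_monomial)
  also have "\<dots> = (\<Sum>j\<le>r. if j = n then (if m = r - n then coeff (coeff F n) (r - n) else 0) else 0)"
    by (intro sum.cong refl) auto
  also have "\<dots> = coeff (coeff F n) m"
  proof (cases "coeff (coeff F n) m = 0")
    case False
    hence "m + n = r" using assms by (simp add: homogeneous_def)
    thus ?thesis by (auto simp: sum.delta)
  qed (auto simp: sum.delta)
  finally show "coeff (coeff F n) m =
    coeff (coeff (\<Sum>j\<le>r. const2 (coeff (coeff F j) (r - j)) * varX ^ (r - j) * varY ^ j) n) m" ..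
qed

text \<open>Setting \<open>X = 1\<close> identifies the forms of degree \<open>r\<close> with the polynomials of degree at most \<open>r\<close> in
  one variable, where division with remainder is available.\<close>

definition homogenize :: "nat \<Rightarrow> 'k::comm_ring_1 poly \<Rightarrow> 'k poly poly" where
  "homogenize r f = (\<Sum>j\<le>r. const2 (coeff f j) * varX ^ (r - j) * varY ^ j)"

abbreviation dehomogenize :: "'k::comm_ring_1 poly poly \<Rightarrow> 'k poly" where
  "dehomogenize \<equiv> eval2 (\<lambda>c. [:c:]) 1 [:0, 1:]"

lemma homogeneous_homogenize: "homogeneous r (homogenize r f)"
  unfolding homogenize_def by (intro homogeneous_sum homogeneous_monomial) auto

lemma dehomogenize_monomials:
  "dehomogenize (\<Sum>j\<le>r. const2 (c j) * varX ^ (r - j) * varY ^ j) = (\<Sum>j\<le>r. monom (c j) j)"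
proof -
  interpret d: comm_ring_hom dehomogenize by (rule eval2_hom[OF const_hom])
  have "[:0, 1:] ^ j = monom (1::'a) j" for j
    by (induction j) (simp_all add: monom_Suc monom_0 one_pCons)
  thus ?thesis
    by (simp add: d.hom_sum d.hom_mult d.hom_power eval2_gens[OF const_hom] smult_monom)
qed

lemma homogenize_dehomogenize:
  assumes "homogeneous r F" shows "homogenize r (dehomogenize F) = F"
proof -
  have "dehomogenize F = (\<Sum>j\<le>r. monom (coeff (coeff F j) (r - j)) j)"
    by (subst homogeneous_expansion[OF assms]) (rule dehomogenize_monomials)
  hence "coeff (dehomogenize F) j = coeff (coeff F j) (r - j)" if "j \<le> r" for j
    using that by (simp add: coeff_sum)
  thus ?thesis
    by (subst (2) homogeneous_expansion[OF assms]) (simp add: homogenize_def)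
qed

lemma dehomogenize_homogenize:
  assumes "degree f \<le> r" shows "dehomogenize (homogenize r f) = f"
  unfolding homogenize_def dehomogenize_monomials using assms by (rule poly_as_sum_of_monoms')


section \<open>The action of the general linear group\<close>


lemma det_2x2:
  fixes A :: "'k::comm_ring_1 mat"
  assumes "A \<in> carrier_mat 2 2"
  shows "det A = A $$ (0,0) * A $$ (1,1) - A $$ (0,1) * A $$ (1,0)"
proof -
  have [simp]: "mat_delete A 0 j \<in> carrier_mat 1 1" if "j < 2" for j
    using assms by (auto simp: mat_delete_def)
  have "det A = (\<Sum>j<2. A $$ (0, j) * cofactor A 0 j)"
    by (rule laplace_expansion_row[OF assms]) simp
  also have "\<dots> = A $$ (0,0) * A $$ (1,1) - A $$ (0,1) * A $$ (1,0)"
    using assms by (simp add: numeral_2_eq_2 cofactor_def det_single mat_delete_def)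
  finally show ?thesis .
qed

lemma GL2_simps:
  "carrier GL2 = {A :: 'k::field mat. A \<in> carrier_mat 2 2 \<and> det A \<noteq> 0}"
  "mult GL2 = ((*) :: 'k mat \<Rightarrow> _)" "one GL2 = (1\<^sub>m 2 :: 'k mat)"
proof -
  show "carrier GL2 = {A :: 'k::field mat. A \<in> carrier_mat 2 2 \<and> det A \<noteq> 0}"
    using det_non_zero_imp_unit[of _ 2 "()"] unit_imp_det_non_zero[of _ 2 "()"]
    by (auto simp: GL2_def units_of_def) (auto simp: Units_def ring_mat_def)
qed (simp_all add: GL2_def units_of_def ring_mat_simps)

lemma group_GL2: "Group.group (GL2 :: 'k::field mat monoid)"
proof -
  interpret ring "ring_mat TYPE('k) 2 ()" by (rule ring_mat)
  show ?thesis unfolding GL2_def by (rule units_group)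
qed

definition mat2 :: "'a \<Rightarrow> 'a \<Rightarrow> 'a \<Rightarrow> 'a \<Rightarrow> 'a mat" where
  "mat2 a b c d = mat 2 2 (\<lambda>(i, j). if i = 0 then (if j = 0 then a else b) else (if j = 0 then c else d))"

lemma mat2_carrier [simp]: "mat2 a b c d \<in> carrier_mat 2 2"
  by (simp add: mat2_def)

lemma mat2_entries [simp]:
  "mat2 a b c d $$ (0,0) = a" "mat2 a b c d $$ (0,Suc 0) = b"
  "mat2 a b c d $$ (Suc 0,0) = c" "mat2 a b c d $$ (Suc 0,Suc 0) = d"
  by (simp_all add: mat2_def)

lemma det_mat2: "det (mat2 a b c d) = a * d - b * (c :: 'k::comm_ring_1)"
  by (simp add: det_2x2)

lemma mat2_GL2: "mat2 a b c d \<in> carrier GL2 \<longleftrightarrow> a * d - b * c \<noteq> (0::'k::field)"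
  by (simp add: GL2_simps det_mat2)

lemma eval2_mat_act:
  assumes "comm_ring_hom h"
  shows "eval2 h P Q (mat_act A F) =
    eval2 h (h (A $$ (0,0)) * P + h (A $$ (1,0)) * Q) (h (A $$ (0,1)) * P + h (A $$ (1,1)) * Q) F"
proof -
  interpret e: comm_ring_hom "eval2 h P Q" by (rule eval2_hom) fact
  show ?thesis
    unfolding mat_act_def subst2_eq_eval2 hom_eval2[OF e.comm_ring_hom_axioms const2_hom]
    by (simp add: eval2_gens[OF assms] e.hom_add e.hom_mult)
qed

lemma mat_act_hom: "comm_ring_hom (mat_act A)"
  unfolding mat_act_def subst2_eq_eval2 by (rule eval2_hom[OF const2_hom])

lemma mat_act_gens:
  "mat_act A (const2 c) = const2 c"
  "mat_act A varX = const2 (A $$ (0,0)) * varX + const2 (A $$ (1,0)) * varY"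
  "mat_act A varY = const2 (A $$ (0,1)) * varX + const2 (A $$ (1,1)) * varY"
  unfolding mat_act_def subst2_eq_eval2 by (simp_all add: eval2_gens[OF const2_hom])

interpretation const2: comm_ring_hom const2 by (rule const2_hom)
interpretation mat_act: comm_ring_hom "mat_act A" for A by (rule mat_act_hom)

lemmas const2_simps = const2.hom_add const2.hom_mult const2.hom_power const2.hom_uminus
  const2.hom_minus const2.hom_zero const2.hom_one const2.hom_sum

lemmas mat_act_simps = mat_act.hom_add mat_act.hom_mult mat_act.hom_power mat_act.hom_uminus
  mat_act.hom_minus mat_act.hom_zero mat_act.hom_one mat_act.hom_sum mat_act_gens

lemma mat_act_one: "mat_act (1\<^sub>m 2) F = F"
  by (rule ring_hom_poly2_eqI[where F=F and g="\<lambda>x. x"])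
     (simp_all add: mat_act_hom id_ring_hom mat_act_simps const2_simps)

lemma mat_act_mult:
  assumes "A \<in> carrier_mat 2 2" "B \<in> carrier_mat 2 2"
  shows "mat_act (A * B) F = mat_act A (mat_act B F)"
proof -
  have entry: "(A * B) $$ (i, j) = A $$ (i, 0) * B $$ (0, j) + A $$ (i, Suc 0) * B $$ (Suc 0, j)"
    if "i < 2" "j < 2" for i j
    using assms that by (auto simp: scalar_prod_def numeral_2_eq_2)
  show ?thesis
    by (rule ring_hom_poly2_eqI[where F=F])
       (simp_all add: mat_act_hom comm_ring_hom_comp mat_act_simps const2_simps entry algebra_simps)
qed

lemma homogeneous_linear: "homogeneous 1 (const2 a * varX + const2 b * varY)"
  by (intro homogeneous_add homogeneous_const2_mult homogeneous_varX homogeneous_varY)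

lemma homogeneous_mat_act:
  assumes "homogeneous r F" shows "homogeneous r (mat_act A F)"
proof -
  have "homogeneous r (const2 c * P ^ (r - j) * Q ^ j)"
    if "homogeneous 1 P" "homogeneous 1 Q" "j \<le> r" for c P Q and j :: nat
    using homogeneous_mult[OF homogeneous_const2_mult[OF homogeneous_power1[OF that(1), of "r - j"]]
        homogeneous_power1[OF that(2), of j]] that(3) by simp
  note summand = this[OF homogeneous_linear homogeneous_linear]
  have "mat_act A F = (\<Sum>j\<le>r. const2 (coeff (coeff F j) (r - j)) *
      (const2 (A $$ (0,0)) * varX + const2 (A $$ (1,0)) * varY) ^ (r - j) *
      (const2 (A $$ (0,1)) * varX + const2 (A $$ (1,1)) * varY) ^ j)"
    by (subst homogeneous_expansion[OF assms]) (simp only: mat_act_simps)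
  thus ?thesis by (auto intro!: homogeneous_sum summand)
qed

lemma Vrep_simps [simp]:
  "carrier (Vrep r) = {F. homogeneous r F}" "zero (Vrep r) = 0" "add (Vrep r) = (+)"
  "smult (Vrep r) c F = const2 c * F" "act (Vrep r) = mat_act"
  by (simp_all add: Vrep_def)

lemma group_module_Vrep: "group_module GL2 class_ring (Vrep r :: ('k::field, _, _) gmodule)"
proof -
  have "abelian_group (Vrep r :: ('k, _, 'k mat) gmodule)"
    by (rule abelian_groupI)
       (auto simp: homogeneous_add homogeneous_0 algebra_simps intro: homogeneous_minus exI[of _ "- _"])
  then have "module class_ring (Vrep r :: ('k, _, 'k mat) gmodule)"
    by (intro moduleI class_cring.is_cring)
       (simp_all add: homogeneous_const2_mult const2_simps distrib_left distrib_right mult.assoc)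
  then show ?thesis
    unfolding group_module_def group_module_axioms_def
    by (auto simp: group_GL2 homogeneous_mat_act mat_act_one GL2_simps mat_act_mult mat_act_simps)
qed

section \<open>Divisibility by \<open>\<theta>\<close> and vanishing at rational points\<close>

lemma mod_ring_power_card: "(x :: 'p::prime_card mod_ring) ^ CARD('p) = x"
  using finite_field_power_card_eq_same[of x] by simp

lemma eval2_theta:
  assumes "comm_ring_hom h"
  shows "eval2 h P Q (theta :: 'p::prime_card mod_ring poly poly) = P ^ CARD('p) * Q - P * Q ^ CARD('p)"
proof -
  interpret e: comm_ring_hom "eval2 h P Q" by (rule eval2_hom) fact
  show ?thesis
    by (simp add: theta_def e.hom_minus e.hom_mult e.hom_power eval2_gens[OF assms])
qed

lemma frobenius_poly2:
  "(F + G :: 'p::prime_card mod_ring poly poly) ^ CARD('p) = F ^ CARD('p) + G ^ CARD('p)"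
  by (rule freshmans_dream) (simp_all add: prime_card)

lemma mat_act_theta:
  assumes "A \<in> carrier_mat 2 2"
  shows "mat_act A theta = const2 (det A) * (theta :: 'p::prime_card mod_ring poly poly)"
proof -
  have [simp]: "const2 c ^ CARD('p) = const2 c" for c :: "'p mod_ring"
    by (simp add: mod_ring_power_card flip: const2_simps)
  show ?thesis
    unfolding theta_def det_2x2[OF assms]
    by (simp add: mat_act_simps frobenius_poly2 power_mult_distrib const2_simps algebra_simps)
qed

lemma homogeneous_theta: "homogeneous (CARD('p) + 1) (theta :: 'p::prime_card mod_ring poly poly)"
  using homogeneous_diff[OF homogeneous_mult[OF homogeneous_power1[OF homogeneous_varX] homogeneous_varY]
      homogeneous_mult[OF homogeneous_power1[OF homogeneous_varY] homogeneous_varX]]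
  unfolding theta_def by (simp add: mult.commute)

lemma theta_nonzero: "(theta :: 'p::prime_card mod_ring poly poly) \<noteq> 0"
proof -
  have "CARD('p) \<noteq> 1" using prime_card[where 'a='p] by auto
  hence "coeff (coeff (const2 1 * varX ^ CARD('p) * varY ^ 1 - const2 1 * varX ^ 1 * varY ^ CARD('p)) 1) CARD('p)
    = (1 :: 'p mod_ring)"
    unfolding coeff_diff coeff2_monomial by simp
  thus ?thesis by (auto simp: theta_def const2_simps)
qed


abbreviation val :: "'k::comm_ring_1 \<Rightarrow> 'k \<Rightarrow> 'k poly poly \<Rightarrow> 'k" where
  "val x y \<equiv> eval2 (\<lambda>c. c) x y"

interpretation val: comm_ring_hom "val x y" for x y by (rule eval2_hom[OF id_ring_hom])

lemmas val_gens = eval2_gens[OF id_ring_hom]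
lemmas val_simps = val.hom_add val.hom_mult val.hom_power val.hom_uminus val.hom_minus
  val.hom_zero val.hom_one val.hom_sum val_gens

lemma val_theta: "val x y (theta :: 'p::prime_card mod_ring poly poly) = 0"
  by (simp add: eval2_theta[OF id_ring_hom] mod_ring_power_card)

lemma poly_dehomogenize: "poly (dehomogenize F) c = val 1 c F"
  using hom_eval2[OF _ const_hom, of "\<lambda>q. poly q c" 1 "[:0, 1:]" F]
  by (simp add: poly_hom.comm_ring_hom_axioms)

text \<open>Put \<open>X = 1\<close>.  The resulting polynomial vanishes on the whole field, so \<open>y\<^sup>p - y\<close> divides it.  The
  value of \<open>F\<close> at \<open>(0, 1)\<close> is its coefficient of \<open>y\<^sup>s\<close>; as this vanishes too, the quotient has
  degree at most \<open>s - (p + 1)\<close> and is again a form.\<close>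

lemma vanishing_form:
  fixes F :: "'p::prime_card mod_ring poly poly"
  assumes F: "homogeneous s F" and 0: "\<And>x y. (x, y) \<noteq> (0, 0) \<Longrightarrow> val x y F = 0"
  shows "\<exists>H. F = theta * H \<and> (if CARD('p) + 1 \<le> s then homogeneous (s - (CARD('p) + 1)) H else H = 0)"
proof (cases "F = 0")
  case False
  define f where "f = dehomogenize F"
  define q :: "'p mod_ring poly" where "q = [:0, 1:] ^ CARD('p) - [:0, 1:]"
  have p1: "1 < CARD('p)" using prime_card[where 'a='p] prime_gt_1_nat by auto
  have deg_q: "degree q = CARD('p)"
    using p1 degree_add_eq_left[of "- [:0, 1:]" "[:0, 1:] ^ CARD('p) :: 'p mod_ring poly"]
    unfolding q_def diff_conv_add_uminus by (simp add: degree_power_eq)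
  have Ff: "F = homogenize s f" unfolding f_def using homogenize_dehomogenize[OF F] by simp
  have f_homog: "f = (\<Sum>j\<le>s. monom (coeff f j) j)"
    using dehomogenize_monomials[of "coeff f" s, folded homogenize_def, folded Ff, folded f_def] .
  have deg_f: "degree f \<le> s"
    by (subst f_homog) (intro degree_sum_le, auto intro: order.trans[OF degree_monom_le])
  have "val 0 1 F = (\<Sum>j\<le>s. if j = s then coeff f j else 0)"
    unfolding Ff homogenize_def val_simps by (intro sum.cong refl) (auto simp: power_0_left)
  hence "coeff f s = 0" using 0[of 0 1] by simp
  moreover have f0: "f \<noteq> 0" using False Ff by (auto simp: homogenize_def const2_simps)
  ultimately have deg_f': "degree f < s" using deg_f by (metis leading_coeff_0_iff le_neq_implies_less)
  have "f mod q = 0"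
  proof (rule ccontr)
    assume r: "f mod q \<noteq> 0"
    have "poly q c = 0" for c by (simp add: q_def mod_ring_power_card)
    moreover have "poly f c = 0" for c using 0[of 1 c] by (simp add: f_def poly_dehomogenize)
    moreover have "poly f c = poly (f div q) c * poly q c + poly (f mod q) c" for c
      by (simp flip: poly_mult poly_add)
    ultimately have "poly (f mod q) c = 0" for c by simp
    hence "card {c. poly (f mod q) c = 0} = CARD('p)" by simp
    moreover have "card {c. poly (f mod q) c = 0} \<le> degree (f mod q)"
      by (rule card_poly_roots_bound) fact
    moreover have "degree (f mod q) < CARD('p)"
      using degree_mod_less[of q f] r deg_q p1 by force
    ultimately show False by simp
  qed
  then obtain k where k: "f = q * k" by (metis dvd_def mod_0_imp_dvd)
  hence k0: "k \<noteq> 0" "q \<noteq> 0" using f0 by auto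
  have deg_k: "CARD('p) + degree k < s" using deg_f' k0 by (simp add: k degree_mult_eq deg_q)
  define H where "H = - homogenize (s - (CARD('p) + 1)) k"
  have H: "homogeneous (s - (CARD('p) + 1)) H"
    unfolding H_def by (intro homogeneous_minus homogeneous_homogenize)
  interpret d: comm_ring_hom "dehomogenize :: 'p mod_ring poly poly \<Rightarrow> _" by (rule eval2_hom[OF const_hom])
  have "homogeneous s (theta * H)"
    using homogeneous_mult[OF homogeneous_theta H] deg_k by simp
  hence "theta * H = homogenize s (dehomogenize (theta * H))"
    by (rule homogenize_dehomogenize[symmetric])
  also have "dehomogenize (theta * H) = f"
    using deg_k
    by (simp add: d.hom_mult eval2_theta[OF const_hom] H_def d.hom_uminus dehomogenize_homogenize k q_def algebra_simps)
  finally have "F = theta * H" using Ff by simp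
  thus ?thesis using H deg_k by auto
qed (auto intro: exI[of _ 0] simp: homogeneous_0)

text \<open>In \<open>Vfilt\<close> the quotient by \<open>\<theta>\<^sup>m\<close> is an arbitrary polynomial; it is in fact a form, since each
  factor \<open>\<theta>\<close> can be split off by \<open>vanishing_form\<close>.\<close>

lemma theta_power_dvd_form:
  fixes F :: "'p::prime_card mod_ring poly poly"
  assumes "homogeneous s F" "theta ^ m dvd F"
  shows "\<exists>H. F = theta ^ m * H \<and> (if m * (CARD('p) + 1) \<le> s then homogeneous (s - m * (CARD('p) + 1)) H else H = 0)"
proof -
  define P where "P = CARD('p) + 1"
  have "\<exists>H. F = theta ^ m * H \<and> (if m * P \<le> s then homogeneous (s - m * P) H else H = 0)"
    using assms
  proof (induction m arbitrary: s F)
    case (Suc m)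
    obtain H' where H': "F = theta * (theta ^ m * H')"
      using Suc.prems(2) by (auto simp: dvd_def mult.assoc)
    hence "val x y F = 0" for x y by (simp add: val_simps val_theta)
    from vanishing_form[OF Suc.prems(1) this] obtain H1 where H1: "F = theta * H1"
      "if P \<le> s then homogeneous (s - P) H1 else H1 = 0" unfolding P_def by blast
    with H' theta_nonzero have "H1 = theta ^ m * H'" by (metis mult_cancel_left)
    hence dvd: "theta ^ m dvd H1" by simp
    show ?case
    proof (cases "P \<le> s")
      case True
      with Suc.IH[OF _ dvd, of "s - P"] H1 obtain H where H: "H1 = theta ^ m * H"
        "if m * P \<le> s - P then homogeneous (s - P - m * P) H else H = 0" by auto
      have "m * P \<le> s - P \<longleftrightarrow> Suc m * P \<le> s" "s - P - m * P = s - Suc m * P"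
        using True by auto
      with H(2) have "if Suc m * P \<le> s then homogeneous (s - Suc m * P) H else H = 0" by metis
      moreover have "F = theta ^ Suc m * H" using H1 H(1) by (simp add: mult.assoc)
      ultimately show ?thesis by blast
    next
      case False
      hence "\<not> Suc m * P \<le> s" by auto
      thus ?thesis using H1 False by (intro exI[of _ 0]) auto
    qed
  qed (auto intro: exI[of _ F])
  thus ?thesis by (simp only: P_def)
qed

text \<open>The restriction \<open>F(P + t v)\<close> of a form to the line through \<open>P = (x, y)\<close> with direction
  \<open>v = (x', y')\<close>, as a polynomial in \<open>t\<close>.\<close>

definition jet :: "'k::comm_ring_1 \<Rightarrow> 'k \<Rightarrow> 'k \<Rightarrow> 'k \<Rightarrow> 'k poly poly \<Rightarrow> 'k poly" where
  "jet x y x' y' = eval2 (\<lambda>c. [:c:]) [:x, x':] [:y, y':]"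

interpretation jet: comm_ring_hom "jet x y x' y'" for x y x' y'
  unfolding jet_def by (rule eval2_hom[OF const_hom])

lemma jet_gens: "jet x y x' y' (const2 c) = [:c:]" "jet x y x' y' varX = [:x, x':]"
  "jet x y x' y' varY = [:y, y':]"
  by (simp_all add: jet_def eval2_gens[OF const_hom])

lemmas jet_simps = jet.hom_add jet.hom_mult jet.hom_power jet.hom_uminus jet.hom_minus
  jet.hom_zero jet.hom_one jet.hom_sum jet_gens

lemma poly_jet_0: "poly (jet x y x' y' F) 0 = val x y F"
  unfolding jet_def using hom_eval2[OF _ const_hom, of "\<lambda>q. poly q 0" "[:x, x':]" "[:y, y':]" F]
  by (simp add: poly_hom.comm_ring_hom_axioms)

abbreviation tvar :: "'k::comm_ring_1 poly" where "tvar \<equiv> [:0, 1:]"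

lemma tvar_dvd_iff: "tvar dvd q \<longleftrightarrow> poly q (0::'k::idom) = 0"
  using poly_eq_0_iff_dvd[of q 0] by simp

text \<open>Because of the Frobenius map only the terms of degree \<open>1\<close> and \<open>p\<close> survive.  The zero at \<open>t = 0\<close>
  is simple exactly if the point and the direction are linearly independent.\<close>

lemma jet_theta:
  "jet x y x' y' (theta :: 'p::prime_card mod_ring poly poly)
    = [:x * y' - y * x':] * (tvar * (1 - tvar ^ (CARD('p) - 1)))"
proof -
  have lin: "[:u, v:] = [:u:] + [:v:] * tvar" for u v :: "'p mod_ring" by simp
  have const: "[:c:] ^ CARD('p) = [:c:]" for c :: "'p mod_ring"
    by (simp add: mod_ring_power_card poly_const_pow)
  have frob: "([:u:] + [:v:] * tvar) ^ CARD('p) = [:u:] + [:v:] * tvar ^ CARD('p)" for u v :: "'p mod_ring"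
    by (subst freshmans_dream) (simp_all only: semiring_char_poly semiring_char_mod_ring prime_card power_mult_distrib const)
  have pow: "tvar ^ CARD('p) = tvar * tvar ^ (CARD('p) - 1)"
    by (metis power_eq_if zero_less_card_finite less_not_refl)
  have det: "[:x * y' - y * x':] = [:x:] * [:y':] - [:y:] * [:x':]" by simp
  show ?thesis
    unfolding jet_def eval2_theta[OF const_hom] lin[of x x'] lin[of y y'] frob pow det
    by (simp only: algebra_simps mult_1_left mult_1_right)
qed

text \<open>The leading coefficient of \<open>\<theta>\<^sup>m H\<close> along a line is the value of \<open>H\<close>, up to a power of the
  determinant of the point and the direction.\<close>

lemma jet_theta_power_mult:
  fixes H :: "'p::prime_card mod_ring poly poly"
  shows "tvar ^ (m + 1) dvd
    jet x y x' y' (theta ^ m * H) - [:(x * y' - y * x') ^ m * val x y H:] * tvar ^ m"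
proof -
  let ?w = "[:(x * y' - y * x') ^ m:] * (1 - tvar ^ (CARD('p) - 1)) ^ m * jet x y x' y' H
    - [:(x * y' - y * x') ^ m * val x y H:]"
  have "CARD('p) - 1 \<noteq> 0" using prime_card[where 'a='p] prime_gt_1_nat by fastforce
  hence "poly ?w 0 = 0" by (simp add: poly_jet_0 power_0_left)
  hence "tvar dvd ?w" by (simp only: tvar_dvd_iff)
  hence "tvar ^ m * tvar dvd tvar ^ m * ?w" by (rule mult_dvd_mono[OF dvd_refl])
  also have "tvar ^ m * ?w = jet x y x' y' (theta ^ m * H) - [:(x * y' - y * x') ^ m * val x y H:] * tvar ^ m"
    by (simp only: jet_simps jet_theta power_mult_distrib poly_const_pow) (simp only: algebra_simps)
  finally show ?thesis by (simp only: power_add power_one_right)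
qed

lemma dvd_jet_theta_power:
  fixes H :: "'p::prime_card mod_ring poly poly"
  shows "tvar ^ m dvd jet x y x' y' (theta ^ m * H)"
  by (simp only: jet_simps jet_theta power_mult_distrib) (simp add: dvd_mult dvd_mult2)

lemma val_from_jet:
  fixes H :: "'p::prime_card mod_ring poly poly"
  assumes "x * y' - y * x' \<noteq> 0"
    and "tvar ^ (m + 1) dvd jet x y x' y' (theta ^ m * H) - [:c:] * tvar ^ m"
  shows "(x * y' - y * x') ^ m * val x y H = c"
proof -
  have "tvar ^ (m + 1) dvd
      (jet x y x' y' (theta ^ m * H) - [:c:] * tvar ^ m)
      - (jet x y x' y' (theta ^ m * H) - [:(x * y' - y * x') ^ m * val x y H:] * tvar ^ m)"
    by (intro dvd_diff assms jet_theta_power_mult)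
  also have "\<dots> = tvar ^ m * [:(x * y' - y * x') ^ m * val x y H - c:]"
    by (simp add: algebra_simps smult_diff_left flip: diff_pCons)
  finally have "tvar ^ m * tvar dvd tvar ^ m * [:(x * y' - y * x') ^ m * val x y H - c:]"
    by (simp only: power_add power_one_right)
  hence "tvar dvd [:(x * y' - y * x') ^ m * val x y H - c:]"
    by (subst (asm) dvd_times_left_cancel_iff) simp_all
  thus ?thesis by (simp only: tvar_dvd_iff) simp
qed

text \<open>By induction on \<open>m\<close>: if \<open>F = \<theta>\<^sup>m H\<close> vanishes to one order more at a point, then \<open>H\<close> vanishes
  there, and a form vanishing at all points is divisible by \<open>\<theta>\<close>.\<close>

lemma theta_power_dvdI:
  fixes F :: "'p::prime_card mod_ring poly poly"
  assumes F: "homogeneous s F"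
    and ex: "\<And>x y. (x, y) \<noteq> (0, 0) \<Longrightarrow>
      \<exists>x' y'. x * y' - y * x' \<noteq> 0 \<and> tvar ^ m dvd jet x y x' y' F"
  shows "theta ^ m dvd F"
  using ex
proof (induction m)
  case (Suc m)
  have "\<exists>x' y'. x * y' - y * x' \<noteq> 0 \<and> tvar ^ m dvd jet x y x' y' F" if "(x, y) \<noteq> (0, 0)" for x y
    using Suc.prems[OF that] by (meson dvd_trans le_imp_power_dvd le_add2 lessI less_imp_le)
  from theta_power_dvd_form[OF F Suc.IH[OF this]] obtain H where H: "F = theta ^ m * H"
    "if m * (CARD('p) + 1) \<le> s then homogeneous (s - m * (CARD('p) + 1)) H else H = 0" by blast
  have "val x y H = 0" if xy: "(x, y) \<noteq> (0, 0)" for x y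
  proof -
    obtain x' y' where *: "x * y' - y * x' \<noteq> 0" "tvar ^ Suc m dvd jet x y x' y' F"
      using Suc.prems[OF xy] by blast
    have "(x * y' - y * x') ^ m * val x y H = 0"
      using *(2) by (intro val_from_jet[OF *(1)]) (simp add: H(1))
    thus ?thesis using *(1) by simp
  qed
  moreover have "\<exists>s'. homogeneous s' H" using H(2) homogeneous_0 by (metis (full_types))
  ultimately obtain K where "H = theta * K" using vanishing_form by blast
  thus ?case using H(1) by simp
qed simp


section \<open>Character sums\<close>

lemma unit_power_card_minus_1:
  fixes x :: "'p::prime_card mod_ring"
  assumes "x \<noteq> 0" shows "x ^ (CARD('p) - 1) = 1"
proof -
  have "x * x ^ (CARD('p) - 1) = x"
    using mod_ring_power_card[of x] by (metis power_eq_if zero_less_card_finite less_not_refl)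
  thus ?thesis using assms by simp
qed

lemma unit_power_cong:
  fixes x :: "'p::prime_card mod_ring"
  assumes "x \<noteq> 0" "[m = n] (mod (CARD('p) - 1))"
  shows "x ^ m = x ^ n"
proof -
  have *: "x ^ m = x ^ (m mod (CARD('p) - 1))" for m
  proof -
    have "x ^ m = x ^ ((CARD('p) - 1) * (m div (CARD('p) - 1)) + m mod (CARD('p) - 1))" by simp
    also have "\<dots> = x ^ (m mod (CARD('p) - 1))"
      by (simp only: power_add power_mult unit_power_card_minus_1[OF assms(1)]) simp
    finally show ?thesis .
  qed
  show ?thesis using assms(2) *[of m] *[of n] by (simp add: cong_def)
qed

text \<open>There is a unit \<open>g\<close> with \<open>g\<^sup>n \<noteq> 1\<close>, since \<open>x\<^sup>n - 1\<close> has at most \<open>n\<close> roots.  Substituting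
  \<open>g x\<close> for \<open>x\<close> multiplies the sum by \<open>g\<^sup>n\<close> and leaves it unchanged.\<close>

lemma sum_units_power:
  assumes "0 < n" "n < CARD('p) - 1"
  shows "(\<Sum>x\<in>UNIV - {0}. (x :: 'p::prime_card mod_ring) ^ n) = 0"
proof -
  let ?q = "[:0, 1:] ^ n - 1 :: 'p mod_ring poly"
  have deg: "degree ?q = n"
    using assms degree_add_eq_left[of "- 1" "[:0, 1:] ^ n :: 'p mod_ring poly"]
    unfolding diff_conv_add_uminus by (simp add: degree_power_eq)
  hence "?q \<noteq> 0" using assms by force
  hence "card {x. poly ?q x = 0} \<le> n" using card_poly_roots_bound[of ?q] deg by simp
  also have "n < card (UNIV - {0 :: 'p mod_ring})" using assms by simp
  finally have "\<not> (UNIV - {0} \<subseteq> {x. poly ?q x = 0})"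
    by (meson card_mono finite not_le)
  then obtain g :: "'p mod_ring" where g: "g \<noteq> 0" "g ^ n \<noteq> 1" by auto
  have "(\<Sum>x\<in>UNIV - {0}. x ^ n) = (\<Sum>x\<in>UNIV - {0}. (g * x) ^ n)"
    by (rule sum.reindex_bij_witness[of _ "\<lambda>x. g * x" "\<lambda>x. x / g"]) (use g in auto)
  also have "\<dots> = g ^ n * (\<Sum>x\<in>UNIV - {0}. x ^ n)"
    by (simp add: power_mult_distrib sum_distrib_left)
  finally show ?thesis using g(2) by simp
qed

lemma sum_units_orthogonality:
  assumes "j < CARD('p) - 1" "k < CARD('p) - 1"
  shows "(\<Sum>x\<in>UNIV - {0}. (x :: 'p::prime_card mod_ring) ^ j * inverse x ^ k) = (if j = k then - 1 else 0)"
proof (cases j k rule: linorder_cases)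
  case less
  have "(\<Sum>x\<in>UNIV - {0}. (x :: 'p mod_ring) ^ j * inverse x ^ k) = (\<Sum>x\<in>UNIV - {0}. inverse x ^ (k - j))"
    using less by (intro sum.cong refl) (simp add: power_inverse power_diff field_simps)
  also have "\<dots> = (\<Sum>x\<in>UNIV - {0}. (x :: 'p mod_ring) ^ (k - j))"
    by (rule sum.reindex_bij_witness[of _ inverse inverse]) auto
  finally show ?thesis using less assms by (simp add: sum_units_power)
next
  case equal
  have "(\<Sum>x\<in>UNIV - {0}. (x :: 'p mod_ring) ^ j * inverse x ^ k) = (\<Sum>x\<in>UNIV - {0 :: 'p mod_ring}. 1)"
    using equal by (intro sum.cong refl) (simp flip: power_mult_distrib)
  also have "\<dots> = of_nat (CARD('p) - 1)" by simp
  also have "\<dots> = (- 1 :: 'p mod_ring)" by (subst of_nat_diff) (auto simp: Suc_leI)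
  finally show ?thesis using equal by simp
next
  case greater
  have "(\<Sum>x\<in>UNIV - {0}. (x :: 'p mod_ring) ^ j * inverse x ^ k) = (\<Sum>x\<in>UNIV - {0}. x ^ (j - k))"
    using greater by (intro sum.cong refl) (simp add: power_inverse power_diff field_simps)
  thus ?thesis using greater assms by (simp add: sum_units_power)
qed

lemma coefficient_extraction:
  fixes h :: "'p::prime_card mod_ring \<Rightarrow> 'a::comm_ring_1"
  assumes "comm_ring_hom h" "n < CARD('p) - 1" "k \<le> n"
  shows "(\<Sum>x\<in>UNIV - {0}. h (inverse x) ^ k * (\<Sum>j\<le>n. h x ^ j * R j)) = - R k"
proof -
  interpret h: comm_ring_hom h by fact
  have "(\<Sum>x\<in>UNIV - {0}. h (inverse x) ^ k * (\<Sum>j\<le>n. h x ^ j * R j))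
    = (\<Sum>j\<le>n. (\<Sum>x\<in>UNIV - {0}. h (inverse x) ^ k * (h x ^ j * R j)))"
    by (subst sum.swap) (simp only: sum_distrib_left)
  also have "\<dots> = (\<Sum>j\<le>n. h (\<Sum>x\<in>UNIV - {0}. x ^ j * inverse x ^ k) * R j)"
    by (simp only: h.hom_sum h.hom_mult h.hom_power sum_distrib_left sum_distrib_right mult_ac)
  also have "\<dots> = (\<Sum>j\<le>n. if j = k then - R k else 0)"
    using assms(2,3) by (intro sum.cong refl) (simp add: sum_units_orthogonality h.hom_uminus)
  also have "\<dots> = - R k" using assms(3) by (simp add: sum.delta)
  finally show ?thesis .
qed

text \<open>The coefficients of a polynomial of degree below \<open>p - 1\<close> are weighted sums of its values at the
  units.  Collecting them with the monomials in \<open>Q\<close> and \<open>-P\<close> evaluates the homogenized polynomial at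
  \<open>(Q, -P)\<close>.  If \<open>(1, x)\<close> are the coefficients of the linear form \<open>X + x Y\<close>, then \<open>(Q, -P)\<close> are
  those of a linear form that vanishes at \<open>(P, Q)\<close>.\<close>

lemma reproducing_kernel:
  fixes h :: "'p::prime_card mod_ring \<Rightarrow> 'a::comm_ring_1"
  assumes h: "comm_ring_hom h" and i: "i < CARD('p) - 1" and f: "degree f \<le> i"
  shows "(\<Sum>x\<in>UNIV - {0}. poly f (h x) * (\<Sum>k\<le>i. h (inverse x) ^ k * (- P) ^ k * Q ^ (i - k)))
    = - eval2 (\<lambda>c. c) Q (- P) (homogenize i f)"
proof -
  have "poly f (h x) = (\<Sum>j\<le>i. h x ^ j * coeff f j)" for x
    by (subst poly_as_sum_of_monoms'[OF f, symmetric]) (simp add: poly_sum poly_monom mult.commute)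
  hence "(\<Sum>x\<in>UNIV - {0}. poly f (h x) * (\<Sum>k\<le>i. h (inverse x) ^ k * (- P) ^ k * Q ^ (i - k)))
    = (\<Sum>x\<in>UNIV - {0}. \<Sum>k\<le>i. (h (inverse x) ^ k * (\<Sum>j\<le>i. h x ^ j * coeff f j)) * ((- P) ^ k * Q ^ (i - k)))"
    by (intro sum.cong refl) (simp add: sum_distrib_left mult_ac)
  also have "\<dots> = (\<Sum>k\<le>i. (\<Sum>x\<in>UNIV - {0}. h (inverse x) ^ k * (\<Sum>j\<le>i. h x ^ j * coeff f j)) * ((- P) ^ k * Q ^ (i - k)))"
    by (subst sum.swap) (simp only: sum_distrib_right)
  also have "\<dots> = (\<Sum>k\<le>i. - coeff f k * ((- P) ^ k * Q ^ (i - k)))"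
    by (intro sum.cong refl) (simp add: coefficient_extraction[OF h i])
  also have "\<dots> = - eval2 (\<lambda>c. c) Q (- P) (homogenize i f)"
    by (simp add: homogenize_def val_simps sum_negf mult_ac)
  finally show ?thesis .
qed

lemma homogenize_linear_product:
  assumes "m \<le> i"
  shows "homogenize i ([:a, b:] ^ (i - m) * [:c, d:] ^ m)
    = (const2 a * varX + const2 b * varY) ^ (i - m) * (const2 c * varX + const2 d * varY) ^ m"
    (is "_ = ?F")
proof -
  interpret d: comm_ring_hom dehomogenize by (rule eval2_hom[OF const_hom])
  have "homogeneous i ?F"
    using homogeneous_mult[OF homogeneous_power1[OF homogeneous_linear] homogeneous_power1[OF homogeneous_linear]]
      assms by (metis le_add_diff_inverse2)
  moreover have "dehomogenize ?F = [:a, b:] ^ (i - m) * [:c, d:] ^ m"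
    by (simp add: d.hom_mult d.hom_add d.hom_power eval2_gens[OF const_hom])
  ultimately show ?thesis using homogenize_dehomogenize by metis
qed

lemma reproducing_kernel_product:
  fixes h :: "'p::prime_card mod_ring \<Rightarrow> 'a::comm_ring_1"
  assumes h: "comm_ring_hom h" and i: "i < CARD('p) - 1" and m: "m \<le> i"
  shows "(\<Sum>x\<in>UNIV - {0}. ((a + h x * b) ^ (i - m) * (c + h x * d) ^ m)
      * (\<Sum>k\<le>i. h (inverse x) ^ k * (- P) ^ k * Q ^ (i - k)))
    = - ((a * Q - b * P) ^ (i - m) * (c * Q - d * P) ^ m)"
proof -
  have "degree ([:a, b:] ^ (i - m) * [:c, d:] ^ m) \<le> degree ([:a, b:] ^ (i - m)) + degree ([:c, d:] ^ m)"
    by (rule degree_mult_le)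
  also have "\<dots> \<le> degree [:a, b:] * (i - m) + degree [:c, d:] * m"
    by (intro add_mono degree_power_le)
  also have "\<dots> \<le> 1 * (i - m) + 1 * m"
    by (intro add_mono mult_right_mono) auto
  finally have "degree ([:a, b:] ^ (i - m) * [:c, d:] ^ m) \<le> i" using m by simp
  from reproducing_kernel[OF h i this, of P Q] show ?thesis
    by (simp add: homogenize_linear_product[OF m] val_simps)
qed


section \<open>A relation between powers of linear forms\<close>

text \<open>The reproducing kernel at the generic point \<open>(X, Y)\<close>.\<close>

definition kernel_form :: "nat \<Rightarrow> 'p::prime_card mod_ring \<Rightarrow> 'p mod_ring poly poly" where
  "kernel_form i c = (\<Sum>k\<le>i. const2 (inverse c) ^ k * (- varX) ^ k * varY ^ (i - k))"

definition relation_form :: "nat \<Rightarrow> nat \<Rightarrow> 'p::prime_card mod_ring poly poly" where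
  "relation_form N i = - (\<Sum>c\<in>UNIV - {0}. (varX + const2 c * varY) ^ N * kernel_form i c)"

text \<open>For \<open>u \<noteq> 0\<close> this is the binomial expansion, with the exponent \<open>N - m\<close> of \<open>u\<close> lowered to \<open>i - m\<close> by
  Fermat.  For \<open>u = 0\<close> the lowered exponent turns the vanishing coefficient of \<open>t\<^sup>i\<close> into
  \<open>binom N i * w\<^sup>i\<close>, which the last summand takes back.\<close>

lemma tvar_power_expansion:
  fixes u w :: "'p::prime_card mod_ring"
  assumes N: "i < N" "[N = i] (mod (CARD('p) - 1))"
  shows "tvar ^ (i + 1) dvd [:u, w:] ^ N
    - (\<Sum>m\<le>i. of_nat (N choose m) * tvar ^ m * ([:u:] ^ (i - m) * [:w:] ^ m))
    + (if u = 0 then [:of_nat (N choose i) * w ^ i:] * tvar ^ i else 0)"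
proof (cases "u = 0")
  case True
  have "[:u, w:] ^ N = tvar ^ N * [:w:] ^ N"
    using True by (simp flip: power_mult_distrib)
  moreover have "tvar ^ (i + 1) dvd tvar ^ N * [:w:] ^ N"
    using N(1) by (intro dvd_mult2 le_imp_power_dvd) simp
  ultimately have "tvar ^ (i + 1) dvd [:u, w:] ^ N" by (simp only:)
  moreover have "(\<Sum>m\<le>i. of_nat (N choose m) * tvar ^ m * ([:u:] ^ (i - m) * [:w:] ^ m))
    = (\<Sum>m\<le>i. if m = i then of_nat (N choose i) * tvar ^ i * [:w:] ^ i else 0)"
    using True by (intro sum.cong refl) (auto simp: power_0_left)
  hence "(\<Sum>m\<le>i. of_nat (N choose m) * tvar ^ m * ([:u:] ^ (i - m) * [:w:] ^ m))
    = [:of_nat (N choose i) * w ^ i:] * tvar ^ i"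
    by (simp add: sum.delta poly_const_pow of_nat_poly mult_ac)
  ultimately show ?thesis using True by simp
next
  case False
  have "[:u, w:] ^ N = ([:w:] * tvar + [:u:]) ^ N" by simp
  also have "\<dots> = (\<Sum>m\<le>N. of_nat (N choose m) * ([:w:] * tvar) ^ m * [:u:] ^ (N - m))"
    by (rule binomial_ring)
  also have "{..N} = {..i} \<union> {i<..N}" using N by auto
  also have "(\<Sum>m\<in>{..i} \<union> {i<..N}. of_nat (N choose m) * ([:w:] * tvar) ^ m * [:u:] ^ (N - m))
    = (\<Sum>m\<le>i. of_nat (N choose m) * ([:w:] * tvar) ^ m * [:u:] ^ (N - m))
      + (\<Sum>m\<in>{i<..N}. of_nat (N choose m) * ([:w:] * tvar) ^ m * [:u:] ^ (N - m))"
    by (rule sum.union_disjoint) auto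
  also have "(\<Sum>m\<le>i. of_nat (N choose m) * ([:w:] * tvar) ^ m * [:u:] ^ (N - m))
    = (\<Sum>m\<le>i. of_nat (N choose m) * tvar ^ m * ([:u:] ^ (i - m) * [:w:] ^ m))"
  proof (intro sum.cong refl)
    fix m assume m: "m \<in> {..i}"
    have "[N - m = i - m] (mod (CARD('p) - 1))"
      using m N by (intro cong_diff_nat) auto
    hence "u ^ (N - m) = u ^ (i - m)" by (rule unit_power_cong[OF False])
    thus "of_nat (N choose m) * ([:w:] * tvar) ^ m * [:u:] ^ (N - m)
      = of_nat (N choose m) * tvar ^ m * ([:u:] ^ (i - m) * [:w:] ^ m)"
      by (simp only: poly_const_pow power_mult_distrib mult_ac)
  qed
  finally have "[:u, w:] ^ N - (\<Sum>m\<le>i. of_nat (N choose m) * tvar ^ m * ([:u:] ^ (i - m) * [:w:] ^ m))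
    = (\<Sum>m\<in>{i<..N}. of_nat (N choose m) * ([:w:] * tvar) ^ m * [:u:] ^ (N - m))" by simp
  moreover have "tvar ^ (i + 1) dvd (\<Sum>m\<in>{i<..N}. of_nat (N choose m) * ([:w:] * tvar) ^ m * [:u:] ^ (N - m))"
  proof (rule dvd_sum)
    fix m assume "m \<in> {i<..N}"
    hence "tvar ^ (i + 1) dvd tvar ^ m" by (intro le_imp_power_dvd) auto
    thus "tvar ^ (i + 1) dvd of_nat (N choose m) * ([:w:] * tvar) ^ m * [:u:] ^ (N - m)"
      unfolding power_mult_distrib by (intro dvd_mult2[OF dvd_mult[OF dvd_mult]])
  qed
  ultimately show ?thesis using False by simp
qed

text \<open>Up to order \<open>i\<close>, the expansion of \<open>(X + c Y)\<^sup>N\<close> at \<open>P + t v\<close> is a polynomial of degree \<open>i\<close> in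
  \<open>c\<close>.  The reproducing kernel replaces the linear form \<open>X + c Y\<close> by the one that vanishes at \<open>P + t v\<close>:
  its value at \<open>P\<close> is \<open>D t\<close> and its value at \<open>v\<close> is \<open>-D\<close>.  So each of the terms becomes a multiple of
  \<open>D\<^sup>i t\<^sup>i\<close>.  The summand for \<open>x \<noteq> 0\<close>, \<open>y \<noteq> 0\<close> is the correction of \<open>tvar_power_expansion\<close> for the
  only \<open>c\<close> with \<open>x + c y = 0\<close>.\<close>

lemma jet_relation_form:
  fixes x y x' y' :: "'p::prime_card mod_ring"
  assumes N: "i < N" "[N = i] (mod (CARD('p) - 1))" and i: "i < CARD('p) - 1"
    and xy: "(x, y) \<noteq> (0, 0)"
  defines "D \<equiv> x * y' - y * x'"
  shows "tvar ^ (i + 1) dvd jet x y x' y' (relation_form N i)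
    - [:D ^ i * ((\<Sum>m\<le>i. (- 1) ^ m * of_nat (N choose m))
        + (if x \<noteq> 0 \<and> y \<noteq> 0 then (- 1) ^ i * (of_nat (i + 1) * of_nat (N choose i)) else 0)):] * tvar ^ i"
proof -
  define u where "u c = x + c * y" for c
  define w where "w c = x' + c * y'" for c
  define K where "K c = (\<Sum>k\<le>i. [:inverse c:] ^ k * (- [:x, x':]) ^ k * [:y, y':] ^ (i - k))" for c
  define S where "S c = (\<Sum>m\<le>i. of_nat (N choose m) * tvar ^ m * ([:u c:] ^ (i - m) * [:w c:] ^ m))" for c
  define C where "C c = (if u c = 0 then [:of_nat (N choose i) * w c ^ i:] * tvar ^ i else 0)" for c
  define b where "b = (\<Sum>m\<le>i. (- 1) ^ m * of_nat (N choose m) :: 'p mod_ring)"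
  have jet: "jet x y x' y' (relation_form N i) = - (\<Sum>c\<in>UNIV - {0}. [:u c, w c:] ^ N * K c)"
    by (simp add: relation_form_def kernel_form_def jet_simps u_def w_def K_def mult_ac)
  have main: "- (\<Sum>c\<in>UNIV - {0}. S c * K c) = [:D ^ i * b:] * tvar ^ i"
  proof -
    have "(\<Sum>c\<in>UNIV - {0}. S c * K c) = (\<Sum>c\<in>UNIV - {0}. \<Sum>m\<le>i. of_nat (N choose m) * tvar ^ m *
        ((([:x:] + [:c:] * [:y:]) ^ (i - m) * ([:x':] + [:c:] * [:y':]) ^ m) * K c))"
      by (intro sum.cong refl) (simp add: S_def sum_distrib_left sum_distrib_right u_def w_def mult_ac)
    also have "\<dots> = (\<Sum>m\<le>i. of_nat (N choose m) * tvar ^ m *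
        (\<Sum>c\<in>UNIV - {0}. (([:x:] + [:c:] * [:y:]) ^ (i - m) * ([:x':] + [:c:] * [:y':]) ^ m) * K c))"
      by (subst sum.swap) (simp only: sum_distrib_left)
    also have "\<dots> = (\<Sum>m\<le>i. of_nat (N choose m) * tvar ^ m *
        - (([:x:] * [:y, y':] - [:y:] * [:x, x':]) ^ (i - m) * ([:x':] * [:y, y':] - [:y':] * [:x, x':]) ^ m))"
      unfolding K_def
      by (intro sum.cong refl arg_cong2[of _ _ _ _ "(*)"] reproducing_kernel_product[OF const_hom i]) simp
    also have "\<dots> = (\<Sum>m\<le>i. - ([:D ^ i * ((- 1) ^ m * of_nat (N choose m)):] * tvar ^ i))"
    proof (intro sum.cong refl)
      fix m assume m: "m \<in> {..i}"
      have 1: "[:x:] * [:y, y':] - [:y:] * [:x, x':] = [:D:] * tvar"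
        by (simp add: D_def)
      have 2: "[:x':] * [:y, y':] - [:y':] * [:x, x':] = [:- 1 * D:]"
        by (simp add: D_def)
      have "of_nat (N choose m) * tvar ^ m * - (([:D:] * tvar) ^ (i - m) * [:- 1 * D:] ^ m)
        = - (([:D ^ (i - m) * D ^ m * ((- 1) ^ m * of_nat (N choose m)):]) * (tvar ^ m * tvar ^ (i - m)))"
        unfolding power_mult_distrib poly_const_pow of_nat_poly by (simp add: mult_ac)
      also have "\<dots> = - ([:D ^ i * ((- 1) ^ m * of_nat (N choose m)):] * tvar ^ i)"
        using m by (simp flip: power_add)
      finally show "of_nat (N choose m) * tvar ^ m *
        - (([:x:] * [:y, y':] - [:y:] * [:x, x':]) ^ (i - m) * ([:x':] * [:y, y':] - [:y':] * [:x, x':]) ^ m)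
        = - ([:D ^ i * ((- 1) ^ m * of_nat (N choose m)):] * tvar ^ i)"
        unfolding 1 2 .
    qed
    also have "\<dots> = - ([:D ^ i * b:] * tvar ^ i)"
    proof -
      have "[:D ^ i * b:] = (\<Sum>m\<le>i. [:D ^ i * ((- 1) ^ m * of_nat (N choose m)):])"
        by (simp add: b_def sum_distrib_left sum_to_poly)
      thus ?thesis by (simp only: sum_negf sum_distrib_right)
    qed
    finally show ?thesis by simp
  qed
  have corr: "tvar ^ (i + 1) dvd (\<Sum>c\<in>UNIV - {0}. C c * K c) -
      [:D ^ i * (if x \<noteq> 0 \<and> y \<noteq> 0 then (- 1) ^ i * (of_nat (i + 1) * of_nat (N choose i)) else 0):] * tvar ^ i"
  proof (cases "x \<noteq> 0 \<and> y \<noteq> 0")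
    case False
    hence "u c \<noteq> 0" if "c \<noteq> 0" for c using xy that by (auto simp: u_def)
    hence "(\<Sum>c\<in>UNIV - {0}. C c * K c) = 0" by (intro sum.neutral) (simp add: C_def)
    thus ?thesis unfolding if_not_P[OF False] by simp
  next
    case True
    \<comment> \<open>the only \<open>c\<close> for which \<open>X + c Y\<close> vanishes at \<open>(x, y)\<close>\<close>
    define c0 where "c0 = - x / y"
    have u: "u c = 0 \<longleftrightarrow> c = c0" for c
      using True by (auto simp: u_def c0_def field_simps add_eq_0_iff)
    have c0: "c0 \<noteq> 0" using True by (simp add: c0_def)
    have "(\<Sum>c\<in>UNIV - {0}. C c * K c) = (\<Sum>c\<in>UNIV - {0}. if c = c0 then C c0 * K c0 else 0)"
      by (intro sum.cong refl) (simp add: C_def u)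
    also have "\<dots> = [:of_nat (N choose i) * w c0 ^ i:] * tvar ^ i * K c0"
      using c0 u by (simp add: sum.delta C_def)
    finally have sumC: "(\<Sum>c\<in>UNIV - {0}. C c * K c) = tvar ^ i * ([:of_nat (N choose i) * w c0 ^ i:] * K c0)"
      by (simp only: mult_ac)
    have "poly (K c0) 0 = (\<Sum>k\<le>i. (y / x * x) ^ k * y ^ (i - k))"
      using True by (simp add: K_def poly_sum c0_def flip: power_mult_distrib)
    also have "\<dots> = of_nat (i + 1) * y ^ i"
      using True by (simp flip: power_add)
    finally have K0: "poly (K c0) 0 = of_nat (i + 1) * y ^ i" .
    have w0: "w c0 * y = - 1 * D" using True by (simp add: w_def c0_def D_def field_simps)
    have "poly ([:of_nat (N choose i) * w c0 ^ i:] * K c0) 0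
      = of_nat (N choose i) * of_nat (i + 1) * (w c0 * y) ^ i"
      by (simp only: poly_mult K0) (simp add: power_mult_distrib mult_ac)
    also have "\<dots> = D ^ i * ((- 1) ^ i * (of_nat (i + 1) * of_nat (N choose i)))"
      unfolding w0 by (simp only: power_mult_distrib mult_ac)
    finally have "tvar dvd [:of_nat (N choose i) * w c0 ^ i:] * K c0
      - [:D ^ i * ((- 1) ^ i * (of_nat (i + 1) * of_nat (N choose i))):]"
      by (simp only: tvar_dvd_iff poly_diff) simp
    hence "tvar ^ i * tvar dvd tvar ^ i * ([:of_nat (N choose i) * w c0 ^ i:] * K c0
      - [:D ^ i * ((- 1) ^ i * (of_nat (i + 1) * of_nat (N choose i))):])"
      by (rule mult_dvd_mono[OF dvd_refl])
    thus ?thesis using True unfolding sumC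
      by (simp only: power_add power_one_right right_diff_distrib mult_ac if_True simp_thms)
  qed
  have "tvar ^ (i + 1) dvd (\<Sum>c\<in>UNIV - {0}. ([:u c, w c:] ^ N - S c + C c) * K c)"
    unfolding S_def C_def by (intro dvd_sum dvd_mult2 tvar_power_expansion[OF N])
  hence "tvar ^ (i + 1) dvd ((\<Sum>c\<in>UNIV - {0}. C c * K c) -
      [:D ^ i * (if x \<noteq> 0 \<and> y \<noteq> 0 then (- 1) ^ i * (of_nat (i + 1) * of_nat (N choose i)) else 0):] * tvar ^ i)
    - (\<Sum>c\<in>UNIV - {0}. ([:u c, w c:] ^ N - S c + C c) * K c)"
    by (rule dvd_diff[OF corr])
  also have "\<dots> = jet x y x' y' (relation_form N i) - [:D ^ i * (b +
      (if x \<noteq> 0 \<and> y \<noteq> 0 then (- 1) ^ i * (of_nat (i + 1) * of_nat (N choose i)) else 0)):] * tvar ^ i"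
  proof -
    have "[:D ^ i * (b + e):] = [:D ^ i * b:] + [:D ^ i * e:]" for e by (simp add: distrib_left)
    moreover have "(\<Sum>c\<in>UNIV - {0}. ([:u c, w c:] ^ N - S c + C c) * K c)
      = (\<Sum>c\<in>UNIV - {0}. [:u c, w c:] ^ N * K c) - (\<Sum>c\<in>UNIV - {0}. S c * K c) + (\<Sum>c\<in>UNIV - {0}. C c * K c)"
      by (simp only: distrib_right left_diff_distrib sum.distrib sum_subtractf)
    moreover have "(A - E) - (J - B + A) = - J - (- B + E)" for A B E J :: "'p mod_ring poly" by simp
    ultimately show ?thesis unfolding jet by (simp only: distrib_right main[symmetric])
  qed
  finally show ?thesis unfolding b_def .
qed


section \<open>Submodules of the space of forms\<close>

context
  fixes r :: nat and U :: "'k::field poly poly set"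
  assumes U: "gsubmodule GL2 class_ring U (Vrep r)"
begin

lemma gsub_homogeneous: "F \<in> U \<Longrightarrow> homogeneous r F"
  and gsub_0: "0 \<in> U" and gsub_add: "F \<in> U \<Longrightarrow> G \<in> U \<Longrightarrow> F + G \<in> U"
  and gsub_const2: "F \<in> U \<Longrightarrow> const2 c * F \<in> U"
  using U by (auto simp: gsubmodule_def submodule_def)

lemma gsub_mat_act: "A \<in> carrier GL2 \<Longrightarrow> F \<in> U \<Longrightarrow> mat_act A F \<in> U"
  using U by (auto simp: gsubmodule_def)

lemma gsub_minus: "F \<in> U \<Longrightarrow> - F \<in> U"
  using gsub_const2[of F "- 1"] by (simp add: const2_simps)

lemma gsub_diff: "F \<in> U \<Longrightarrow> G \<in> U \<Longrightarrow> F - G \<in> U"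
  using gsub_add[OF _ gsub_minus, of F G] by simp

lemma gsub_sum: "(\<And>a. a \<in> A \<Longrightarrow> f a \<in> U) \<Longrightarrow> (\<Sum>a\<in>A. f a) \<in> U"
  by (induction A rule: infinite_finite_induct) (auto simp: gsub_0 gsub_add)

lemma gsub_const2_cancel: "const2 c * F \<in> U \<Longrightarrow> c \<noteq> 0 \<Longrightarrow> F \<in> U"
  using gsub_const2[of "const2 c * F" "inverse c"]
  by (simp flip: mult.assoc const2_simps) (simp add: const2_simps)

end

lemma gsubmodule_VrepI:
  assumes "\<And>F. F \<in> U \<Longrightarrow> homogeneous r F" "0 \<in> U" "\<And>F G. F \<in> U \<Longrightarrow> G \<in> U \<Longrightarrow> F + G \<in> U"
    "\<And>c F. F \<in> U \<Longrightarrow> const2 c * F \<in> U"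
    "\<And>A F. A \<in> carrier GL2 \<Longrightarrow> F \<in> U \<Longrightarrow> mat_act A F \<in> U"
  shows "gsubmodule GL2 class_ring (U :: 'k::field poly poly set) (Vrep r)"
  by (rule group_module.gsubmoduleI[OF group_module_Vrep]) (use assms in auto)

lemma Xsub_gsubmodule:
  assumes "l \<le> r"
  shows "gsubmodule GL2 class_ring (Xsub r l :: 'k::field poly poly set) (Vrep r)"
    and "varX ^ (r - l) * varY ^ l \<in> (Xsub r l :: 'k poly poly set)"
proof -
  let ?m = "varX ^ (r - l) * varY ^ l :: 'k poly poly"
  have m: "homogeneous r ?m"
    using homogeneous_monomial[of "r - l" l r 1] assms by (simp add: const2_1)
  show "?m \<in> Xsub r l" by (auto simp: Xsub_def generated_gsubmodule_def)
  have V: "gsubmodule GL2 class_ring {F :: 'k poly poly. homogeneous r F} (Vrep r)"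
    by (rule gsubmodule_VrepI)
       (auto simp: homogeneous_0 homogeneous_add homogeneous_const2_mult homogeneous_mat_act)
  show "gsubmodule GL2 class_ring (Xsub r l :: 'k poly poly set) (Vrep r)"
  proof (rule gsubmodule_VrepI)
    fix F :: "'k poly poly" assume "F \<in> Xsub r l"
    thus "homogeneous r F" using V m by (auto simp: Xsub_def generated_gsubmodule_def)
  qed (auto simp: Xsub_def generated_gsubmodule_def
        intro: gsub_0 gsub_add gsub_const2 gsub_mat_act)
qed

lemma Xsub_least:
  assumes "gsubmodule GL2 class_ring U (Vrep r)" "varX ^ (r - l) * varY ^ l \<in> U"
  shows "Xsub r l \<subseteq> U"
  using assms by (auto simp: Xsub_def generated_gsubmodule_def)

lemma Vfilt_iff: "F \<in> Vfilt r m \<longleftrightarrow> homogeneous r F \<and> theta ^ m dvd F"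
  by (simp add: Vfilt_def)

lemma Vfilt_gsubmodule:
  "gsubmodule GL2 class_ring (Vfilt r m :: 'p::prime_card mod_ring poly poly set) (Vrep r)"
proof (rule gsubmodule_VrepI)
  fix A :: "'p mod_ring mat" and F :: "'p mod_ring poly poly"
  assume A: "A \<in> carrier GL2" and F: "F \<in> Vfilt r m"
  then obtain H where H: "F = theta ^ m * H" unfolding Vfilt_iff dvd_def by blast
  have "mat_act A F = theta ^ m * (const2 (det A) ^ m * mat_act A H)"
    using A by (simp add: H mat_act_simps mat_act_theta GL2_simps power_mult_distrib mult_ac)
  hence "theta ^ m dvd mat_act A F" by simp
  thus "mat_act A F \<in> Vfilt r m" using homogeneous_mat_act[of r F A] F by (simp only: Vfilt_iff)
qed (auto simp: Vfilt_iff homogeneous_0 homogeneous_add homogeneous_const2_mult dvd_add)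

lemma gsub_sum_iff: "F \<in> U <+>\<^bsub>Vrep r\<^esub> V \<longleftrightarrow> (\<exists>a\<in>U. \<exists>b\<in>V. F = a + b)"
  by (auto simp: set_add_def')

lemma gsub_sum_gsubmodule:
  assumes "gsubmodule GL2 class_ring U (Vrep r)" "gsubmodule GL2 class_ring V (Vrep r)"
  shows "gsubmodule GL2 class_ring (U <+>\<^bsub>Vrep r\<^esub> V) (Vrep r :: ('k::field, _, _) gmodule)"
  by (rule group_module.gsubmodule_sum[OF group_module_Vrep assms])

lemma gsub_sum_left: "F \<in> U \<Longrightarrow> 0 \<in> V \<Longrightarrow> F \<in> U <+>\<^bsub>Vrep r\<^esub> V"
  unfolding gsub_sum_iff by (metis add.right_neutral)

lemma gsub_sum_right: "F \<in> V \<Longrightarrow> 0 \<in> U \<Longrightarrow> F \<in> U <+>\<^bsub>Vrep r\<^esub> V"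
  unfolding gsub_sum_iff by (metis add.left_neutral)

definition shear :: "'k::comm_ring_1 \<Rightarrow> 'k mat" where "shear c = mat2 1 0 c 1"

lemma shear_GL2: "shear c \<in> carrier (GL2 :: 'k::field mat monoid)"
  by (simp add: shear_def mat2_GL2)

lemma mat_act_shear: "mat_act (shear c) varX = varX + const2 c * varY" "mat_act (shear c) varY = varY"
  by (simp_all add: shear_def mat_act_simps const2_simps)

lemma mat_act_shear_inverse: "mat_act (shear c) (mat_act (shear (- c)) F) = (F :: 'k::field poly poly)"
  by (rule ring_hom_poly2_eqI[where F=F and g="\<lambda>x. x"])
     (simp_all add: comm_ring_hom_comp mat_act_hom id_ring_hom mat_act_simps const2_simps shear_def)

text \<open>Modulo the linear form \<open>X + c Y\<close> a form of degree \<open>i\<close> is a multiple of \<open>Y\<^sup>i\<close>, with its value at the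
  zero \<open>(-c, 1)\<close> of the linear form as the factor.  A shear reduces this to \<open>c = 0\<close>.\<close>

lemma form_mod_linear:
  fixes F :: "'k::field poly poly"
  assumes F: "homogeneous i F" and i: "1 \<le> i"
  shows "\<exists>G. homogeneous (i - 1) G \<and> F = const2 (val (- c) 1 F) * varY ^ i + (varX + const2 c * varY) * G"
proof -
  have *: "\<exists>G. homogeneous (i - 1) G \<and> F = const2 (val 0 1 F) * varY ^ i + varX * G"
    if F: "homogeneous i F" for F :: "'k poly poly"
  proof -
    define a where "a j = coeff (coeff F j) (i - j)" for j
    define G where "G = (\<Sum>j<i. const2 (a j) * varX ^ (i - 1 - j) * varY ^ j)"
    have "F = (\<Sum>j\<le>i. const2 (a j) * varX ^ (i - j) * varY ^ j)"
      unfolding a_def by (rule homogeneous_expansion[OF F])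
    also have "\<dots> = (\<Sum>j<i. const2 (a j) * varX ^ (i - j) * varY ^ j) + const2 (a i) * varY ^ i"
      by (simp add: lessThan_Suc_atMost[symmetric])
    also have "(\<Sum>j<i. const2 (a j) * varX ^ (i - j) * varY ^ j) = varX * G"
      unfolding G_def sum_distrib_left
    proof (intro sum.cong refl)
      fix j assume "j \<in> {..<i}"
      hence "i - j = Suc (i - 1 - j)" by auto
      thus "const2 (a j) * varX ^ (i - j) * varY ^ j = varX * (const2 (a j) * varX ^ (i - 1 - j) * varY ^ j)"
        by (simp only: power_Suc mult_ac)
    qed
    finally have e: "F = varX * G + const2 (a i) * varY ^ i" .
    have "val 0 1 F = a i" by (subst e) (simp add: val_simps)
    moreover have "homogeneous (i - 1) G"
      unfolding G_def by (intro homogeneous_sum homogeneous_monomial) auto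
    ultimately show ?thesis using e by (intro exI[of _ G]) (simp add: add.commute)
  qed
  obtain G where G: "homogeneous (i - 1) G"
    "mat_act (shear (- c)) F = const2 (val 0 1 (mat_act (shear (- c)) F)) * varY ^ i + varX * G"
    using *[OF homogeneous_mat_act[OF F]] by blast
  have v: "val 0 1 (mat_act (shear (- c)) F) = val (- c) 1 F"
    by (simp add: eval2_mat_act[OF id_ring_hom] shear_def)
  have "F = mat_act (shear c) (const2 (val (- c) 1 F) * varY ^ i + varX * G)"
    using G(2) mat_act_shear_inverse[of c F] unfolding v by simp
  also have "\<dots> = const2 (val (- c) 1 F) * varY ^ i + (varX + const2 c * varY) * mat_act (shear c) G"
    by (simp add: mat_act_simps shear_def const2_simps)
  finally show ?thesis using homogeneous_mat_act[OF G(1)] by blast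
qed

lemma of_nat_mod_ring_nonzero:
  "0 < n \<Longrightarrow> n < CARD('p) \<Longrightarrow> (of_nat n :: 'p::prime_card mod_ring) \<noteq> 0"
  using of_nat_0_mod_ring_dvd[of n, where 'a='p] nat_dvd_not_less by blast

lemma of_nat_choose_nonzero:
  assumes "n < CARD('p)" "k \<le> n"
  shows "(of_nat (n choose k) :: 'p::prime_card mod_ring) \<noteq> 0"
proof
  assume "of_nat (n choose k) = (0 :: 'p mod_ring)"
  hence "CARD('p) dvd n choose k" by (rule of_nat_0_mod_ring_dvd)
  hence "CARD('p) dvd fact n" using binomial_fact_lemma[OF assms(2)] by (metis dvd_mult)
  thus False using assms(1) prime_dvd_fact_iff[OF prime_card, of n, where 'a1='p] by simp
qed

lemma const2_of_nat: "const2 (of_nat n) = of_nat n"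
  by (induction n) (simp_all add: const2_simps)

text \<open>The matrices fixing \<open>X\<close> and sending \<open>Y\<close> to \<open>b X + Y\<close> produce \<open>X\<^bsup>r-l\<^esup> (b X + Y)\<^sup>l\<close> from the
  generator.  As \<open>l < p - 1\<close>, its expansion in \<open>b\<close> can be inverted, which gives \<open>X\<^bsup>r-l\<^esup>\<close> times every
  monomial of degree \<open>l\<close>.  A shear then moves \<open>X\<close> to \<open>X + c Y\<close>.\<close>

lemma linear_power_mult_in_Xsub:
  fixes G :: "'p::prime_card mod_ring poly poly"
  assumes l: "l < CARD('p) - 1" "l \<le> r" and G: "homogeneous l G"
  shows "(varX + const2 c * varY) ^ (r - l) * G \<in> Xsub r l"
proof -
  note X = Xsub_gsubmodule[OF l(2), where 'k="'p mod_ring"]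
  have mono: "varX ^ (r - l) * (varX ^ k * varY ^ (l - k)) \<in> (Xsub r l :: 'p mod_ring poly poly set)"
    if k: "k \<le> l" for k
  proof -
    define R :: "nat \<Rightarrow> 'p mod_ring poly poly"
      where "R j = of_nat (l choose j) * (varX ^ j * varY ^ (l - j))" for j
    have "varX ^ (r - l) * (\<Sum>j\<le>l. const2 b ^ j * R j) \<in> (Xsub r l :: 'p mod_ring poly poly set)" for b
    proof -
      have "mat2 1 b 0 1 \<in> carrier GL2" by (simp add: mat2_GL2)
      hence "mat_act (mat2 1 b 0 1) (varX ^ (r - l) * varY ^ l) \<in> Xsub r l"
        by (rule gsub_mat_act[OF X(1) _ X(2)])
      also have "mat_act (mat2 1 b 0 1) (varX ^ (r - l) * varY ^ l)
        = varX ^ (r - l) * (const2 b * varX + varY) ^ l"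
        by (simp add: mat_act_simps const2_simps)
      also have "(const2 b * varX + varY) ^ l = (\<Sum>j\<le>l. const2 b ^ j * R j)"
        unfolding binomial_ring by (simp add: R_def power_mult_distrib mult_ac)
      finally show ?thesis .
    qed
    hence "(\<Sum>b\<in>UNIV - {0}. const2 (inverse b ^ k) * (varX ^ (r - l) * (\<Sum>j\<le>l. const2 b ^ j * R j))) \<in> Xsub r l"
      by (intro gsub_sum[OF X(1)] gsub_const2[OF X(1)])
    also have "(\<Sum>b\<in>UNIV - {0}. const2 (inverse b ^ k) * (varX ^ (r - l) * (\<Sum>j\<le>l. const2 b ^ j * R j)))
      = varX ^ (r - l) * (\<Sum>b\<in>UNIV - {0}. const2 (inverse b) ^ k * (\<Sum>j\<le>l. const2 b ^ j * R j))"
      by (simp only: sum_distrib_left const2_simps mult_ac)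
    also have "\<dots> = - (const2 (of_nat (l choose k)) * (varX ^ (r - l) * (varX ^ k * varY ^ (l - k))))"
      unfolding coefficient_extraction[OF const2_hom l(1) k] R_def by (simp add: mult_ac const2_of_nat)
    finally have "- (const2 (of_nat (l choose k)) * (varX ^ (r - l) * (varX ^ k * varY ^ (l - k))))
      \<in> (Xsub r l :: 'p mod_ring poly poly set)" .
    from gsub_minus[OF X(1) this]
    have "const2 (of_nat (l choose k)) * (varX ^ (r - l) * (varX ^ k * varY ^ (l - k)))
      \<in> (Xsub r l :: 'p mod_ring poly poly set)"
      by (simp only: minus_minus)
    from gsub_const2_cancel[OF X(1) this] show ?thesis
      using of_nat_choose_nonzero[of l k, where 'p='p] k l(1) by simp
  qed
  have base: "varX ^ (r - l) * G \<in> Xsub r l" if G: "homogeneous l G" for G :: "'p mod_ring poly poly"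
  proof -
    define a where "a j = coeff (coeff G j) (l - j)" for j
    have "G = (\<Sum>j\<le>l. const2 (a j) * (varX ^ (l - j) * varY ^ (l - (l - j))))"
      using homogeneous_expansion[OF G] by (simp add: a_def mult.assoc)
    hence "varX ^ (r - l) * G = varX ^ (r - l) * (\<Sum>j\<le>l. const2 (a j) * (varX ^ (l - j) * varY ^ (l - (l - j))))"
      by (rule arg_cong)
    also have "\<dots> = (\<Sum>j\<le>l. const2 (a j) * (varX ^ (r - l) * (varX ^ (l - j) * varY ^ (l - (l - j)))))"
      unfolding sum_distrib_left by (intro sum.cong refl) (simp only: mult_ac)
    also have "\<dots> \<in> Xsub r l"
      by (intro gsub_sum[OF X(1)] gsub_const2[OF X(1)] mono) auto
    finally show ?thesis .
  qed
  have "mat_act (shear c) (varX ^ (r - l) * mat_act (shear (- c)) G) \<in> Xsub r l"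
    by (intro gsub_mat_act[OF X(1) shear_GL2] base homogeneous_mat_act G)
  also have "mat_act (shear c) (varX ^ (r - l) * mat_act (shear (- c)) G) = (varX + const2 c * varY) ^ (r - l) * G"
    by (simp only: mat_act.hom_mult mat_act.hom_power mat_act_shear mat_act_shear_inverse)
  finally show ?thesis .
qed


section \<open>The generator modulo the filtration\<close>

lemma homogeneous_kernel_form: "homogeneous i (kernel_form i c)"
proof -
  have "kernel_form i c = (\<Sum>k\<le>i. const2 ((- inverse c) ^ k) * varX ^ k * varY ^ (i - k))"
    unfolding kernel_form_def by (intro sum.cong refl) (simp add: const2_simps power_minus[of varX] power_minus[of "const2 _"])
  thus ?thesis by (auto intro!: homogeneous_sum homogeneous_monomial)
qed

lemma relation_form_in_Xsub:
  assumes "i < CARD('p) - 1" "i \<le> r"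
  shows "relation_form (r - i) i \<in> (Xsub r i :: 'p::prime_card mod_ring poly poly set)"
  unfolding relation_form_def
  using assms Xsub_gsubmodule(1)[OF assms(2), where 'k="'p mod_ring"]
  by (intro gsub_minus gsub_sum linear_power_mult_in_Xsub homogeneous_kernel_form)

lemma complementary_vector:
  assumes "(x, y) \<noteq> (0, 0 :: 'k::field)"
  shows "\<exists>x' y'. x * y' - y * x' \<noteq> 0"
proof (cases "x = 0")
  case True
  thus ?thesis using assms by (intro exI[of _ 1] exI[of _ 0]) simp
next
  case False
  thus ?thesis by (intro exI[of _ 0] exI[of _ 1]) simp
qed

lemma relation_form_factorization:
  fixes r i :: nat
  assumes r: "i < r - i" "[r - i = i] (mod (CARD('p) - 1))" and i: "i < CARD('p) - 1"
  shows "theta ^ i dvd (relation_form (r - i) i :: 'p::prime_card mod_ring poly poly)"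
    and "relation_form (r - i) i = theta ^ i * H \<Longrightarrow> (x, y) \<noteq> (0, 0) \<Longrightarrow>
      val x y H = (\<Sum>m\<le>i. (- 1) ^ m * of_nat (r - i choose m))
        + (if x \<noteq> 0 \<and> y \<noteq> (0 :: 'p mod_ring) then (- 1) ^ i * (of_nat (i + 1) * of_nat (r - i choose i)) else 0)"
proof -
  let ?E = "relation_form (r - i) i :: 'p mod_ring poly poly"
  have ir: "i \<le> r" using r by simp
  have "homogeneous r ?E"
    using gsub_homogeneous[OF Xsub_gsubmodule(1)[OF ir] relation_form_in_Xsub[OF i ir]] .
  thus "theta ^ i dvd ?E"
  proof (rule theta_power_dvdI)
    fix x y :: "'p mod_ring" assume xy: "(x, y) \<noteq> (0, 0)"
    obtain x' y' where D: "x * y' - y * x' \<noteq> 0" using complementary_vector[OF xy] by blast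
    let ?c = "(x * y' - y * x') ^ i * ((\<Sum>m\<le>i. (- 1) ^ m * of_nat (r - i choose m))
        + (if x \<noteq> 0 \<and> y \<noteq> 0 then (- 1) ^ i * (of_nat (i + 1) * of_nat (r - i choose i)) else 0))"
    have "tvar ^ i dvd jet x y x' y' ?E - [:?c:] * tvar ^ i"
      by (rule dvd_trans[OF le_imp_power_dvd jet_relation_form[OF r i xy]]) simp
    hence "tvar ^ i dvd (jet x y x' y' ?E - [:?c:] * tvar ^ i) + [:?c:] * tvar ^ i"
      by (intro dvd_add dvd_triv_right)
    hence "tvar ^ i dvd jet x y x' y' ?E" by (simp only: diff_add_cancel)
    with D show "\<exists>x' y'. x * y' - y * x' \<noteq> 0 \<and> tvar ^ i dvd jet x y x' y' ?E" by blast
  qed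
  assume H: "?E = theta ^ i * H" and xy: "(x, y) \<noteq> (0, 0)"
  obtain x' y' where D: "x * y' - y * x' \<noteq> 0" using complementary_vector[OF xy] by blast
  let ?e = "(\<Sum>m\<le>i. (- 1) ^ m * of_nat (r - i choose m))
        + (if x \<noteq> 0 \<and> y \<noteq> (0 :: 'p mod_ring) then (- 1) ^ i * (of_nat (i + 1) * of_nat (r - i choose i)) else 0)"
  have "(x * y' - y * x') ^ i * val x y H = (x * y' - y * x') ^ i * ?e"
    by (rule val_from_jet[OF D]) (rule jet_relation_form[OF r i xy, where x'=x' and y'=y', unfolded H])
  thus "val x y H = ?e" using D by simp
qed

text \<open>Put \<open>e c = (X + c Y)\<^sup>N Y\<^sup>i\<close> and let \<open>U\<close> be the sum on the right-hand side.  Modulo \<open>X\<^bsub>r-i+1\<^esub>\<close> only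
  the value of the kernel at the zero of \<open>X + c Y\<close> counts, so the relation form becomes
  \<open>-(i + 1) (\<Sum>c\<noteq>0. e c)\<close>.  With \<open>Z = (\<Sum>c. e c)\<close> this shows \<open>Z - e 0 \<in> U\<close>, and shears give
  \<open>Z - e b \<in> U\<close> for all \<open>b\<close>.  The sum of these \<open>p\<close> elements is \<open>-Z\<close>, so \<open>Z\<close> and \<open>e 0\<close> are in \<open>U\<close>.\<close>

lemma generator_in_lower_sum:
  fixes r i :: nat
  assumes r: "i < r - i" "[r - i = i] (mod (CARD('p) - 1))" and i: "1 \<le> i" "i < CARD('p) - 1"
  shows "varX ^ (r - i) * varY ^ i \<in>
    Xsub r (i - 1) <+>\<^bsub>Vrep r\<^esub> (Vfilt r i :: 'p::prime_card mod_ring poly poly set)"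
proof -
  define N where "N = r - i"
  define X where "X = (Xsub r (i - 1) :: 'p mod_ring poly poly set)"
  define U where "U = X <+>\<^bsub>Vrep r\<^esub> (Vfilt r i :: 'p mod_ring poly poly set)"
  have ir: "i \<le> r" "i - 1 \<le> r" using r by auto
  have N1: "r - (i - 1) = Suc N" using i ir by (simp add: N_def)
  note Xg = Xsub_gsubmodule(1)[OF ir(2), where 'k="'p mod_ring", folded X_def]
  have Ug: "gsubmodule GL2 class_ring U (Vrep r)"
    unfolding U_def by (intro gsub_sum_gsubmodule Xg Vfilt_gsubmodule)
  have XU: "F \<in> U" if "F \<in> X" for F
    unfolding U_def by (rule gsub_sum_left[OF that gsub_0[OF Vfilt_gsubmodule]])
  have "(relation_form N i :: 'p mod_ring poly poly) \<in> Xsub r i"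
    unfolding N_def by (rule relation_form_in_Xsub[OF i(2) ir(1)])
  hence "(relation_form N i :: 'p mod_ring poly poly) \<in> Vfilt r i"
    using gsub_homogeneous[OF Xsub_gsubmodule(1)[OF ir(1)]] relation_form_factorization(1)[OF r i(2)]
    unfolding Vfilt_iff N_def by blast
  hence relU: "relation_form N i \<in> U"
    unfolding U_def by (rule gsub_sum_right[OF _ gsub_0[OF Xg]])
  define e :: "'p mod_ring \<Rightarrow> 'p mod_ring poly poly" where
    "e c = (varX + const2 c * varY) ^ N * varY ^ i" for c
  have reduce: "(varX + const2 c * varY) ^ N * kernel_form i c - const2 (of_nat (i + 1)) * e c \<in> U"
    if c: "c \<noteq> 0" for c
  proof -
    obtain G where G: "homogeneous (i - 1) G"
      "kernel_form i c = const2 (val (- c) 1 (kernel_form i c)) * varY ^ i + (varX + const2 c * varY) * G"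
      using form_mod_linear[OF homogeneous_kernel_form i(1)] by blast
    have "val (- c) 1 (kernel_form i c) = (\<Sum>k\<le>i. (inverse c * c) ^ k)"
      by (simp only: kernel_form_def val_simps power_mult_distrib minus_minus power_one mult_1_right)
    also have "\<dots> = of_nat (i + 1)" using c by simp
    finally have "(varX + const2 c * varY) ^ N * kernel_form i c - const2 (of_nat (i + 1)) * e c
      = (varX + const2 c * varY) ^ (r - (i - 1)) * G"
      unfolding N1 by (subst G(2)) (simp add: e_def algebra_simps)
    also have "\<dots> \<in> X"
      unfolding X_def using i ir by (intro linear_power_mult_in_Xsub G) auto
    finally show ?thesis by (rule XU)
  qed
  define Z where "Z = (\<Sum>c\<in>UNIV. e c)"
  have "(\<Sum>c\<in>UNIV - {0}. (varX + const2 c * varY) ^ N * kernel_form i c - const2 (of_nat (i + 1)) * e c) \<in> U"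
    by (rule gsub_sum[OF Ug]) (use reduce in auto)
  hence "- relation_form N i - (\<Sum>c\<in>UNIV - {0}. const2 (of_nat (i + 1)) * e c) \<in> U"
    by (simp add: relation_form_def sum_subtractf)
  from gsub_diff[OF Ug gsub_minus[OF Ug relU] this]
  have "const2 (of_nat (i + 1)) * (\<Sum>c\<in>UNIV - {0}. e c) \<in> U" by (simp add: sum_distrib_left)
  from gsub_const2_cancel[OF Ug this] have "(\<Sum>c\<in>UNIV - {0}. e c) \<in> U"
    using of_nat_mod_ring_nonzero[of "i + 1", where 'p='p] i by simp
  moreover have "(\<Sum>c\<in>UNIV - {0}. e c) = Z - e 0" by (simp add: Z_def sum_diff1)
  ultimately have Z0: "Z - e 0 \<in> U" by simp
  have shear_e: "mat_act (shear b) (e c) = e (b + c)" for b c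
    unfolding e_def by (simp only: mat_act.hom_mult mat_act.hom_power mat_act.hom_add mat_act_shear mat_act_gens(1))
      (simp add: const2_simps algebra_simps)
  have Zb: "Z - e b \<in> U" for b
  proof -
    have "mat_act (shear b) (Z - e 0) = (\<Sum>c\<in>UNIV. e (b + c)) - e b"
      unfolding Z_def mat_act.hom_minus mat_act.hom_sum shear_e by simp
    also have "(\<Sum>c\<in>UNIV. e (b + c)) = Z"
      unfolding Z_def by (rule sum.reindex_bij_witness[of _ "\<lambda>c. c - b" "\<lambda>c. b + c"]) auto
    finally show ?thesis using gsub_mat_act[OF Ug shear_GL2 Z0, of b] by simp
  qed
  hence "(\<Sum>b\<in>UNIV. Z - e b) \<in> U" by (intro gsub_sum[OF Ug])
  also have "(\<Sum>b\<in>UNIV. Z - e b) = of_nat CARD('p) * Z - Z" by (simp add: sum_subtractf Z_def[symmetric])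
  also have "of_nat CARD('p) = (0 :: 'p mod_ring poly poly)"
    using of_nat_CHAR[where 'a="'p mod_ring poly poly"] by simp
  finally have "- Z \<in> U" by simp
  from gsub_diff[OF Ug gsub_minus[OF Ug this] Zb[of 0]] have "e 0 \<in> U" by simp
  thus ?thesis by (simp add: e_def U_def X_def N_def const2_simps)
qed

lemma Xsub_mono:
  assumes "1 \<le> i" "i < CARD('p) - 1" "i \<le> r"
  shows "Xsub r (i - 1) \<subseteq> (Xsub r i :: 'p::prime_card mod_ring poly poly set)"
proof (rule Xsub_least)
  show "gsubmodule GL2 class_ring (Xsub r i :: 'p mod_ring poly poly set) (Vrep r)"
    by (rule Xsub_gsubmodule) fact
  have "homogeneous i (varX * varY ^ (i - 1) :: 'p mod_ring poly poly)"
    using homogeneous_monomial[of 1 "i - 1" i 1] assms by (simp add: const2_1)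
  from linear_power_mult_in_Xsub[OF assms(2,3) this, of 0]
  have "varX ^ (r - i) * (varX * varY ^ (i - 1)) \<in> (Xsub r i :: 'p mod_ring poly poly set)"
    by (simp add: const2_simps)
  moreover have "r - (i - 1) = Suc (r - i)" using assms by simp
  ultimately show "varX ^ (r - (i - 1)) * varY ^ (i - 1) \<in> (Xsub r i :: 'p mod_ring poly poly set)"
    by (simp add: mult_ac)
qed

section \<open>Periodicity in the exponent\<close>

lemma jet_mat_act:
  "jet x y x' y' (mat_act A F) = jet (x * A $$ (0,0) + y * A $$ (1,0)) (x * A $$ (0,1) + y * A $$ (1,1))
    (x' * A $$ (0,0) + y' * A $$ (1,0)) (x' * A $$ (0,1) + y' * A $$ (1,1)) F"
  unfolding jet_def eval2_mat_act[OF const_hom] by (simp add: mult.commute)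

lemma GL2_row_nonzero:
  assumes A: "A \<in> carrier (GL2 :: 'k::field mat monoid)" and xy: "(x, y) \<noteq> (0, 0)"
  shows "(x * A $$ (0,0) + y * A $$ (1,0), x * A $$ (0,1) + y * A $$ (1,1)) \<noteq> (0, 0)"
proof
  assume *: "(x * A $$ (0,0) + y * A $$ (1,0), x * A $$ (0,1) + y * A $$ (1,1)) = (0, 0)"
  have det: "det A = A $$ (0,0) * A $$ (1,1) - A $$ (0,1) * A $$ (1,0)" "det A \<noteq> 0"
    using A by (auto simp: GL2_simps det_2x2)
  have "x * det A = (x * A $$ (0,0) + y * A $$ (1,0)) * A $$ (1,1) - (x * A $$ (0,1) + y * A $$ (1,1)) * A $$ (1,0)"
    "y * det A = (x * A $$ (0,1) + y * A $$ (1,1)) * A $$ (0,0) - (x * A $$ (0,0) + y * A $$ (1,0)) * A $$ (0,1)"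
    unfolding det(1) by (simp_all add: algebra_simps)
  thus False using * xy det(2) by simp
qed

text \<open>If \<open>u = 0\<close>, both powers vanish to order \<open>m\<close>.  Otherwise \<open>(u + w t)\<^sup>p\<close> agrees with \<open>u\<close> to order \<open>p\<close>,
  and \<open>u\<^bsup>p-1\<^esup> = 1\<close>.\<close>

lemma linear_power_periodic:
  fixes u w :: "'p::prime_card mod_ring"
  assumes "m \<le> N" "m \<le> N'" "m \<le> CARD('p)" "[N = N'] (mod (CARD('p) * (CARD('p) - 1)))"
  shows "tvar ^ m dvd [:u, w:] ^ N - [:u, w:] ^ N'"
proof -
  have *: "tvar ^ m dvd [:u, w:] ^ (M + CARD('p) * (CARD('p) - 1) * k) - [:u, w:] ^ M" if M: "m \<le> M" for M k
  proof (cases "u = 0")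
    case True
    have "tvar ^ m dvd [:u, w:] ^ n" if "m \<le> n" for n
    proof -
      have "[:u, w:] = tvar * [:w:]" using True by simp
      thus ?thesis using that by (simp only: power_mult_distrib) (intro dvd_mult2 le_imp_power_dvd)
    qed
    thus ?thesis using M by (intro dvd_diff) auto
  next
    case False
    have "[:u, w:] = [:u:] + [:w:] * tvar" by simp
    hence "[:u, w:] ^ CARD('p) = [:u:] ^ CARD('p) + ([:w:] * tvar) ^ CARD('p)"
      by (simp only:) (rule freshmans_dream, simp_all add: prime_card)
    hence "tvar ^ CARD('p) dvd [:u, w:] ^ CARD('p) - [:u:]"
      by (simp only: power_mult_distrib poly_const_pow mod_ring_power_card) (simp add: dvd_smult)
    hence d1: "tvar ^ m dvd [:u, w:] ^ CARD('p) - [:u:]"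
      using le_imp_power_dvd[OF assms(3)] dvd_trans by blast
    let ?a = "[:u, w:] ^ CARD('p)" and ?n = "(CARD('p) - 1) * k"
    have "[:u, w:] ^ CARD('p) - [:u:] dvd ?a ^ ?n - [:u:] ^ ?n"
      unfolding power_diff_sumr2[of ?a ?n "[:u:]"] by (rule dvd_triv_left)
    from dvd_trans[OF d1 this] have "tvar ^ m dvd ?a ^ ?n - [:u:] ^ ?n" .
    moreover have "[:u:] ^ ?n = 1"
      by (simp only: poly_const_pow power_mult unit_power_card_minus_1[OF False]) (simp add: one_pCons)
    ultimately have "tvar ^ m dvd ?a ^ ?n - 1" by (simp only:)
    hence "tvar ^ m dvd [:u, w:] ^ M * (?a ^ ?n - 1)" by (rule dvd_mult)
    thus ?thesis by (simp only: power_add power_mult right_diff_distrib mult_1_right mult.assoc)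
  qed
  show ?thesis
  proof (cases "N \<le> N'")
    case True
    then obtain k where "N' = k * (CARD('p) * (CARD('p) - 1)) + N"
      using assms(4) cong_le_nat[OF True] cong_sym by blast
    hence "N' = N + CARD('p) * (CARD('p) - 1) * k" by (simp only: mult.commute add.commute)
    thus ?thesis using *[OF assms(1), of k] by (subst dvd_diff_commute) (simp only:)
  next
    case False
    hence "N' \<le> N" by simp
    from assms(4) cong_le_nat[OF this] obtain k where "N = k * (CARD('p) * (CARD('p) - 1)) + N'" by blast
    hence "N = N' + CARD('p) * (CARD('p) - 1) * k" by (simp only: mult.commute add.commute)
    thus ?thesis using *[OF assms(2), of k] by (simp only:)
  qed
qed

text \<open>The forms that have such a companion \<open>F'\<close> are a submodule, since the matrices act on points and
  directions; it contains the generator \<open>X\<^bsup>r-i\<^esup> Y\<^sup>i\<close>, with companion \<open>X\<^bsup>N'\<^esup> Y\<^sup>i\<close>.\<close>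

lemma Xsub_companion:
  fixes F :: "'p::prime_card mod_ring poly poly"
  assumes F: "F \<in> Xsub r i" and i: "i \<le> r" "i < CARD('p)"
    and N': "i < r - i" "i < N'" "[r - i = N'] (mod (CARD('p) * (CARD('p) - 1)))"
  shows "\<exists>F'. homogeneous (N' + i) F' \<and>
    (\<forall>x y x' y'. tvar ^ (i + 1) dvd jet x y x' y' F - jet x y x' y' F')"
proof -
  define U where "U = {F :: 'p mod_ring poly poly. homogeneous r F \<and> (\<exists>F'. homogeneous (N' + i) F' \<and>
    (\<forall>x y x' y'. tvar ^ (i + 1) dvd jet x y x' y' F - jet x y x' y' F'))}"
  have "gsubmodule GL2 class_ring U (Vrep r)"
  proof (rule gsubmodule_VrepI)
    show "0 \<in> U" by (auto simp: U_def homogeneous_0 intro!: exI[of _ 0])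
  next
    fix F G assume "F \<in> U" "G \<in> U"
    then obtain F' G' where *: "homogeneous r F" "homogeneous r G" "homogeneous (N' + i) F'" "homogeneous (N' + i) G'"
      "\<And>x y x' y'. tvar ^ (i + 1) dvd jet x y x' y' F - jet x y x' y' F'"
      "\<And>x y x' y'. tvar ^ (i + 1) dvd jet x y x' y' G - jet x y x' y' G'" unfolding U_def by blast
    have "tvar ^ (i + 1) dvd jet x y x' y' (F + G) - jet x y x' y' (F' + G')" for x y x' y'
      using dvd_add[OF *(5,6), of x y x' y' x y x' y'] by (simp only: jet.hom_add add_diff_add)
    thus "F + G \<in> U" using * homogeneous_add unfolding U_def by blast
  next
    fix c F assume "F \<in> U"
    then obtain F' where *: "homogeneous r F" "homogeneous (N' + i) F'"
      "\<And>x y x' y'. tvar ^ (i + 1) dvd jet x y x' y' F - jet x y x' y' F'" unfolding U_def by blast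
    have "tvar ^ (i + 1) dvd jet x y x' y' (const2 c * F) - jet x y x' y' (const2 c * F')" for x y x' y'
      using dvd_mult[OF *(3), of "[:c:]" x y x' y'] by (simp only: jet.hom_mult jet_gens right_diff_distrib)
    thus "const2 c * F \<in> U" using * homogeneous_const2_mult unfolding U_def by blast
  next
    fix A :: "'p mod_ring mat" and F assume "F \<in> U"
    then obtain F' where *: "homogeneous r F" "homogeneous (N' + i) F'"
      "\<And>x y x' y'. tvar ^ (i + 1) dvd jet x y x' y' F - jet x y x' y' F'" unfolding U_def by blast
    have "tvar ^ (i + 1) dvd jet x y x' y' (mat_act A F) - jet x y x' y' (mat_act A F')" for x y x' y'
      unfolding jet_mat_act by (rule *(3))
    thus "mat_act A F \<in> U" using * homogeneous_mat_act unfolding U_def by blast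
  qed (simp add: U_def)
  moreover have "varX ^ (r - i) * varY ^ i \<in> U"
  proof -
    have hom: "homogeneous (n + i) (varX ^ n * varY ^ i :: 'p mod_ring poly poly)" for n
      using homogeneous_monomial[of n i "n + i" 1] by (simp add: const2_1)
    have "tvar ^ (i + 1) dvd jet x y x' y' (varX ^ (r - i) * varY ^ i) - jet x y x' y' (varX ^ N' * varY ^ i)"
      for x y x' y' :: "'p mod_ring"
    proof -
      have "tvar ^ (i + 1) dvd ([:x, x':] ^ (r - i) - [:x, x':] ^ N') * [:y, y':] ^ i"
        using i N' by (intro dvd_mult2 linear_power_periodic) auto
      thus ?thesis by (simp only: jet_simps left_diff_distrib)
    qed
    moreover have "homogeneous r (varX ^ (r - i) * varY ^ i :: 'p mod_ring poly poly)"
      using hom[of "r - i"] i by simp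
    ultimately show ?thesis using hom[of N'] unfolding U_def by blast
  qed
  ultimately have "Xsub r i \<subseteq> U" by (rule Xsub_least)
  thus ?thesis using F unfolding U_def by blast
qed

text \<open>The companion is divisible by \<open>\<theta>\<^sup>i\<close> as well, and the quotients have the same values.  The gain
  is that \<open>N'\<close> may be chosen small.\<close>

lemma Xsub_values:
  fixes H :: "'p::prime_card mod_ring poly poly"
  assumes F: "theta ^ i * H \<in> Xsub r i" and i: "i \<le> r" "i < CARD('p)"
    and N': "i < r - i" "i < N'" "[r - i = N'] (mod (CARD('p) * (CARD('p) - 1)))"
  shows "\<exists>H'. (if i * (CARD('p) + 1) \<le> N' + i then homogeneous (N' + i - i * (CARD('p) + 1)) H' else H' = 0)
    \<and> (\<forall>x y. (x, y) \<noteq> (0, 0) \<longrightarrow> val x y H = val x y H')"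
proof -
  obtain F' where F': "homogeneous (N' + i) F'"
    "\<And>x y x' y'. tvar ^ (i + 1) dvd jet x y x' y' (theta ^ i * H) - jet x y x' y' F'"
    using Xsub_companion[OF assms] by blast
  have "theta ^ i dvd F'"
  proof (rule theta_power_dvdI[OF F'(1)])
    fix x y :: "'p mod_ring" assume xy: "(x, y) \<noteq> (0, 0)"
    obtain x' y' where D: "x * y' - y * x' \<noteq> 0" using complementary_vector[OF xy] by blast
    have "tvar ^ i dvd jet x y x' y' (theta ^ i * H) - jet x y x' y' F'"
      by (rule dvd_trans[OF le_imp_power_dvd F'(2)]) simp
    from dvd_diff[OF dvd_jet_theta_power[of i x y x' y' H] this] have "tvar ^ i dvd jet x y x' y' F'" by simp
    with D show "\<exists>x' y'. x * y' - y * x' \<noteq> 0 \<and> tvar ^ i dvd jet x y x' y' F'" by blast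
  qed
  from theta_power_dvd_form[OF F'(1) this] obtain H' where H': "F' = theta ^ i * H'"
    "if i * (CARD('p) + 1) \<le> N' + i then homogeneous (N' + i - i * (CARD('p) + 1)) H' else H' = 0" by blast
  have "val x y H = val x y H'" if xy: "(x, y) \<noteq> (0, 0)" for x y
  proof -
    obtain x' y' where D: "x * y' - y * x' \<noteq> 0" using complementary_vector[OF xy] by blast
    have "tvar ^ (i + 1) dvd (jet x y x' y' (theta ^ i * H) - jet x y x' y' F')
      + (jet x y x' y' (theta ^ i * H') - [:(x * y' - y * x') ^ i * val x y H':] * tvar ^ i)"
      by (intro dvd_add F' jet_theta_power_mult)
    hence "tvar ^ (i + 1) dvd jet x y x' y' (theta ^ i * H) - [:(x * y' - y * x') ^ i * val x y H':] * tvar ^ i"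
      by (simp only: H'(1)) (simp only: add_diff_eq diff_add_cancel)
    from val_from_jet[OF D this] show ?thesis using D by simp
  qed
  thus ?thesis using H'(2) by blast
qed


section \<open>Functions on the rational projective line\<close>

lemma val_scale:
  assumes "homogeneous s F"
  shows "val (t * x) (t * y) F = t ^ s * val x y F"
proof -
  define a where "a j = coeff (coeff F j) (s - j)" for j
  have F: "F = (\<Sum>j\<le>s. const2 (a j) * varX ^ (s - j) * varY ^ j)"
    unfolding a_def by (rule homogeneous_expansion[OF assms])
  have "t ^ s = t ^ (s - j) * t ^ j" if "j \<le> s" for j using that by (simp flip: power_add)
  thus ?thesis
    by (subst (1 2) F) (auto simp: val_simps sum_distrib_left power_mult_distrib mult_ac intro!: sum.cong)
qed

lemma val_0_0: "homogeneous s F \<Longrightarrow> 0 < s \<Longrightarrow> val 0 0 F = 0"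
  using val_scale[of s F 0 0 0] by (simp add: power_0_left)

context
  fixes s :: nat
  assumes s: "CARD('p::prime_card) - 1 dvd s"
begin

lemma unit_power_degree: "t \<noteq> 0 \<Longrightarrow> (t :: 'p mod_ring) ^ s = 1"
  using s by (auto simp: power_mult unit_power_card_minus_1 simp del: One_nat_def elim!: dvdE)

lemma val_affine:
  assumes "homogeneous s F" "x \<noteq> 0"
  shows "val x y F = val 1 (y / x :: 'p mod_ring) F"
  using val_scale[OF assms(1), of x 1 "y / x"] assms(2) by (simp add: unit_power_degree)

lemma val_infinity:
  assumes "homogeneous s F" "y \<noteq> 0"
  shows "val 0 y F = val 0 (1 :: 'p mod_ring) F"
  using val_scale[OF assms(1), of y 0 1] assms(2) by (simp add: unit_power_degree)

end

text \<open>For a form of positive degree divisible by \<open>p - 1\<close> this is minus the sum over the projective line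
  (\<open>total_eq\<close>).  Summing over the plane makes the invariance under matrices evident.\<close>

definition total :: "'p::prime_card mod_ring poly poly \<Rightarrow> 'p mod_ring" where
  "total F = (\<Sum>P\<in>UNIV. val (fst P) (snd P) F)"

text \<open>Here \<open>x Y - y X\<close> is the linear form that vanishes at \<open>(x, y)\<close>.  Its power \<open>p - 1\<close> depends on the
  point of the projective line only, and takes the value \<open>1\<close> at the other points.\<close>

definition dual_form :: "'p::prime_card mod_ring poly poly \<Rightarrow> 'p mod_ring poly poly" where
  "dual_form F = (\<Sum>P\<in>UNIV. const2 (val (fst P) (snd P) F) *
    (const2 (fst P) * varY - const2 (snd P) * varX) ^ (CARD('p) - 1))"

lemma total_add: "total (F + G) = total F + total G"
  and total_const2: "total (const2 c * F) = c * total F"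
  by (simp_all add: total_def val_simps sum.distrib sum_distrib_left)

lemma dual_form_add: "dual_form (F + G) = dual_form F + dual_form G"
  and dual_form_const2: "dual_form (const2 c * F) = const2 c * dual_form F"
  by (simp_all add: dual_form_def val_simps const2_simps sum.distrib sum_distrib_left distrib_right mult.assoc)

definition row_act :: "'k::comm_ring_1 mat \<Rightarrow> 'k \<times> 'k \<Rightarrow> 'k \<times> 'k" where
  "row_act A P = (fst P * A $$ (0,0) + snd P * A $$ (1,0), fst P * A $$ (0,1) + snd P * A $$ (1,1))"

lemma val_mat_act: "val (fst P) (snd P) (mat_act A F) = val (fst (row_act A P)) (snd (row_act A P)) F"
  by (simp add: eval2_mat_act[OF id_ring_hom] row_act_def mult.commute)

lemma bij_row_act:
  assumes "A \<in> carrier (GL2 :: 'p::prime_card mod_ring mat monoid)"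
  shows "bij (row_act A)"
proof -
  have "P = Q" if eq: "row_act A P = row_act A Q" for P Q
  proof (rule ccontr)
    assume "P \<noteq> Q"
    hence "(fst P - fst Q, snd P - snd Q) \<noteq> (0, 0)" by (auto simp: prod_eq_iff)
    from GL2_row_nonzero[OF assms this] show False
      using eq by (auto simp: row_act_def algebra_simps)
  qed
  hence "inj (row_act A)" by (rule injI)
  thus ?thesis by (simp add: bij_def finite_UNIV_inj_surj)
qed

lemma total_mat_act:
  assumes "A \<in> carrier GL2" shows "total (mat_act A F) = total F"
  unfolding total_def val_mat_act by (rule sum.reindex_bij_betw[OF bij_row_act[OF assms]])

lemma dual_form_mat_act:
  fixes F :: "'p::prime_card mod_ring poly poly"
  assumes A: "A \<in> carrier GL2" shows "dual_form (mat_act A F) = mat_act A (dual_form F)"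
proof -
  define L :: "'p mod_ring \<times> 'p mod_ring \<Rightarrow> 'p mod_ring poly poly"
    where "L P = const2 (fst P) * varY - const2 (snd P) * varX" for P
  have det: "det A = A $$ (0,0) * A $$ (1,1) - A $$ (0,1) * A $$ (1,0)" "det A \<noteq> 0"
    using A by (auto simp: GL2_simps det_2x2)
  have "mat_act A (L (row_act A P)) = const2 (det A) * L P" for P
    unfolding L_def row_act_def det(1) by (simp add: mat_act_simps const2_simps algebra_simps)
  hence "mat_act A (L (row_act A P) ^ (CARD('p) - 1)) = const2 (det A ^ (CARD('p) - 1)) * L P ^ (CARD('p) - 1)" for P
    by (simp only: mat_act.hom_power power_mult_distrib const2.hom_power)
  hence L: "mat_act A (L (row_act A P) ^ (CARD('p) - 1)) = L P ^ (CARD('p) - 1)" for P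
    by (simp only: unit_power_card_minus_1[OF det(2)] const2.hom_one mult_1_left)
  have "mat_act A (dual_form F) = (\<Sum>P\<in>UNIV. const2 (val (fst P) (snd P) F) * mat_act A (L P ^ (CARD('p) - 1)))"
    by (simp add: dual_form_def L_def mat_act.hom_sum mat_act.hom_mult mat_act_gens(1))
  also have "\<dots> = (\<Sum>P\<in>UNIV. const2 (val (fst (row_act A P)) (snd (row_act A P)) F) * mat_act A (L (row_act A P) ^ (CARD('p) - 1)))"
    by (rule sum.reindex_bij_betw[OF bij_row_act[OF A], symmetric])
  also have "\<dots> = dual_form (mat_act A F)"
    unfolding L by (simp add: dual_form_def val_mat_act L_def)
  finally show ?thesis ..
qed

lemma homogeneous_dual_form: "homogeneous (CARD('p) - 1) (dual_form (F :: 'p::prime_card mod_ring poly poly))"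
  unfolding dual_form_def
  by (intro homogeneous_sum homogeneous_const2_mult homogeneous_power1 homogeneous_diff homogeneous_varX homogeneous_varY)

lemma sum_UNIV_power:
  "n < CARD('p) - 1 \<Longrightarrow> (\<Sum>x\<in>UNIV. (x :: 'p::prime_card mod_ring) ^ n) = 0"
proof (cases "n = 0")
  case False
  assume "n < CARD('p) - 1"
  thus ?thesis using False sum_units_power[of n, where 'p='p]
    by (simp add: sum.remove[of UNIV 0] power_0_left)
qed simp

lemma card_minus_1_pos: "0 < CARD('p::prime_card) - 1"
  using prime_gt_1_nat[OF prime_card[where 'a='p]] by simp

lemma sum_UNIV_pair: "(\<Sum>P\<in>UNIV. f (fst P) (snd P)) = (\<Sum>x\<in>UNIV. \<Sum>y\<in>UNIV. f x y)"
  by (simp add: sum.cartesian_product case_prod_beta flip: UNIV_Times_UNIV)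

text \<open>The sum of a monomial is a product of two power sums over the field, and at least one of the two
  exponents is less than \<open>p - 1\<close>.\<close>

lemma total_degree_card_minus_1:
  fixes F :: "'p::prime_card mod_ring poly poly"
  assumes "homogeneous (CARD('p) - 1) F" shows "total F = 0"
proof -
  define n where "n = CARD('p) - 1"
  define a where "a j = coeff (coeff F j) (n - j)" for j
  have n: "0 < n" using card_minus_1_pos unfolding n_def .
  have F: "F = (\<Sum>j\<le>n. const2 (a j) * varX ^ (n - j) * varY ^ j)"
    unfolding a_def by (rule homogeneous_expansion[OF assms[folded n_def]])
  have "total F = (\<Sum>x\<in>UNIV. \<Sum>y\<in>UNIV. \<Sum>j\<le>n. a j * x ^ (n - j) * y ^ j)"
    unfolding total_def
    by (subst F) (simp only: val_simps sum_UNIV_pair[of "\<lambda>x y. \<Sum>j\<le>n. a j * x ^ (n - j) * y ^ j"])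
  also have "\<dots> = (\<Sum>x\<in>UNIV. \<Sum>j\<le>n. \<Sum>y\<in>UNIV. a j * x ^ (n - j) * y ^ j)"
    by (intro sum.cong refl sum.swap)
  also have "\<dots> = (\<Sum>j\<le>n. \<Sum>x\<in>UNIV. \<Sum>y\<in>UNIV. a j * x ^ (n - j) * y ^ j)"
    by (rule sum.swap)
  also have "\<dots> = (\<Sum>j\<le>n. a j * ((\<Sum>x\<in>UNIV. x ^ (n - j)) * (\<Sum>y\<in>UNIV. y ^ j)))"
    by (simp only: sum_product) (simp only: sum_distrib_left mult.assoc)
  also have "\<dots> = 0"
  proof (intro sum.neutral ballI)
    fix j assume "j \<in> {..n}"
    hence "j < n \<or> n - j < n" using n by auto
    thus "a j * ((\<Sum>x\<in>UNIV. x ^ (n - j)) * (\<Sum>y\<in>UNIV. y ^ j)) = 0"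
      using sum_UNIV_power[where 'p='p] unfolding n_def by auto
  qed
  finally show ?thesis .
qed

lemma form_eq_0I:
  fixes F :: "'p::prime_card mod_ring poly poly"
  assumes "homogeneous s F" "s \<le> CARD('p)" "\<And>x y. (x, y) \<noteq> (0, 0) \<Longrightarrow> val x y F = 0"
  shows "F = 0"
  using vanishing_form[OF assms(1,3)] assms(2) by (metis Suc_eq_plus1 mult_zero_right not_less_eq_eq)

context
  fixes s :: nat
  assumes s: "CARD('p::prime_card) - 1 dvd s" "0 < s"
begin

lemma total_eq:
  assumes F: "homogeneous s F"
  shows "total (F :: 'p mod_ring poly poly) = - ((\<Sum>c\<in>UNIV. val 1 c F) + val 0 1 F)"
proof -
  have m1: "(\<Sum>x\<in>UNIV - {0 :: 'p mod_ring}. c) = - c" for c :: "'p mod_ring"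
  proof -
    have "(\<Sum>x\<in>UNIV - {0 :: 'p mod_ring}. c) = of_nat (CARD('p) - 1) * c" by simp
    also have "of_nat (CARD('p) - 1) = (- 1 :: 'p mod_ring)" by (subst of_nat_diff) (auto simp: Suc_leI)
    finally show ?thesis by simp
  qed
  have "total F = (\<Sum>x\<in>UNIV. \<Sum>y\<in>UNIV. val x y F)"
    unfolding total_def by (rule sum_UNIV_pair)
  also have "\<dots> = (\<Sum>y\<in>UNIV. val 0 y F) + (\<Sum>x\<in>UNIV - {0}. \<Sum>y\<in>UNIV. val x y F)"
    by (rule sum.remove) auto
  also have "(\<Sum>y\<in>UNIV. val 0 y F) = val 0 0 F + (\<Sum>y\<in>UNIV - {0}. val 0 y F)"
    by (rule sum.remove) auto
  also have "(\<Sum>y\<in>UNIV - {0}. val 0 y F) = (\<Sum>y\<in>UNIV - {0 :: 'p mod_ring}. val 0 1 F)"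
    by (intro sum.cong refl val_infinity[OF s(1) F]) simp
  also have "val 0 0 F + \<dots> = - val 0 1 F"
    by (simp only: val_0_0[OF F s(2)] m1 add_0_left)
  also have "(\<Sum>x\<in>UNIV - {0}. \<Sum>y\<in>UNIV. val x y F) = (\<Sum>x\<in>UNIV - {0 :: 'p mod_ring}. \<Sum>c\<in>UNIV. val 1 c F)"
  proof (rule sum.cong[OF refl])
    fix x :: "'p mod_ring" assume x: "x \<in> UNIV - {0}"
    have "(\<Sum>y\<in>UNIV. val x y F) = (\<Sum>y\<in>UNIV. val 1 (y / x) F)"
      by (intro sum.cong refl val_affine[OF s(1) F]) (use x in simp)
    also have "\<dots> = (\<Sum>c\<in>UNIV. val 1 c F)"
      by (rule sum.reindex_bij_witness[of _ "\<lambda>c. c * x" "\<lambda>y. y / x"]) (use x in auto)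
    finally show "(\<Sum>y\<in>UNIV. val x y F) = (\<Sum>c\<in>UNIV. val 1 c F)" .
  qed
  also have "\<dots> = - (\<Sum>c\<in>UNIV. val 1 c F)" by (rule m1)
  finally show ?thesis by simp
qed

text \<open>The summand of \<open>P\<close> contributes the value of \<open>F\<close> at \<open>P\<close>, except for the multiples of \<open>(u, v)\<close>, where it
  is zero; these would have contributed \<open>p - 1 = -1\<close> times the value at \<open>(u, v)\<close>.\<close>

lemma val_dual_form:
  assumes F: "homogeneous s F" and uv: "(u, v) \<noteq> (0, 0 :: 'p mod_ring)"
  shows "val u v (dual_form F) = total F + val u v F"
proof -
  have ind: "z ^ (CARD('p) - 1) = 1 - (if z = 0 then 1 else 0)" for z :: "'p mod_ring"
    using unit_power_card_minus_1[of z] card_minus_1_pos[where 'p='p] by (auto simp: power_0_left)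
  have "val u v (dual_form F) = (\<Sum>P\<in>UNIV. val (fst P) (snd P) F * (fst P * v - snd P * u) ^ (CARD('p) - 1))"
    by (simp add: dual_form_def val_simps)
  also have "\<dots> = total F - (\<Sum>P\<in>UNIV. if fst P * v - snd P * u = 0 then val (fst P) (snd P) F else 0)"
    unfolding ind total_def sum_subtractf[symmetric] by (intro sum.cong refl) auto
  also have "(\<Sum>P\<in>UNIV. if fst P * v - snd P * u = 0 then val (fst P) (snd P) F else 0)
    = (\<Sum>P\<in>{P. fst P * v - snd P * u = 0}. val (fst P) (snd P) F)"
    by (subst sum.inter_filter[symmetric]) auto
  also have "\<dots> = (\<Sum>t\<in>UNIV. val (t * u) (t * v) F)"
  proof (rule sum.reindex_bij_witness[of _ "\<lambda>t. (t * u, t * v)" "\<lambda>P. if u \<noteq> 0 then fst P / u else snd P / v"])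
    fix P assume "P \<in> {P. fst P * v - snd P * u = 0}"
    thus "((if u \<noteq> 0 then fst P / u else snd P / v) * u, (if u \<noteq> 0 then fst P / u else snd P / v) * v) = P"
      and "val ((if u \<noteq> 0 then fst P / u else snd P / v) * u) ((if u \<noteq> 0 then fst P / u else snd P / v) * v) F = val (fst P) (snd P) F"
      using uv by (auto simp: prod_eq_iff field_simps)
  qed (use uv in auto)
  also have "\<dots> = (\<Sum>t\<in>UNIV. t ^ s) * val u v F"
    by (simp add: val_scale[OF F] sum_distrib_right)
  also have "(\<Sum>t\<in>UNIV. t ^ s) = 0 ^ s + (\<Sum>t\<in>UNIV - {0}. (t :: 'p mod_ring) ^ s)"
    by (rule sum.remove) auto
  also have "\<dots> = (\<Sum>t\<in>UNIV - {0 :: 'p mod_ring}. 1)"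
    using s(2) by (simp add: power_0_left unit_power_degree[OF s(1)])
  also have "\<dots> = of_nat (CARD('p) - 1)" by simp
  also have "\<dots> = - 1" by (subst of_nat_diff) (auto simp: Suc_leI)
  finally show ?thesis by simp
qed

lemma same_values:
  assumes F: "homogeneous s F" and G: "homogeneous t G" and t: "CARD('p) - 1 dvd t"
    and "\<And>c. val 1 c F = val 1 c G" "val 0 1 F = val 0 1 G" and "(x, y) \<noteq> (0, 0)"
  shows "val x y F = val x (y :: 'p mod_ring) G"
proof (cases "x = 0")
  case True
  hence "y \<noteq> 0" using assms(6) by simp
  thus ?thesis
    using True assms(5) val_infinity[OF s(1) F, of y] val_infinity[OF t G, of y] by simp
next
  case False
  thus ?thesis
    using assms(4)[of "y / x"] val_affine[OF s(1) F, of x y] val_affine[OF t G, of x y] by simp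
qed

text \<open>The forms \<open>X\<^sup>s - X\<^bsup>s-p+1\<^esup> (Y - c X)\<^bsup>p-1\<^esup>\<close> and \<open>Y\<^sup>s - Y\<^bsup>s-p+1\<^esup> X\<^bsup>p-1\<^esup>\<close> are the indicator functions
  of the points \<open>(1, c)\<close> and \<open>(0, 1)\<close>.\<close>

lemma interpolation:
  assumes "CARD('p) \<le> s"
  shows "\<exists>F. homogeneous s F \<and> (\<forall>c. val 1 c F = f c) \<and> val 0 1 F = (g :: 'p mod_ring)"
proof -
  define n where "n = CARD('p) - 1"
  have n: "0 < n" "0 < s - n" "s - n + n = s"
    using assms card_minus_1_pos[where 'p='p] by (auto simp: n_def)
  have ind: "z ^ n = 1 - (if z = 0 then 1 else 0)" for z :: "'p mod_ring"
    using unit_power_card_minus_1[of z] n by (auto simp: power_0_left n_def)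
  define F where "F = (\<Sum>c\<in>UNIV. const2 (f c) * (varX ^ s - varX ^ (s - n) * (varY - const2 c * varX) ^ n))
    + const2 g * (varY ^ s - varY ^ (s - n) * varX ^ n)"
  have lin: "homogeneous s (P ^ (s - n) * Q ^ n)"
    if "homogeneous 1 P" "homogeneous 1 Q" for P Q :: "'p mod_ring poly poly"
    using homogeneous_mult[OF homogeneous_power1[OF that(1), of "s - n"] homogeneous_power1[OF that(2), of n]] n(3)
    by auto
  have "homogeneous s F"
    unfolding F_def
    by (intro homogeneous_add homogeneous_sum homogeneous_const2_mult homogeneous_diff lin
        homogeneous_power1 homogeneous_varX homogeneous_varY)
  moreover have "val 1 c F = f c" for c
  proof -
    have "c ^ s = c ^ (s - n) * c ^ n" using n(3) by (metis power_add)
    also have "\<dots> = c ^ (s - n)" using n(2) by (simp add: ind)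
    finally have "val 1 c F = (\<Sum>d\<in>UNIV. f d * (1 - (c - d) ^ n))"
      by (simp add: F_def val_simps)
    also have "\<dots> = (\<Sum>d\<in>UNIV. if d = c then f c else 0)"
      by (intro sum.cong refl) (auto simp: ind)
    finally show ?thesis by (simp add: sum.delta)
  qed
  moreover have "val 0 1 F = g"
    using n assms s(2) by (simp add: F_def val_simps power_0_left)
  ultimately show ?thesis by blast
qed

end


lemma gsub_vals_cong:
  fixes U :: "'p::prime_card mod_ring poly poly set"
  assumes U: "gsubmodule GL2 class_ring U (Vrep s)"
    and vanish: "\<And>F. homogeneous s F \<Longrightarrow> (\<And>x y. (x, y) \<noteq> (0, 0) \<Longrightarrow> val x y F = 0) \<Longrightarrow> F \<in> U"
    and F: "F \<in> U" "homogeneous s G" "\<And>x y. (x, y) \<noteq> (0, 0) \<Longrightarrow> val x y F = val x y G"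
  shows "G \<in> U"
proof -
  have "homogeneous s (G - F)"
    by (intro homogeneous_diff F(2) gsub_homogeneous[OF U F(1)])
  hence "G - F \<in> U" by (rule vanish) (simp add: val_simps F(3))
  from gsub_add[OF U this F(1)] show ?thesis by simp
qed

text \<open>The difference of \<open>E\<close> and its translate by a shear is \<open>e\<close> times the difference of the indicator
  functions of two points \<open>(1, c)\<close>; swapping the coordinates brings in the point \<open>(0, 1)\<close>.  Such
  differences span the functions with sum zero.\<close>

lemma total_0_in_gsub:
  fixes U :: "'p::prime_card mod_ring poly poly set"
  assumes s: "CARD('p) - 1 dvd s" "0 < s"
    and U: "gsubmodule GL2 class_ring U (Vrep s)"
    and vanish: "\<And>F. homogeneous s F \<Longrightarrow> (\<And>x y. (x, y) \<noteq> (0, 0) \<Longrightarrow> val x y F = 0) \<Longrightarrow> F \<in> U"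
    and E: "E \<in> U" "\<And>x y. (x, y) \<noteq> (0, 0) \<Longrightarrow> val x y E = b + (if x \<noteq> 0 \<and> y \<noteq> 0 then e else 0)"
    and e: "e \<noteq> 0" and F: "homogeneous s F" "total F = 0"
  shows "F \<in> U"
proof -
  \<comment> \<open>\<open>e\<close> times the indicator of \<open>(1, c)\<close> minus that of \<open>(1, 0)\<close>\<close>
  define D where "D c = E - mat_act (mat2 1 (- c) 0 1) E" for c
  have DU: "D c \<in> U" for c
    unfolding D_def by (intro gsub_diff[OF U] gsub_mat_act[OF U] E(1)) (simp add: mat2_GL2)
  \<comment> \<open>\<open>e\<close> times the indicator of \<open>(1, 1)\<close> minus that of \<open>(0, 1)\<close>\<close>
  define D' where "D' = mat_act (mat2 0 1 1 0) (D 1)"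
  have D'U: "D' \<in> U"
    unfolding D'_def by (intro gsub_mat_act[OF U] DU) (simp add: mat2_GL2)
  have Dval: "val 1 y (D c) = (if y = c then e else 0) - (if y = 0 then e else 0)" "val 0 1 (D c) = 0" for y c
    by (simp_all add: D_def val_simps eval2_mat_act[OF id_ring_hom] E(2))
  have homD: "homogeneous s (D c)" for c by (rule gsub_homogeneous[OF U DU])
  have D'val: "val 1 y D' = (if y = 1 then e else 0)" "val 0 1 D' = - e" for y
  proof -
    have "val 1 y D' = val y 1 (D 1)" "val 0 1 D' = val 1 0 (D 1)"
      by (simp_all add: D'_def eval2_mat_act[OF id_ring_hom])
    moreover have "val y 1 (D 1) = (if y = 1 then e else 0)"
    proof (cases "y = 0")
      case False
      have "val y 1 (D 1) = val 1 (1 / y) (D 1)" by (rule val_affine[OF s(1) homD False])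
      thus ?thesis using False by (simp add: Dval field_simps)
    qed (simp add: Dval)
    ultimately show "val 1 y D' = (if y = 1 then e else 0)" "val 0 1 D' = - e" by (simp_all add: Dval)
  qed
  define S where "S = (\<Sum>c\<in>UNIV. val 1 c F)"
  have "- (S + val 0 1 F) = 0" using total_eq[OF s F(1)] F(2) unfolding S_def by metis
  hence inf: "val 0 1 F = - S" by (simp only: neg_equal_0_iff_equal add_eq_0_iff)
  define G where "G = const2 (inverse e) * ((\<Sum>c\<in>UNIV. const2 (val 1 c F) * D c) - const2 S * D 1 + const2 S * D')"
  have GU: "G \<in> U"
    unfolding G_def by (intro gsub_const2[OF U] gsub_add[OF U] gsub_diff[OF U] gsub_sum[OF U] DU D'U)
  show ?thesis
  proof (rule gsub_vals_cong[OF U vanish GU F(1)])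
    have "val 1 y G = val 1 y F" for y
    proof -
      have "(\<Sum>c\<in>UNIV. val 1 c F * val 1 y (D c))
        = (\<Sum>c\<in>UNIV. (if c = y then val 1 y F * e else 0) - val 1 c F * (if y = 0 then e else 0))"
        by (intro sum.cong refl) (auto simp: Dval right_diff_distrib)
      also have "\<dots> = val 1 y F * e - S * (if y = 0 then e else 0)"
        by (simp only: sum_subtractf sum.delta finite UNIV_I if_True S_def sum_distrib_right)
      finally have D: "(\<Sum>c\<in>UNIV. val 1 c F * val 1 y (D c)) = val 1 y F * e - S * (if y = 0 then e else 0)" .
      have "val 1 y G = inverse e * ((\<Sum>c\<in>UNIV. val 1 c F * val 1 y (D c)) - S * val 1 y (D 1) + S * val 1 y D')"
        by (simp only: G_def val_simps)
      also have "\<dots> = inverse e * (val 1 y F * e)"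
        unfolding D unfolding Dval D'val by (simp add: algebra_simps)
      finally show ?thesis using e by simp
    qed
    moreover have "val 0 1 G = val 0 1 F"
      using e by (simp add: G_def val_simps Dval D'val inf)
    ultimately show "val x y G = val x y F" if "(x, y) \<noteq> (0, 0)" for x y
      by (rule same_values[OF s gsub_homogeneous[OF U GU] F(1) s(1) _ _ that])
  qed
qed

section \<open>Divisibility of binomial coefficients\<close>

lemma Suc_times_choose_Suc: "Suc k * (n choose Suc k) = (n - k) * (n choose k)"
proof (cases n)
  case (Suc m)
  have "Suc k * (n choose Suc k) = n * (m choose k)" using Suc_times_binomial[of k m] Suc by simp
  also have "\<dots> = (n - k) * (n choose k)" using binomial_absorb_comp[of n k] Suc by simp
  finally show ?thesis .
qed simp

text \<open>Up to the factor \<open>k!\<close>, which is prime to \<open>p\<close>, the binomial coefficient is the product of the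
  \<open>n - j\<close> for \<open>j < k\<close>.\<close>

lemma prime_dvd_choose_imp:
  assumes "prime p" "k < p" "p dvd (n choose k)"
  shows "\<exists>j<k. [n = j] (mod p)"
  using assms(2,3)
proof (induction k)
  case 0
  thus ?case using assms(1) by simp
next
  case (Suc k)
  have "p dvd (n - k) * (n choose k)"
    using Suc.prems(2) unfolding Suc_times_choose_Suc[symmetric] by (rule dvd_mult)
  hence "p dvd n - k \<or> p dvd n choose k" using assms(1) by (simp add: prime_dvd_mult_iff)
  thus ?case
  proof
    assume d: "p dvd n - k"
    show ?thesis
    proof (cases "k \<le> n")
      case True
      hence "[n = k] (mod p)" using d cong_altdef_nat by blast
      thus ?thesis by blast
    next
      case False
      thus ?thesis by (intro exI[of _ n]) auto
    qed
  next
    assume "p dvd n choose k"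
    thus ?thesis using Suc less_Suc_eq by fastforce
  qed
qed

lemma alternating_choose_sum:
  assumes "0 < n"
  shows "(\<Sum>m\<le>i. (- 1) ^ m * of_nat (n choose m)) = ((- 1) ^ i * of_nat (n - 1 choose i) :: 'a::comm_ring_1)"
proof (induction i)
  case (Suc i)
  obtain k where "n = Suc k" using assms by (cases n) auto
  thus ?case using Suc by (simp add: algebra_simps)
qed simp

lemma of_nat_mod_ring_eq_iff:
  "(of_nat m :: 'p::prime_card mod_ring) = of_nat n \<longleftrightarrow> [m = n] (mod CARD('p))"
  using of_nat_eq_iff_cong_CHAR[where 'a="'p mod_ring", of m n] by simp

section \<open>The graded piece\<close>

lemma group_module_det_twist:
  "group_module GL2 class_ring (det_twist (Vrep n) i :: ('k::field, _, _) gmodule)"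
proof -
  interpret group_module GL2 class_ring "Vrep n :: ('k, _, _) gmodule" by (rule group_module_Vrep)
  have "abelian_group (det_twist (Vrep n) i :: ('k, _, _) gmodule)"
    by (rule abelian_groupI)
       (auto simp: det_twist_def homogeneous_add homogeneous_0 algebra_simps intro: homogeneous_minus exI[of _ "- _"])
  then have "module class_ring (det_twist (Vrep n) i :: ('k, _, _) gmodule)"
    by (intro moduleI class_cring.is_cring)
       (simp_all add: det_twist_def homogeneous_const2_mult const2_simps distrib_left distrib_right mult.assoc)
  then show ?thesis
    unfolding group_module_def group_module_axioms_def
    by (auto simp: group_GL2 det_twist_def homogeneous_const2_mult homogeneous_mat_act mat_act_one GL2_simps
        mat_act_mult mat_act.hom_add mat_act.hom_mult mat_act_gens(1) det_mult power_mult_distrib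
        const2.hom_mult distrib_left mult.assoc mult.left_commute simp del: const2.hom_power)
qed

context
  fixes r i s :: nat
  assumes r: "r = s + i * (CARD('p::prime_card) + 1)"
begin

lemma Vfilt_eq: "Vfilt r i = {theta ^ i * H | H :: 'p mod_ring poly poly. homogeneous s H}"
proof (intro equalityI subsetI)
  fix F :: "'p mod_ring poly poly" assume "F \<in> Vfilt r i"
  hence "homogeneous r F" "theta ^ i dvd F" by (auto simp: Vfilt_iff)
  from theta_power_dvd_form[OF this] show "F \<in> {theta ^ i * H | H. homogeneous s H}"
    using r by auto
next
  fix F :: "'p mod_ring poly poly" assume "F \<in> {theta ^ i * H | H. homogeneous s H}"
  then obtain H where H: "F = theta ^ i * H" "homogeneous s H" by blast
  have "homogeneous r F"
    unfolding H(1) using homogeneous_mult[OF homogeneous_power[OF homogeneous_theta] H(2), of i]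
    by (simp add: r algebra_simps)
  thus "F \<in> Vfilt r i" using H by (simp add: Vfilt_iff)
qed

lemma mat_act_theta_mult:
  assumes "A \<in> carrier GL2"
  shows "mat_act A (theta ^ i * H) = theta ^ i * (const2 (det A ^ i) * mat_act A (H :: 'p mod_ring poly poly))"
  using assms by (simp add: mat_act_simps mat_act_theta GL2_simps power_mult_distrib const2_simps mult_ac)

text \<open>A description of \<open>B\<close> on \<open>V\<^sup>i\<close> by a linear condition \<open>T H = 0\<close> identifies the quotient with the
  range of \<open>T\<close>.  The twist comes from \<open>mat_act_theta\<close>: a matrix multiplies \<open>\<theta>\<^sup>i\<close> by the \<open>i\<close>-th power of its
  determinant.\<close>

lemma graded_quotient_iso:
  fixes T :: "'p mod_ring poly poly \<Rightarrow> 'p mod_ring poly poly"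
  assumes T_add: "\<And>F G. T (F + G) = T F + T G" and T_const2: "\<And>c F. T (const2 c * F) = const2 c * T F"
    and T_act: "\<And>A F. A \<in> carrier GL2 \<Longrightarrow> T (mat_act A F) = mat_act A (T F)"
    and T_hom: "\<And>F. homogeneous s F \<Longrightarrow> homogeneous n (T F)"
    and T_onto: "\<And>G. homogeneous n G \<Longrightarrow> \<exists>F. homogeneous s F \<and> T F = G"
    and B: "gsubmodule GL2 class_ring B (Vrep r)"
    and ker: "\<And>H. homogeneous s H \<Longrightarrow> theta ^ i * H \<in> B \<longleftrightarrow> T H = 0"
  shows "gmodule_iso GL2 class_ring
    (quotient_gmodule ((Vrep r)\<lparr>carrier := Vfilt r i\<rparr>) (B \<inter> Vfilt r i)) (det_twist (Vrep n) i)"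
proof -
  let ?M = "(Vrep r :: ('p mod_ring, _, _) gmodule)\<lparr>carrier := Vfilt r i\<rparr>"
  interpret M: group_module GL2 class_ring ?M
    by (rule group_module.gsubmodule_restrict[OF group_module_Vrep Vfilt_gsubmodule])
  note V = Vfilt_gsubmodule[where r=r and m=i and 'p='p]
  have "gsubmodule GL2 class_ring (B \<inter> Vfilt r i) ?M"
    by (rule M.gsubmoduleI)
       (auto intro: gsub_0[OF B] gsub_0[OF V] gsub_add[OF B] gsub_add[OF V] gsub_const2[OF B] gsub_const2[OF V]
          gsub_mat_act[OF B] gsub_mat_act[OF V])
  then interpret J: group_submodule GL2 class_ring ?M "B \<inter> Vfilt r i" by (rule M.group_submoduleI)
  define f where "f F = T (F div theta ^ i)" for F
  have f: "f (theta ^ i * H) = T H" for H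
    unfolding f_def using theta_nonzero[where 'p='p] by (subst nonzero_mult_div_cancel_left) auto
  have cases: thesis if "F \<in> Vfilt r i" "\<And>H. homogeneous s H \<Longrightarrow> F = theta ^ i * H \<Longrightarrow> thesis" for F :: "'p mod_ring poly poly" and thesis
    using that unfolding Vfilt_eq by blast
  show ?thesis
  proof (rule J.quotient_iso)
    show "group_module GL2 class_ring (det_twist (Vrep n) i :: ('p mod_ring, _, _) gmodule)"
      by (rule group_module_det_twist)
    show "f \<in> gmodule_hom GL2 class_ring ?M (det_twist (Vrep n) i)"
      unfolding gmodule_hom_def module_hom_def
    proof (intro CollectI conjI allI ballI impI funcsetI; (elim conjE)?)
      fix F assume "F \<in> carrier ?M"
      hence "F \<in> Vfilt r i" by simp
      thus "f F \<in> carrier (det_twist (Vrep n) i)"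
        by (elim cases) (simp add: f T_hom det_twist_def)
    next
      fix F G assume "F \<in> carrier ?M" "G \<in> carrier ?M"
      hence "F \<in> Vfilt r i" "G \<in> Vfilt r i" by simp_all
      thus "f (F \<oplus>\<^bsub>?M\<^esub> G) = f F \<oplus>\<^bsub>det_twist (Vrep n) i\<^esub> f G"
        by (elim cases) (simp add: f T_add det_twist_def flip: distrib_left)
    next
      fix c F assume "F \<in> carrier ?M"
      hence "F \<in> Vfilt r i" by simp
      thus "f (c \<odot>\<^bsub>?M\<^esub> F) = c \<odot>\<^bsub>det_twist (Vrep n) i\<^esub> f F"
      proof (elim cases)
        fix H assume H: "F = theta ^ i * H"
        have "const2 c * F = theta ^ i * (const2 c * H)" by (simp add: H mult_ac)
        hence "f (const2 c * F) = const2 c * T H" by (simp only: f T_const2)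
        moreover have "f F = T H" by (simp only: H f)
        ultimately show ?thesis by (simp add: det_twist_def)
      qed
    next
      fix A F assume "A \<in> carrier (GL2 :: 'p mod_ring mat monoid)" "F \<in> carrier ?M"
      hence "A \<in> carrier GL2" "F \<in> Vfilt r i" by simp_all
      thus "f (act ?M A F) = act (det_twist (Vrep n) i) A (f F)"
        by (elim cases) (simp add: mat_act_theta_mult f T_const2 T_act det_twist_def)
    qed
    show "f ` carrier ?M = carrier (det_twist (Vrep n) i)"
    proof (intro equalityI subsetI)
      fix G assume "G \<in> f ` carrier ?M"
      then obtain F where "F \<in> Vfilt r i" "G = f F" by auto
      thus "G \<in> carrier (det_twist (Vrep n) i)" by (elim cases) (simp add: f T_hom det_twist_def)
    next
      fix G assume "G \<in> carrier (det_twist (Vrep n) i :: ('p mod_ring, _, _) gmodule)"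
      hence "homogeneous n G" by (simp add: det_twist_def)
      then obtain H where H: "homogeneous s H" "G = f (theta ^ i * H)" using T_onto f by metis
      hence "theta ^ i * H \<in> carrier ?M" by (auto simp: Vfilt_eq)
      thus "G \<in> f ` carrier ?M" using H by blast
    qed
    show "B \<inter> Vfilt r i = {F \<in> carrier ?M. f F = \<zero>\<^bsub>det_twist (Vrep n) i\<^esub>}"
    proof (intro equalityI subsetI)
      fix F assume "F \<in> B \<inter> Vfilt r i"
      hence F: "F \<in> B" "F \<in> Vfilt r i" by auto
      from F(2) show "F \<in> {F \<in> carrier ?M. f F = \<zero>\<^bsub>det_twist (Vrep n) i\<^esub>}"
        by (rule cases) (use F ker in \<open>simp add: f det_twist_def\<close>)
    next
      fix F assume "F \<in> {F \<in> carrier ?M. f F = \<zero>\<^bsub>det_twist (Vrep n) i\<^esub>}"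
      hence F: "f F = 0" "F \<in> Vfilt r i" by (auto simp: det_twist_def)
      from F(2) show "F \<in> B \<inter> Vfilt r i"
        by (rule cases) (use F ker in \<open>simp add: f\<close>)
    qed
  qed
qed

end


section \<open>The kernel of the map between the quotients\<close>

lemma gmodule_iso_refl: "gmodule_iso G R M M"
  unfolding gmodule_iso_def gmodule_hom_def module_hom_def
  by (intro bexI[of _ "\<lambda>x. x"]) (auto simp: bij_betw_def)

lemma bracket_cong:
  assumes "3 \<le> p" shows "[int (bracket p n) = n] (mod int (p - 1))"
proof -
  define q where "q = int (p - 1)"
  have q: "0 < q" using assms by (simp add: q_def)
  define t where "t = n mod q"
  define m where "m = (if t = 0 then p - 1 else nat t)"
  have "0 \<le> t" "t < int (p - 1)" using q by (auto simp: t_def q_def)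
  hence m: "m \<in> {1..p - 1}" using assms unfolding m_def by auto
  have mc: "[int m = n] (mod q)" using q \<open>0 \<le> t\<close> by (auto simp: m_def t_def cong_def q_def)
  have top: "x = p - 1" if "p - 1 dvd x" "x \<in> {1..p - 1}" for x
    using that dvd_imp_le[of "p - 1" x] by auto
  have "k = m" if k: "k \<in> {1..p - 1}" "[int k = n] (mod q)" for k
  proof -
    have "[k = m] (mod (p - 1))"
      using cong_trans[OF k(2) cong_sym[OF mc]] unfolding q_def by (simp only: cong_int_iff)
    hence km: "k mod (p - 1) = m mod (p - 1)" by (simp only: cong_def)
    show ?thesis
    proof (cases "k = p - 1 \<or> m = p - 1")
      case True
      hence "k mod (p - 1) = 0" "m mod (p - 1) = 0" using km by auto
      hence "k = p - 1" "m = p - 1" using top k(1) m by (simp_all only: mod_eq_0_iff_dvd)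
      thus ?thesis by (simp only:)
    next
      case False
      hence "k < p - 1" "m < p - 1" using k(1) m by auto
      thus ?thesis using km by (simp only: mod_less)
    qed
  qed
  note unique = this
  have "bracket p n = m"
    unfolding bracket_def q_def[symmetric]
  proof (rule the_equality)
    show "m \<in> {1..p - 1} \<and> [int m = n] (mod q)" using m mc by (rule conjI)
    show "k = m" if "k \<in> {1..p - 1} \<and> [int k = n] (mod q)" for k
      using that unique by blast
  qed
  thus ?thesis using mc by (simp add: q_def)
qed

text \<open>Below, \<open>Qker\<close> is the kernel of \<open>V\<^sub>r \<rightarrow> Q(i)\<close>, and \<open>s\<close> is the degree of the quotients \<open>H\<close> of the
  elements \<open>\<theta>\<^sup>i H\<close> of \<open>V\<^sup>i\<close>.\<close>

context
  fixes r i s :: nat and Qker :: "'p::prime_card mod_ring poly poly set"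
  assumes r: "r = s + i * (CARD('p) + 1)" and i: "1 \<le> i" "i < CARD('p) - 1"
    and s: "CARD('p) - 1 dvd s" "CARD('p) \<le> s"
  defines "Qker \<equiv> Xsub r i <+>\<^bsub>Vrep r\<^esub> Vfilt r (i + 1)"
begin

lemma degree_conditions: "i \<le> r" "i < r - i" "[r - i = i] (mod (CARD('p) - 1))"
proof -
  show "i \<le> r" "i < r - i" using r i s by simp_all
  define q where "q = CARD('p) - 1"
  have "CARD('p) = q + 1" using i by (simp add: q_def)
  hence "r - i = s + i * q + i" unfolding r by (simp add: algebra_simps)
  hence "r - i = s + i * (CARD('p) - 1) + i" by (simp only: q_def)
  moreover have "[s + i * (CARD('p) - 1) + i = 0 + i] (mod (CARD('p) - 1))"
    by (rule cong_add[OF _ cong_refl]) (use s(1) in \<open>simp add: cong_0_iff\<close>)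
  ultimately show "[r - i = i] (mod (CARD('p) - 1))" by simp
qed

lemma quotient_degree_pos: "0 < s"
  using s(2) i by simp

lemma Qker_gsubmodule: "gsubmodule GL2 class_ring Qker (Vrep r)"
  unfolding Qker_def by (intro gsub_sum_gsubmodule Xsub_gsubmodule degree_conditions(1) Vfilt_gsubmodule)

lemma Xsub_le_Qker: "F \<in> Xsub r i \<Longrightarrow> F \<in> Qker"
  unfolding Qker_def by (rule gsub_sum_left[OF _ gsub_0[OF Vfilt_gsubmodule]])

lemma Vfilt_le_Qker: "F \<in> Vfilt r (i + 1) \<Longrightarrow> F \<in> Qker"
  unfolding Qker_def by (rule gsub_sum_right[OF _ gsub_0[OF Xsub_gsubmodule(1)[OF degree_conditions(1)]]])

lemma homogeneous_theta_mult:
  "homogeneous s (H :: 'p mod_ring poly poly) \<Longrightarrow> homogeneous r (theta ^ i * H)"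
  using Vfilt_eq[OF r] by (auto simp: Vfilt_iff)

lemma vanishing_in_Qker:
  assumes "homogeneous s H" "\<And>x y. (x, y) \<noteq> (0, 0) \<Longrightarrow> val x y H = 0"
  shows "theta ^ i * H \<in> Qker"
proof -
  obtain K where "H = theta * K" using vanishing_form[OF assms] by blast
  hence "theta ^ i * H \<in> Vfilt r (i + 1)"
    using homogeneous_theta_mult[OF assms(1)] by (simp add: Vfilt_iff)
  thus ?thesis by (rule Vfilt_le_Qker)
qed

text \<open>The factor by which a matrix multiplies \<open>\<theta>\<^sup>i\<close> is a unit, so the quotients form a submodule for the
  untwisted action, to which \<open>total_0_in_gsub\<close> applies.\<close>

lemma quotient_forms_gsubmodule:
  "gsubmodule GL2 class_ring {H. homogeneous s H \<and> theta ^ i * H \<in> Qker} (Vrep s)"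
proof (rule gsubmodule_VrepI)
  fix A :: "'p mod_ring mat" and H assume A: "A \<in> carrier GL2" and H: "H \<in> {H. homogeneous s H \<and> theta ^ i * H \<in> Qker}"
  have "mat_act A (theta ^ i * H) \<in> Qker" using H by (intro gsub_mat_act[OF Qker_gsubmodule A]) auto
  hence "const2 (det A ^ i) * (theta ^ i * mat_act A H) \<in> Qker"
    unfolding mat_act_theta_mult[OF r A] by (simp only: mult.left_commute)
  from gsub_const2_cancel[OF Qker_gsubmodule this]
  show "mat_act A H \<in> {H. homogeneous s H \<and> theta ^ i * H \<in> Qker}"
    using A H by (simp add: GL2_simps homogeneous_mat_act)
next
  fix c H assume H: "H \<in> {H. homogeneous s H \<and> theta ^ i * H \<in> Qker}"
  hence "const2 c * (theta ^ i * H) \<in> Qker" by (intro gsub_const2[OF Qker_gsubmodule]) auto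
  thus "const2 c * H \<in> {H. homogeneous s H \<and> theta ^ i * H \<in> Qker}"
    using H by (simp add: homogeneous_const2_mult mult.left_commute)
qed (auto simp: homogeneous_0 homogeneous_add distrib_left gsub_0[OF Qker_gsubmodule] gsub_add[OF Qker_gsubmodule])

lemma relation_form_quotient:
  shows "\<exists>E. homogeneous s E \<and> theta ^ i * E \<in> Qker \<and>
    (\<forall>x y. (x, y) \<noteq> (0, 0) \<longrightarrow> val x y E = (- 1) ^ i * of_nat (r - i - 1 choose i)
      + (if x \<noteq> 0 \<and> y \<noteq> 0 then (- 1) ^ i * (of_nat (i + 1) * of_nat (r - i choose i)) else 0))"
proof -
  have X: "(relation_form (r - i) i :: 'p mod_ring poly poly) \<in> Xsub r i"
    by (rule relation_form_in_Xsub[OF i(2) degree_conditions(1)])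
  have "(relation_form (r - i) i :: 'p mod_ring poly poly) \<in> Vfilt r i"
    using gsub_homogeneous[OF Xsub_gsubmodule(1)[OF degree_conditions(1)] X]
      relation_form_factorization(1)[OF degree_conditions(2,3) i(2)] by (simp only: Vfilt_iff)
  then obtain E :: "'p mod_ring poly poly" where E: "relation_form (r - i) i = theta ^ i * E" "homogeneous s E"
    unfolding Vfilt_eq[OF r] by blast
  have pos: "0 < r - i" using degree_conditions(2) by simp
  show ?thesis
    using E Xsub_le_Qker[OF X] relation_form_factorization(2)[OF degree_conditions(2,3) i(2) E(1)]
    unfolding alternating_choose_sum[OF pos] by metis
qed

text \<open>The exponent \<open>N\<close> is replaced by the small exponent \<open>N' = p (i + 1 - j) + j - 1\<close>, which is congruent to \<open>N\<close>
  modulo \<open>p\<close> and, like \<open>N\<close>, to \<open>i\<close> modulo \<open>p - 1\<close>.  After division by \<open>\<theta>\<^sup>i\<close> the degree is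
  \<open>N' + i - i (p + 1) = (1 - j) (p - 1)\<close>.\<close>

lemma values_of_Qker:
  assumes H: "theta ^ i * H \<in> Qker"
    and j: "j \<le> i" "[r - i + 1 = j] (mod CARD('p))"
  shows "\<exists>H'. (if j = 0 then homogeneous (CARD('p) - 1) H' else if j = 1 then homogeneous 0 H' else H' = 0)
    \<and> (\<forall>x y. (x, y) \<noteq> (0, 0) \<longrightarrow> val x y H = val x y H')"
proof -
  define p where "p = CARD('p)"
  have p: "i + 1 < p" using i by (simp add: p_def)
  obtain q where q: "p = q + 1" using p by (metis Suc_eq_plus1 less_imp_Suc_add)
  define k where "k = i + 1 - j"
  have k: "1 \<le> k" "k + j = i + 1" using j by (simp_all add: k_def)
  define N' where "N' = p * k + j - 1"
  have pk: "p \<le> p * k" using k(1) by simp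
  have N': "N' + 1 = p * k + j" "i < N'" unfolding N'_def using p pk by linarith+
  have "[r - i + 1 = N' + 1] (mod p)"
    using j(2) unfolding N'(1) p_def by (simp add: cong_def)
  hence c1: "[r - i = N'] (mod p)" by (simp only: cong_add_rcancel_nat)
  have "N' + 1 = (p - 1) * k + (k + j)" unfolding N'(1) q by (simp add: algebra_simps)
  hence "[N' + 1 = i + 1] (mod (p - 1))" unfolding k(2) by (simp add: cong_def)
  hence "[N' = i] (mod (p - 1))" by (simp only: cong_add_rcancel_nat)
  hence c2: "[r - i = N'] (mod (p - 1))" using degree_conditions(3) cong_trans cong_sym unfolding p_def by blast
  have "coprime p (p - 1)" unfolding q by simp
  hence c: "[r - i = N'] (mod (CARD('p) * (CARD('p) - 1)))"
    using coprime_cong_mult_nat[OF c1 c2] by (simp add: p_def)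
  obtain F1 F2 where F12: "F1 \<in> Xsub r i" "F2 \<in> Vfilt r (i + 1)" "theta ^ i * H = F1 + F2"
    using H unfolding Qker_def gsub_sum_iff by blast
  then obtain K where "F2 = theta ^ (i + 1) * K" unfolding Vfilt_iff dvd_def by blast
  hence F1: "F1 \<in> Xsub r i" "theta ^ i * H = F1 + theta ^ (i + 1) * K" using F12 by simp_all
  hence "F1 = theta ^ i * (H - theta * K)" by (simp add: algebra_simps)
  hence "theta ^ i * (H - theta * K) \<in> Xsub r i" using F1(1) by simp
  from Xsub_values[OF this degree_conditions(1) _ degree_conditions(2) N'(2) c] p obtain H' where
    H': "if i * (CARD('p) + 1) \<le> N' + i then homogeneous (N' + i - i * (CARD('p) + 1)) H' else H' = 0"
      "\<And>x y. (x, y) \<noteq> (0, 0) \<Longrightarrow> val x y (H - theta * K) = val x y H'" by (auto simp: p_def)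
  have "val x y H = val x y H'" if "(x, y) \<noteq> (0, 0)" for x y
    using H'(2)[OF that] by (simp add: val_simps val_theta)
  moreover have "if j = 0 then homogeneous (CARD('p) - 1) H' else if j = 1 then homogeneous 0 H' else H' = 0"
  proof (cases "j \<le> 1")
    case True
    have "N' + 1 + i = i * (p + 1) + (1 - j) * (p - 1) + 1"
    proof -
      consider "j = 0" "k = i + 1" | "j = 1" "k = i" using True k(2) by linarith
      thus ?thesis unfolding N'(1) by cases (simp_all add: q algebra_simps)
    qed
    hence "N' + i = i * (p + 1) + (1 - j) * (p - 1)" by simp
    thus ?thesis using H'(1) True by (auto simp: p_def le_Suc_eq)
  next
    case False
    have "k + (j - 1) = i" using k(2) False by simp
    hence "p * k + p * (j - 1) = p * i" by (simp flip: distrib_left)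
    moreover have "1 * (j - 1) < p * (j - 1)" using False p by (intro mult_strict_right_mono) auto
    moreover have "N' + 1 + i = p * k + (j - 1) + 1 + i" unfolding N'(1) using False by simp
    ultimately have "N' + i < p * i + i" by linarith
    hence "N' + i < i * (p + 1)" by (simp add: algebra_simps)
    thus ?thesis using H'(1) False by (simp add: p_def)
  qed
  ultimately show ?thesis by blast
qed

text \<open>With \<open>b = binom (N-1) i\<close> and \<open>c = (i+1) binom N i\<close>, the quotient \<open>E\<close> of the relation form has value \<open>\<plusminus>(b + c)\<close>
  at the points with \<open>x y \<noteq> 0\<close> and \<open>\<plusminus>b\<close> at the other two.  The hypothesis gives \<open>c \<noteq> 0\<close>, which yields all functions with
  sum zero, and \<open>b \<noteq> c\<close>, which means that \<open>E\<close> itself does not have sum zero.\<close>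

lemma Qker_all:
  assumes "\<not> [(r - i + 1) choose (i + 1) = 0] (mod CARD('p))" and H: "homogeneous s H"
  shows "theta ^ i * H \<in> Qker"
proof -
  define N where "N = r - i"
  define b c :: "'p mod_ring" where "b = of_nat (N - 1 choose i)" and "c = of_nat (i + 1) * of_nat (N choose i)"
  obtain E where E: "homogeneous s E" "theta ^ i * E \<in> Qker"
    "\<And>x y. (x, y) \<noteq> (0, 0) \<Longrightarrow> val x y E = (- 1) ^ i * b + (if x \<noteq> 0 \<and> y \<noteq> 0 then (- 1) ^ i * c else 0)"
    using relation_form_quotient unfolding b_def c_def N_def by blast
  have "of_nat (N + 1 choose (i + 1)) \<noteq> (0 :: 'p mod_ring)"
    using assms(1) of_nat_mod_ring_eq_iff[of "N + 1 choose (i + 1)" 0, where 'p='p] by (simp add: N_def)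
  moreover have "of_nat (i + 1) * of_nat (N + 1 choose (i + 1)) = (of_nat (N + 1) * of_nat (N choose i) :: 'p mod_ring)"
    using Suc_times_binomial[of i N] by (metis Suc_eq_plus1 of_nat_mult)
  moreover have i1: "of_nat (i + 1) \<noteq> (0 :: 'p mod_ring)" "of_nat i \<noteq> (0 :: 'p mod_ring)"
    using i by (intro of_nat_mod_ring_nonzero; simp)+
  ultimately have N1: "of_nat (N + 1) \<noteq> (0 :: 'p mod_ring)" "of_nat (N choose i) \<noteq> (0 :: 'p mod_ring)" by auto
  hence c0: "c \<noteq> 0" using i1 by (simp add: c_def)
  have bc: "b \<noteq> c"
  proof
    assume "b = c"
    have "(N - i) * (N choose i) = N * (N - 1 choose i)" by (rule binomial_absorb_comp)
    hence "of_nat (N - i) * of_nat (N choose i) = (of_nat N * b :: 'p mod_ring)"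
      unfolding b_def by (metis of_nat_mult)
    moreover have "of_nat (N - i) = (of_nat N - of_nat i :: 'p mod_ring)"
      using degree_conditions(2) by (simp add: N_def of_nat_diff)
    ultimately have "(of_nat N - of_nat i) * of_nat (N choose i)
      = (of_nat N * of_nat (i + 1) * of_nat (N choose i) :: 'p mod_ring)"
      unfolding \<open>b = c\<close> c_def by (simp only: mult.assoc)
    hence "of_nat N - of_nat i = (of_nat N * of_nat (i + 1) :: 'p mod_ring)" using N1(2) by simp
    hence "of_nat i * of_nat (N + 1) = (0 :: 'p mod_ring)" by (simp add: algebra_simps eq_diff_eq)
    thus False using N1(1) i1(2) by simp
  qed
  have "total E = - ((\<Sum>y\<in>UNIV. (- 1) ^ i * b + (if y \<noteq> (0 :: 'p mod_ring) then (- 1) ^ i * c else 0)) + (- 1) ^ i * b)"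
    by (simp add: total_eq[OF s(1) quotient_degree_pos E(1)] E(3))
  also have "(\<Sum>y\<in>UNIV. (- 1) ^ i * b + (if y \<noteq> (0 :: 'p mod_ring) then (- 1) ^ i * c else 0)) = - ((- 1) ^ i * c)"
  proof -
    have "(\<Sum>y\<in>UNIV. (- 1) ^ i * b + (if y \<noteq> (0 :: 'p mod_ring) then (- 1) ^ i * c else 0))
      = (\<Sum>y\<in>UNIV. ((- 1) ^ i * b + (- 1) ^ i * c) - (if y = (0 :: 'p mod_ring) then (- 1) ^ i * c else 0))"
      by (intro sum.cong refl) auto
    thus ?thesis by (simp add: sum_subtractf sum.delta)
  qed
  finally have tE: "total E = (- 1) ^ i * (c - b)" by (simp add: algebra_simps)
  hence tE0: "total E \<noteq> 0" using bc by simp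
  let ?U = "{H. homogeneous s H \<and> theta ^ i * H \<in> Qker}"
  let ?G = "H - const2 (total H / total E) * E"
  have "?G \<in> ?U"
  proof (rule total_0_in_gsub[OF s(1) quotient_degree_pos quotient_forms_gsubmodule _ _ E(3)])
    show "homogeneous s ?G" by (intro homogeneous_diff homogeneous_const2_mult E H)
    show "total ?G = 0"
      using total_add[of ?G "const2 (total H / total E) * E"] tE0 by (simp add: total_const2)
  qed (use E c0 vanishing_in_Qker in auto)
  moreover have "const2 (total H / total E) * E \<in> ?U"
    using E by (intro gsub_const2[OF quotient_forms_gsubmodule]) auto
  ultimately have "?G + const2 (total H / total E) * E \<in> ?U"
    by (rule gsub_add[OF quotient_forms_gsubmodule])
  thus ?thesis by simp
qed

text \<open>Here \<open>N \<equiv> -1\<close>.  The values are those of a form of degree \<open>p - 1\<close>, so their sum is zero.  Conversely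
  \<open>binom N i\<close> is a unit, and the translates of the relation form give all functions with sum zero.\<close>

lemma Qker_iff_total:
  assumes N: "[r - i + 1 = 0] (mod CARD('p))" and H: "homogeneous s H"
  shows "theta ^ i * H \<in> Qker \<longleftrightarrow> total H = 0"
proof
  assume "theta ^ i * H \<in> Qker"
  from values_of_Qker[OF this _ N] obtain H' where H': "homogeneous (CARD('p) - 1) H'"
    "\<And>x y. (x, y) \<noteq> (0, 0) \<Longrightarrow> val x y H = val x y H'" by auto
  have "val (fst P) (snd P) H = val (fst P) (snd P) H'" for P
  proof (cases "P = (0, 0)")
    case True
    thus ?thesis using val_0_0[OF H quotient_degree_pos] val_0_0[OF H'(1) card_minus_1_pos] by simp
  next
    case False
    thus ?thesis by (intro H'(2)) (simp add: prod_eq_iff)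
  qed
  hence "total H = total H'" by (simp add: total_def)
  thus "total H = 0" using total_degree_card_minus_1[OF H'(1)] by simp
next
  assume t: "total H = 0"
  obtain E where E: "homogeneous s E" "theta ^ i * E \<in> Qker"
    "\<And>x y. (x, y) \<noteq> (0, 0) \<Longrightarrow> val x y E = (- 1) ^ i * of_nat (r - i - 1 choose i)
      + (if x \<noteq> 0 \<and> y \<noteq> 0 then (- 1) ^ i * (of_nat (i + 1) * of_nat (r - i choose i)) else 0)"
    using relation_form_quotient by blast
  have "of_nat (r - i choose i) \<noteq> (0 :: 'p mod_ring)"
  proof
    assume "of_nat (r - i choose i) = (0 :: 'p mod_ring)"
    hence "CARD('p) dvd r - i choose i" by (rule of_nat_0_mod_ring_dvd)
    then obtain j where j: "j < i" "[r - i = j] (mod CARD('p))"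
      using prime_dvd_choose_imp[OF prime_card[where 'a='p], of i] i(2) by (meson diff_le_self less_le_trans)
    hence "[j + 1 = 0] (mod CARD('p))"
      using N cong_add_rcancel_nat[of "r - i" 1 j "CARD('p)"] cong_trans cong_sym by blast
    thus False using j(1) i by (auto simp: cong_0_iff dest: dvd_imp_le)
  qed
  moreover have "of_nat (i + 1) \<noteq> (0 :: 'p mod_ring)"
    using i by (intro of_nat_mod_ring_nonzero) simp_all
  ultimately have e: "(- 1) ^ i * (of_nat (i + 1) * of_nat (r - i choose i)) \<noteq> (0 :: 'p mod_ring)" by simp
  have "H \<in> {H. homogeneous s H \<and> theta ^ i * H \<in> Qker}"
    by (rule total_0_in_gsub[OF s(1) quotient_degree_pos quotient_forms_gsubmodule _ _ E(3) e H t])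
       (use E vanishing_in_Qker in auto)
  thus "theta ^ i * H \<in> Qker" by simp
qed

text \<open>Here \<open>N \<equiv> 0\<close>, so \<open>Qker\<close> yields only constant functions, which are the zeros of \<open>dual_form\<close>.
  Conversely \<open>binom N i\<close> vanishes, so the relation form gives a constant function, and
  \<open>binom (N-1) i\<close> is a unit, so this constant is not zero.\<close>

lemma Qker_iff_dual_form:
  assumes N: "[r - i + 1 = 1] (mod CARD('p))" and H: "homogeneous s H"
  shows "theta ^ i * H \<in> Qker \<longleftrightarrow> dual_form H = 0"
proof
  assume "theta ^ i * H \<in> Qker"
  from values_of_Qker[OF this i(1) N] obtain H' where H': "homogeneous 0 H'"
    "\<And>x y. (x, y) \<noteq> (0, 0) \<Longrightarrow> val x y H = val x y H'" by auto
  have const: "val x y H' = val 1 0 H'" for x y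
    using val_scale[OF H'(1), of 0 x y] val_scale[OF H'(1), of 0 1 0] by simp
  have c: "val x y H = val 1 0 H" if "(x, y) \<noteq> (0, 0)" for x y
    using H'(2)[OF that] H'(2)[of 1 0] const[of x y] by simp
  have "total H = - val 1 0 H"
  proof -
    have "(\<Sum>y\<in>UNIV. val 1 y H) = (\<Sum>y\<in>(UNIV :: 'p mod_ring set). val 1 0 H)"
      by (intro sum.cong refl c) simp
    thus ?thesis using total_eq[OF s(1) quotient_degree_pos H] c[of 0 1] by simp
  qed
  hence "val x y (dual_form H) = 0" if "(x, y) \<noteq> (0, 0)" for x y
    using val_dual_form[OF s(1) quotient_degree_pos H that] c[OF that] by simp
  thus "dual_form H = 0" by (intro form_eq_0I[OF homogeneous_dual_form]) auto
next
  assume d: "dual_form H = 0"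
  have c: "val x y H = - total H" if "(x, y) \<noteq> (0, 0)" for x y
  proof -
    have "total H + val x y H = 0" using val_dual_form[OF s(1) quotient_degree_pos H that] d by (simp add: val_simps)
    thus ?thesis by (simp only: add_eq_0_iff)
  qed
  define b :: "'p mod_ring" where "b = (- 1) ^ i * of_nat (r - i - 1 choose i)"
  obtain E where E: "homogeneous s E" "theta ^ i * E \<in> Qker"
    "\<And>x y. (x, y) \<noteq> (0, 0) \<Longrightarrow> val x y E = b
      + (if x \<noteq> 0 \<and> y \<noteq> 0 then (- 1) ^ i * (of_nat (i + 1) * of_nat (r - i choose i)) else 0)"
    using relation_form_quotient unfolding b_def by blast
  have N0: "[r - i = 0] (mod CARD('p))"
    using N cong_add_rcancel_nat[of "r - i" 1 0 "CARD('p)"] by simp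
  have "of_nat i * of_nat (r - i choose i) = (of_nat (r - i) * of_nat (r - i - 1 choose (i - 1)) :: 'p mod_ring)"
    using times_binomial_minus1_eq[of i "r - i"] i(1) by (simp only: flip: of_nat_mult)
  moreover have "of_nat (r - i) = (0 :: 'p mod_ring)" using N0 of_nat_mod_ring_eq_iff[of "r - i" 0, where 'p='p] by simp
  moreover have "of_nat i \<noteq> (0 :: 'p mod_ring)" using i by (intro of_nat_mod_ring_nonzero) simp_all
  ultimately have z: "of_nat (r - i choose i) = (0 :: 'p mod_ring)" by simp
  have "of_nat (r - i - 1 choose i) \<noteq> (0 :: 'p mod_ring)"
  proof
    assume "of_nat (r - i - 1 choose i) = (0 :: 'p mod_ring)"
    hence "CARD('p) dvd r - i - 1 choose i" by (rule of_nat_0_mod_ring_dvd)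
    then obtain j where j: "j < i" "[r - i - 1 = j] (mod CARD('p))"
      using prime_dvd_choose_imp[OF prime_card[where 'a='p], of i] i(2) by (meson diff_le_self less_le_trans)
    have "[r - i - 1 + 1 = j + 1] (mod CARD('p))" using j(2) by (simp only: cong_add_rcancel_nat)
    moreover have "r - i - 1 + 1 = r - i" using degree_conditions(2) by simp
    ultimately have "[r - i = j + 1] (mod CARD('p))" by (simp only:)
    hence "[j + 1 = 0] (mod CARD('p))" using N0 cong_trans cong_sym by blast
    thus False using j(1) i by (auto simp: cong_0_iff dest: dvd_imp_le)
  qed
  hence b: "b \<noteq> 0" by (simp add: b_def)
  let ?U = "{H. homogeneous s H \<and> theta ^ i * H \<in> Qker}"
  have "H \<in> ?U"
  proof (rule gsub_vals_cong[OF quotient_forms_gsubmodule])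
    show "const2 (- total H / b) * E \<in> ?U"
      using E by (intro gsub_const2[OF quotient_forms_gsubmodule]) auto
    show "val x y (const2 (- total H / b) * E) = val x y H" if "(x, y) \<noteq> (0, 0)" for x y
      using b by (simp add: val_simps E(3)[OF that] c[OF that] z)
  qed (use H vanishing_in_Qker in auto)
  thus "theta ^ i * H \<in> Qker" by simp
qed

lemma Qker_only_next:
  assumes j: "2 \<le> j" "j \<le> i" "[r - i + 1 = j] (mod CARD('p))"
  shows "Qker \<inter> Vfilt r i = Vfilt r (i + 1)"
proof (intro equalityI subsetI)
  fix F assume "F \<in> Qker \<inter> Vfilt r i"
  then obtain H where H: "F = theta ^ i * H" "homogeneous s H" "theta ^ i * H \<in> Qker" "F \<in> Vfilt r i"
    using Vfilt_eq[OF r] by auto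
  have "val x y H = 0" if "(x, y) \<noteq> (0, 0)" for x y
    using values_of_Qker[OF H(3) j(2,3)] that j(1) by (auto simp: val_simps)
  then obtain K where "H = theta * K" using vanishing_form[OF H(2)] by blast
  thus "F \<in> Vfilt r (i + 1)" using H by (simp add: Vfilt_iff)
next
  fix F :: "'p mod_ring poly poly" assume F: "F \<in> Vfilt r (i + 1)"
  hence "F \<in> Vfilt r i" by (auto simp: Vfilt_iff intro: dvd_trans[OF le_imp_power_dvd])
  thus "F \<in> Qker \<inter> Vfilt r i" using Vfilt_le_Qker[OF F] by blast
qed

lemma lower_sum_eq: "Xsub r (i - 1) <+>\<^bsub>Vrep r\<^esub> Vfilt r i = Qker <+>\<^bsub>Vrep r\<^esub> Vfilt r i"
proof (intro equalityI subsetI)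
  fix F assume "F \<in> Xsub r (i - 1) <+>\<^bsub>Vrep r\<^esub> (Vfilt r i :: 'p mod_ring poly poly set)"
  then obtain a b where ab: "a \<in> Xsub r (i - 1)" "b \<in> Vfilt r i" "F = a + b" unfolding gsub_sum_iff by blast
  have "a \<in> Xsub r i" using Xsub_mono[OF i degree_conditions(1)] ab(1) by blast
  hence "a \<in> Qker" by (rule Xsub_le_Qker)
  thus "F \<in> Qker <+>\<^bsub>Vrep r\<^esub> Vfilt r i" using ab unfolding gsub_sum_iff by blast
next
  let ?U = "Xsub r (i - 1) <+>\<^bsub>Vrep r\<^esub> (Vfilt r i :: 'p mod_ring poly poly set)"
  have i1: "i - 1 \<le> r" using degree_conditions(1) by simp
  note U = gsub_sum_gsubmodule[OF Xsub_gsubmodule(1)[OF i1] Vfilt_gsubmodule[of r i, where 'p='p]]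
  have X: "Xsub r i \<subseteq> ?U"
    by (rule Xsub_least[OF U generator_in_lower_sum[OF degree_conditions(2,3) i]])
  have V: "F \<in> ?U" if "F \<in> Vfilt r i" for F
    using that by (rule gsub_sum_right[OF _ gsub_0[OF Xsub_gsubmodule(1)[OF i1]]])
  fix F assume "F \<in> Qker <+>\<^bsub>Vrep r\<^esub> Vfilt r i"
  then obtain d c where dc: "d \<in> Qker" "c \<in> Vfilt r i" "F = d + c" unfolding gsub_sum_iff by blast
  from dc(1) obtain a b where ab: "a \<in> Xsub r i" "b \<in> Vfilt r (i + 1)" "d = a + b"
    unfolding Qker_def gsub_sum_iff by blast
  have b: "b \<in> Vfilt r i" using ab(2) by (auto simp: Vfilt_iff intro: dvd_trans[OF le_imp_power_dvd])
  have a: "a \<in> ?U" using ab(1) X by blast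
  have d: "d \<in> ?U" unfolding ab(3) by (rule gsub_add[OF U a V[OF b]])
  show "F \<in> ?U" unfolding dc(3) by (rule gsub_add[OF U d V[OF dc(2)]])
qed

lemma short_exact_Qrep:
  "short_exact GL2 class_ring
    (quotient_gmodule ((Vrep r)\<lparr>carrier := Vfilt r i\<rparr>) (Qker \<inter> Vfilt r i))
    (\<lambda>S. Qker <+>\<^bsub>Vrep r\<^esub> S) (Qrep r i)
    (\<lambda>S. (Xsub r (i - 1) <+>\<^bsub>Vrep r\<^esub> Vfilt r i) <+>\<^bsub>Vrep r\<^esub> S) (Qrep r (i - 1))"
proof -
  have "i - 1 + 1 = i" using i(1) by simp
  hence Q: "Qrep r (i - 1) = quotient_gmodule (Vrep r) (Xsub r (i - 1) <+>\<^bsub>Vrep r\<^esub> Vfilt r i)"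
    "Qrep r i = quotient_gmodule (Vrep r) Qker"
    by (simp_all only: Qrep_def Qker_def)
  show ?thesis
    unfolding Q
    by (rule group_module.short_exact_quotients[OF group_module_Vrep Qker_gsubmodule Vfilt_gsubmodule lower_sum_eq])
qed

lemma iso_zero:
  assumes "\<not> [(r - i + 1) choose (i + 1) = 0] (mod CARD('p))"
  shows "gmodule_iso GL2 class_ring
    (quotient_gmodule ((Vrep r)\<lparr>carrier := Vfilt r i\<rparr>) (Qker \<inter> Vfilt r i))
    (zero_gmodule :: ('p mod_ring, unit, 'p mod_ring mat) gmodule)"
proof -
  have "Vfilt r i \<subseteq> Qker" using Qker_all[OF assms] Vfilt_eq[OF r] by auto
  hence eq: "Qker \<inter> Vfilt r i = Vfilt r i" by blast
  interpret M: group_module GL2 class_ring "(Vrep r :: ('p mod_ring, _, _) gmodule)\<lparr>carrier := Vfilt r i\<rparr>"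
    by (rule group_module.gsubmodule_restrict[OF group_module_Vrep Vfilt_gsubmodule])
  note V = Vfilt_gsubmodule[where r=r and m=i and 'p='p]
  have "gsubmodule GL2 class_ring (Vfilt r i :: 'p mod_ring poly poly set) ((Vrep r)\<lparr>carrier := Vfilt r i\<rparr>)"
    by (rule M.gsubmoduleI) (auto intro: gsub_0[OF V] gsub_add[OF V] gsub_const2[OF V] gsub_mat_act[OF V])
  then interpret J: group_submodule GL2 class_ring "(Vrep r :: ('p mod_ring, _, _) gmodule)\<lparr>carrier := Vfilt r i\<rparr>" "Vfilt r i"
    by (rule M.group_submoduleI)
  show ?thesis unfolding eq by (rule J.quotient_zero_iso) simp
qed

lemma iso_trivial:
  assumes N: "[r - i + 1 = 0] (mod CARD('p))"
  shows "gmodule_iso GL2 class_ring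
    (quotient_gmodule ((Vrep r)\<lparr>carrier := Vfilt r i\<rparr>) (Qker \<inter> Vfilt r i)) (det_twist (Vrep 0) i)"
proof (rule graded_quotient_iso[OF r, where T = "\<lambda>F. const2 (total F)"])
  fix G :: "'p mod_ring poly poly" assume "homogeneous 0 G"
  hence G: "G = const2 (coeff (coeff G 0) 0)" using homogeneous_expansion[of 0 G] by simp
  obtain F where F: "homogeneous s F" "\<forall>c. val 1 c F = 0" "val 0 1 F = - coeff (coeff G 0) 0"
    using interpolation[OF s(1) quotient_degree_pos s(2), of "\<lambda>_. 0" "- coeff (coeff G 0) 0"] by blast
  have "total F = coeff (coeff G 0) 0" using total_eq[OF s(1) quotient_degree_pos F(1)] F by simp
  thus "\<exists>F. homogeneous s F \<and> const2 (total F) = G" using F(1) G by metis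
next
  fix H :: "'p mod_ring poly poly" assume "homogeneous s H"
  from Qker_iff_total[OF N this] show "theta ^ i * H \<in> Qker \<longleftrightarrow> const2 (total H) = 0"
    by (simp add: const2_def)
qed (simp_all add: total_add total_const2 const2_simps total_mat_act mat_act_gens(1) homogeneous_const2 Qker_gsubmodule)

text \<open>For surjectivity, let \<open>F\<close> interpolate the values of a form \<open>G\<close> of degree \<open>p - 1\<close>.  Their sum is zero,
  so \<open>dual_form F\<close> has the values of \<open>F\<close> and hence of \<open>G\<close>, and forms of degree \<open>p - 1\<close> are
  determined by their values.\<close>

lemma iso_steinberg:
  assumes N: "[r - i + 1 = 1] (mod CARD('p))"
  shows "gmodule_iso GL2 class_ring
    (quotient_gmodule ((Vrep r)\<lparr>carrier := Vfilt r i\<rparr>) (Qker \<inter> Vfilt r i)) (det_twist (Vrep (CARD('p) - 1)) i)"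
proof (rule graded_quotient_iso[OF r, where T = dual_form])
  fix G :: "'p mod_ring poly poly" assume G: "homogeneous (CARD('p) - 1) G"
  obtain F where F: "homogeneous s F" "\<forall>c. val 1 c F = val 1 c G" "val 0 1 F = val 0 1 G"
    using interpolation[OF s(1) quotient_degree_pos s(2), of "\<lambda>c. val 1 c G" "val 0 1 G"] by blast
  have FG: "val x y F = val x y G" if "(x, y) \<noteq> (0, 0)" for x y
    using F(2,3) by (intro same_values[OF s(1) quotient_degree_pos F(1) G _ _ _ that]) auto
  have "total F = total G"
    using total_eq[OF s(1) quotient_degree_pos F(1)] total_eq[OF _ card_minus_1_pos G] F(2,3) by simp
  hence t: "total F = 0" using total_degree_card_minus_1[OF G] by simp
  have "dual_form F - G = 0"
  proof (rule form_eq_0I)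
    show "homogeneous (CARD('p) - 1) (dual_form F - G)"
      by (intro homogeneous_diff homogeneous_dual_form G)
    show "val x y (dual_form F - G) = 0" if "(x, y) \<noteq> (0, 0)" for x y
      using val_dual_form[OF s(1) quotient_degree_pos F(1) that] FG[OF that] t by (simp add: val_simps)
  qed simp
  thus "\<exists>F. homogeneous s F \<and> dual_form F = G" using F(1) by auto
qed (simp_all add: dual_form_add dual_form_const2 dual_form_mat_act homogeneous_dual_form Qker_gsubmodule
    Qker_iff_dual_form[OF N] del: One_nat_def)

end

theorem theorem1p8:
  fixes p r a r0 i :: nat
  assumes "p = CARD('p::prime_card)" and "p \<ge> 3"
    and "[r = a] (mod (p - 1))" and "1 \<le> a" and "a \<le> p - 1"
    and "[r = r0] (mod p)" and "r0 \<le> p - 1"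
    and "1 \<le> i" and "i < p - 1" and "i = bracket p (int a - int i)"
    and "r \<ge> i * (p + 1) + p"
  shows "\<exists>(W :: ('p mod_ring, 'p mod_ring poly poly set, 'p mod_ring mat) gmodule) \<phi> \<psi>.
    short_exact GL2 class_ring W \<phi> (Qrep r i :: (_, 'p mod_ring poly poly set, _) gmodule)
      \<psi> (Qrep r (i - 1) :: (_, 'p mod_ring poly poly set, _) gmodule) \<and>
    (if \<not> [(r - i + 1) choose (i + 1) = 0] (mod p)
       then gmodule_iso GL2 class_ring W (zero_gmodule :: ('p mod_ring, unit, 'p mod_ring mat) gmodule)
     else if r0 = i
       then gmodule_iso GL2 class_ring W (det_twist (Vrep (p - 1)) i)
     else if r0 = i - 1
       then gmodule_iso GL2 class_ring W (det_twist (Vrep 0) i)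
     else gmodule_iso GL2 class_ring W (Vgraded r i))"
proof -
  define s where "s = r - i * (p + 1)"
  have r: "r = s + i * (CARD('p) + 1)" using assms(1,11) by (simp add: s_def)
  have s2: "CARD('p) \<le> s" using assms(1,11) by (simp add: s_def)
  have ii: "1 \<le> i" "i < CARD('p) - 1" using assms by auto
  have "[int i = int a - int i] (mod int (p - 1))"
    using bracket_cong[OF assms(2), of "int a - int i"] assms(10) by simp
  hence "[int i + int i = int a] (mod int (p - 1))"
    using cong_add[OF _ cong_refl[of "int i"]] by fastforce
  hence "[i + i = a] (mod (p - 1))" by (simp flip: cong_int_iff)
  hence "[r = i + i] (mod (p - 1))" using assms(3) cong_trans cong_sym by blast
  moreover have "r = s + i * (p - 1) + (i + i)"
  proof -
    obtain q where "p = q + 1" using assms(2) by (metis Suc_eq_plus1 Suc_le_D numeral_3_eq_3)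
    thus ?thesis using r unfolding assms(1)[symmetric] by (simp add: algebra_simps)
  qed
  ultimately have "[s + i * (p - 1) + (i + i) = 0 + (i + i)] (mod (p - 1))" by simp
  hence "[s + i * (p - 1) = 0] (mod (p - 1))" by (simp only: cong_add_rcancel_nat)
  hence s1: "CARD('p) - 1 dvd s" using assms(1) by (simp add: cong_0_iff)
  note ctx = r ii s1 s2
  define Qker :: "'p mod_ring poly poly set" where "Qker = Xsub r i <+>\<^bsub>Vrep r\<^esub> Vfilt r (i + 1)"
  define W where "W = quotient_gmodule ((Vrep r)\<lparr>carrier := Vfilt r i\<rparr>) (Qker \<inter> Vfilt r i)"
  have r0: "[r - i + 1 = j] (mod p) \<longleftrightarrow> [r0 + 1 = i + j] (mod p)" for j
  proof -
    have "[r - i + 1 = j] (mod p) \<longleftrightarrow> [(r - i + 1) + i = j + i] (mod p)" by (simp only: cong_add_rcancel_nat)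
    also have "(r - i + 1) + i = r + 1" using r by simp
    also have "[r + 1 = j + i] (mod p) \<longleftrightarrow> [r0 + 1 = j + i] (mod p)"
      using assms(6) by (meson cong_add_rcancel_nat cong_sym cong_trans)
    finally show ?thesis by (simp only: add.commute)
  qed
  have exact: "short_exact GL2 class_ring W (\<lambda>S. Qker <+>\<^bsub>Vrep r\<^esub> S) (Qrep r i)
    (\<lambda>S. (Xsub r (i - 1) <+>\<^bsub>Vrep r\<^esub> Vfilt r i) <+>\<^bsub>Vrep r\<^esub> S) (Qrep r (i - 1))"
    unfolding W_def Qker_def by (rule short_exact_Qrep[OF ctx])
  have iso0: "gmodule_iso GL2 class_ring W (zero_gmodule :: ('p mod_ring, unit, 'p mod_ring mat) gmodule)"
    if "\<not> [(r - i + 1) choose (i + 1) = 0] (mod p)"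
    unfolding W_def Qker_def using that assms(1) by (intro iso_zero[OF ctx]) simp
  have iso1: "gmodule_iso GL2 class_ring W (det_twist (Vrep (p - 1)) i)" if "r0 = i"
  proof -
    have "[r - i + 1 = 1] (mod p)" using that by (simp only: r0 cong_refl)
    thus ?thesis unfolding W_def Qker_def assms(1) by (rule iso_steinberg[OF ctx])
  qed
  have iso2: "gmodule_iso GL2 class_ring W (det_twist (Vrep 0) i)" if "r0 = i - 1"
  proof -
    have "[r - i + 1 = 0] (mod p)" using that assms(8) unfolding r0 by simp
    thus ?thesis unfolding W_def Qker_def assms(1) by (rule iso_trivial[OF ctx])
  qed
  have iso3: "gmodule_iso GL2 class_ring W (Vgraded r i)"
    if b: "[(r - i + 1) choose (i + 1) = 0] (mod p)" and ne: "r0 \<noteq> i" "r0 \<noteq> i - 1"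
  proof -
    have "prime p" "i + 1 < p" using prime_card[where 'a='p] assms by auto
    with prime_dvd_choose_imp[of p "i + 1" "r - i + 1"] b
    obtain j where j: "j < i + 1" "[r - i + 1 = j] (mod p)" by (auto simp: cong_0_iff)
    have inj: "m = n" if "[m + 1 = n + 1] (mod p)" "m \<le> p - 1" "n \<le> p - 1" for m n
      using that assms(2) by (simp only: cong_add_rcancel_nat) (simp add: cong_def)
    have "j \<noteq> 0"
    proof
      assume "j = 0"
      hence "[r0 + 1 = (i - 1) + 1] (mod p)" using j(2) assms(8) unfolding r0 by simp
      thus False using inj[of r0 "i - 1"] assms(7,9) ne(2) by simp
    qed
    moreover have "j \<noteq> 1"
    proof
      assume "j = 1"
      hence "[r0 + 1 = i + 1] (mod p)" using j(2) unfolding r0 by simp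
      thus False using inj[of r0 i] assms(7,9) ne(1) by simp
    qed
    ultimately have "Qker \<inter> Vfilt r i = Vfilt r (i + 1)"
      using j unfolding Qker_def assms(1) by (intro Qker_only_next[OF ctx, of j]) auto
    thus ?thesis unfolding W_def Vgraded_def by (simp add: gmodule_iso_refl)
  qed
  show ?thesis
    by (rule exI[of _ W], rule exI, rule exI, rule conjI, rule exact)
       (simp only: split: if_split, use iso0 iso1 iso2 iso3 in blast)
qed

end
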